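(* Let $D$ be a division ring whose complete theory (in the language of rings) is superrosy. Then $D$ has finite dimension (as a vector space) over its center $Z(D)$.
   Context: A complete first-order theory is superrosy if it is rosy and every type has ordinal-valued $U^{\text{þ}}$-rank (equivalently, thorn-forking gives an ordinal-valued rank on types in the imaginary expansion). *)

theory Defs
  imports "HOL-Algebra.Embedded_Algebras" "HOL-Library.Countable_Set"
begin

unbundle cardinal_syntax

section \<open>Division rings and their centers\<close>

locale skew_field = ring R for R (structure) +
  assumes skew_field_Units: "Units R = carrier R - {\<zero>}"

definition ring_center :: "('a, 'b) ring_scheme \<Rightarrow> 'a set" where
  "ring_center R = {z \<in> carrier R. \<forall>x \<in> carrier R. z \<otimes>\<^bsub>R\<^esub> x = x \<otimes>\<^bsub>R\<^esub> z}"

lemma (in skew_field) subfield_ring_center: "subfield (ring_center R) R"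
proof (rule subfieldI)
  have z: "\<And>z. z \<in> ring_center R \<Longrightarrow> z \<in> carrier R"
    and comm: "\<And>z x. \<lbrakk>z \<in> ring_center R; x \<in> carrier R\<rbrakk> \<Longrightarrow> z \<otimes> x = x \<otimes> z"
    by (auto simp: ring_center_def)
  have mult: "a \<otimes> b \<in> ring_center R" if a: "a \<in> ring_center R" and b: "b \<in> ring_center R" for a b
  proof -
    have "(a \<otimes> b) \<otimes> x = x \<otimes> (a \<otimes> b)" if "x \<in> carrier R" for x
      using z[OF a] z[OF b] comm[OF a that] comm[OF b that] that by (metis m_assoc)
    then show ?thesis using z[OF a] z[OF b] by (simp add: ring_center_def)
  qed
  have sub: "subring (ring_center R) R"
  proof (rule subringI)
    show "ring_center R \<subseteq> carrier R" "\<one> \<in> ring_center R"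
      by (auto simp: ring_center_def)
    show "\<ominus> h \<in> ring_center R" if "h \<in> ring_center R" for h
      using that by (auto simp: ring_center_def l_minus r_minus)
    show "h \<oplus> k \<in> ring_center R" if "h \<in> ring_center R" "k \<in> ring_center R" for h k
      using that by (auto simp: ring_center_def l_distr r_distr)
  qed (rule mult)
  show "subcring (ring_center R) R"
    using sub z comm by (simp add: subcringI)
  show "Units (R\<lparr>carrier := ring_center R\<rparr>) = ring_center R - {\<zero>}"
  proof
    have "x \<in> Units R" if "x \<in> Units (R\<lparr>carrier := ring_center R\<rparr>)" for x
      using that z by (auto simp: Units_def)
    then show "Units (R\<lparr>carrier := ring_center R\<rparr>) \<subseteq> ring_center R - {\<zero>}"
      using skew_field_Units by (auto simp: Units_def)
    show "ring_center R - {\<zero>} \<subseteq> Units (R\<lparr>carrier := ring_center R\<rparr>)"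
    proof
      fix x assume x: "x \<in> ring_center R - {\<zero>}"
      then have u: "x \<in> Units R" using skew_field_Units z by auto
      have "inv x \<otimes> y = y \<otimes> inv x" if y: "y \<in> carrier R" for y
      proof -
        have "inv x \<otimes> y = inv x \<otimes> (y \<otimes> x) \<otimes> inv x"
          using u y by (simp add: m_assoc Units_closed Units_r_inv)
        also have "\<dots> = inv x \<otimes> (x \<otimes> y) \<otimes> inv x"
          using x y comm[of x y] by simp
        also have "\<dots> = y \<otimes> inv x"
          using u y by (simp add: m_assoc[symmetric] Units_closed Units_l_inv)
        finally show ?thesis .
      qed
      then have "inv x \<in> ring_center R" using u by (simp add: ring_center_def)
      then show "x \<in> Units (R\<lparr>carrier := ring_center R\<rparr>)"
        using x u by (auto simp: Units_def[of "R\<lparr>carrier := ring_center R\<rparr>"]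
            intro!: bexI[of _ "inv x"])
    qed
  qed
qed

section \<open>First-order logic in the language of rings\<close>

datatype rterm =
    Var nat
  | Zero
  | One
  | Add rterm rterm
  | Minus rterm
  | Mult rterm rterm

datatype rform =
    Equal rterm rterm
  | Neg rform
  | And rform rform
  | Exists nat rform

primrec tvars :: "rterm \<Rightarrow> nat set" where
  "tvars (Var i) = {i}"
| "tvars Zero = {}"
| "tvars One = {}"
| "tvars (Add t u) = tvars t \<union> tvars u"
| "tvars (Minus t) = tvars t"
| "tvars (Mult t u) = tvars t \<union> tvars u"

primrec fvars :: "rform \<Rightarrow> nat set" where
  "fvars (Equal t u) = tvars t \<union> tvars u"
| "fvars (Neg \<phi>) = fvars \<phi>"
| "fvars (And \<phi> \<psi>) = fvars \<phi> \<union> fvars \<psi>"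
| "fvars (Exists i \<phi>) = fvars \<phi> - {i}"

primrec teval :: "('m, 'b) ring_scheme \<Rightarrow> (nat \<Rightarrow> 'm) \<Rightarrow> rterm \<Rightarrow> 'm" where
  "teval M v (Var i) = v i"
| "teval M v Zero = \<zero>\<^bsub>M\<^esub>"
| "teval M v One = \<one>\<^bsub>M\<^esub>"
| "teval M v (Add t u) = teval M v t \<oplus>\<^bsub>M\<^esub> teval M v u"
| "teval M v (Minus t) = \<ominus>\<^bsub>M\<^esub> teval M v t"
| "teval M v (Mult t u) = teval M v t \<otimes>\<^bsub>M\<^esub> teval M v u"

primrec sat :: "('m, 'b) ring_scheme \<Rightarrow> (nat \<Rightarrow> 'm) \<Rightarrow> rform \<Rightarrow> bool" where
  "sat M v (Equal t u) \<longleftrightarrow> teval M v t = teval M v u"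
| "sat M v (Neg \<phi>) \<longleftrightarrow> \<not> sat M v \<phi>"
| "sat M v (And \<phi> \<psi>) \<longleftrightarrow> sat M v \<phi> \<and> sat M v \<psi>"
| "sat M v (Exists i \<phi>) \<longleftrightarrow> (\<exists>a \<in> carrier M. sat M (v(i := a)) \<phi>)"

definition ring_theory :: "('m, 'b) ring_scheme \<Rightarrow> rform set" where
  "ring_theory M = {\<phi>. fvars \<phi> = {} \<and> sat M (\<lambda>_. \<zero>\<^bsub>M\<^esub>) \<phi>}"

definition ring_language_structure :: "('m, 'b) ring_scheme \<Rightarrow> bool" where
  "ring_language_structure M \<longleftrightarrow>
     \<zero>\<^bsub>M\<^esub> \<in> carrier M \<and> \<one>\<^bsub>M\<^esub> \<in> carrier M \<and>
     (\<forall>x \<in> carrier M. \<ominus>\<^bsub>M\<^esub> x \<in> carrier M) \<and>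
     (\<forall>x \<in> carrier M. \<forall>y \<in> carrier M.
        x \<oplus>\<^bsub>M\<^esub> y \<in> carrier M \<and> x \<otimes>\<^bsub>M\<^esub> y \<in> carrier M)"

definition is_model :: "('m, 'b) ring_scheme \<Rightarrow> rform set \<Rightarrow> bool" where
  "is_model M T \<longleftrightarrow> ring_language_structure M \<and> T \<subseteq> ring_theory M"

section \<open>Monster models\<close>

text \<open>Throughout, a formula with parameters \<open>\<phi>(x, b)\<close> is a pair \<open>(\<phi>, b)\<close>: if \<open>x\<close> is a tuple of
  length \<open>n\<close>, the variables \<open>0, \<dots>, n - 1\<close> of \<open>\<phi>\<close> stand for \<open>x\<close> and the next \<open>length b\<close>
  variables stand for the parameters, so that \<open>\<phi>(a, b)\<close> is evaluated at the list \<open>a @ b\<close>.\<close>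

definition saturated :: "'k rel \<Rightarrow> ('m, 'b) ring_scheme \<Rightarrow> bool" where
  "saturated \<kappa> M \<longleftrightarrow>
     (\<forall>A \<Phi>. A \<subseteq> carrier M \<and> |A| <o \<kappa> \<and>
        \<Phi> \<subseteq> {(\<phi>, b). b \<in> lists A \<and> fvars \<phi> \<subseteq> {..<1 + length b}} \<and>
        (\<forall>F \<subseteq> \<Phi>. finite F \<longrightarrow> (\<exists>a \<in> carrier M. \<forall>(\<phi>, b) \<in> F. sat M (nth ([a] @ b)) \<phi>))
        \<longrightarrow> (\<exists>a \<in> carrier M. \<forall>(\<phi>, b) \<in> \<Phi>. sat M (nth ([a] @ b)) \<phi>))"

definition partial_elementary ::
    "('m, 'b) ring_scheme \<Rightarrow> 'm set \<Rightarrow> ('m \<Rightarrow> 'm) \<Rightarrow> bool" where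
  "partial_elementary M A f \<longleftrightarrow>
     A \<subseteq> carrier M \<and> f ` A \<subseteq> carrier M \<and>
     (\<forall>b \<in> lists A. \<forall>\<phi>. fvars \<phi> \<subseteq> {..<length b} \<longrightarrow>
        (sat M (nth b) \<phi> \<longleftrightarrow> sat M (nth (map f b)) \<phi>))"

definition strongly_homogeneous :: "'k rel \<Rightarrow> ('m, 'b) ring_scheme \<Rightarrow> bool" where
  "strongly_homogeneous \<kappa> M \<longleftrightarrow>
     (\<forall>A f. |A| <o \<kappa> \<and> partial_elementary M A f \<longrightarrow>
        (\<exists>h \<in> ring_iso M M. \<forall>a \<in> A. h a = f a))"

text \<open>A set is small if its cardinality is below \<open>\<kappa>\<close>. As the language is countable,
  \<open>cardSuc natLeq\<close> is the cardinal successor of the cardinality of the theory; smaller \<open>\<kappa>\<close> would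
  make local character (see \<open>rosy\<close> below) a void condition.\<close>

definition monster :: "'k rel \<Rightarrow> ('m, 'b) ring_scheme \<Rightarrow> bool" where
  "monster \<kappa> M \<longleftrightarrow>
     Card_order \<kappa> \<and> cardSuc natLeq <o \<kappa> \<and> saturated \<kappa> M \<and> strongly_homogeneous \<kappa> M"

section \<open>The imaginary expansion\<close>

text \<open>\<open>Imag n E\<close> is the sort of the classes of \<open>n\<close>-tuples modulo the equivalence relation defined
  by \<open>E\<close> without parameters; the variables \<open>0, \<dots>, n - 1\<close> of \<open>E\<close> stand for the first tuple and
  \<open>n, \<dots>, 2n - 1\<close> for the second one. The sort is empty if \<open>E\<close> does not define an equivalence
  relation on \<open>n\<close>-tuples. The class carries its sort, so distinct sorts are disjoint.\<close>

datatype sort = Home | Imag nat rform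

datatype 'm el = Real (un_Real: 'm) | Class nat rform "'m list set"

primrec sort_of :: "'m el \<Rightarrow> sort" where
  "sort_of (Real a) = Home"
| "sort_of (Class n E C) = Imag n E"

definition home_tuples :: "('m, 'b) ring_scheme \<Rightarrow> nat \<Rightarrow> 'm list set" where
  "home_tuples M n = {xs \<in> lists (carrier M). length xs = n}"

definition defined_rel :: "('m, 'b) ring_scheme \<Rightarrow> nat \<Rightarrow> rform \<Rightarrow> 'm list rel" where
  "defined_rel M n E =
     {(xs, ys). xs \<in> home_tuples M n \<and> ys \<in> home_tuples M n \<and> sat M (nth (xs @ ys)) E}"

definition eq_els :: "('m, 'b) ring_scheme \<Rightarrow> 'm el set" where
  "eq_els M = Real ` carrier M \<union>
     {Class n E C | n E C. fvars E \<subseteq> {..<2 * n} \<and> equiv (home_tuples M n) (defined_rel M n E) \<and>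
        C \<in> home_tuples M n // defined_rel M n E}"

text \<open>Formulas of the expansion. The atomic ones are equations between ring terms in variables of
  the home sort, equations between two variables (of any sort), and \<open>IProj n E ts j\<close>, saying that
  the \<open>j\<close>-th variable is the image of the \<open>n\<close>-tuple \<open>ts\<close> under the projection to \<open>Imag n E\<close>.
  Every quantifier ranges over a single sort. Free variables are not declared with a sort; they get
  one from the element assigned to them, and an ill-sorted atomic formula is false. Hence, on tuples
  of a fixed list of sorts, these formulas define exactly what the well-sorted ones do.\<close>

datatype ieq_form =
    IEqual rterm rterm
  | ISame nat nat
  | IProj nat rform "rterm list" nat
  | INeg ieq_form
  | IAnd ieq_form ieq_form
  | IEx sort nat ieq_form

primrec ifvars :: "ieq_form \<Rightarrow> nat set" where
  "ifvars (IEqual t u) = tvars t \<union> tvars u"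
| "ifvars (ISame i j) = {i, j}"
| "ifvars (IProj n E ts j) = insert j (\<Union>t \<in> set ts. tvars t)"
| "ifvars (INeg \<phi>) = ifvars \<phi>"
| "ifvars (IAnd \<phi> \<psi>) = ifvars \<phi> \<union> ifvars \<psi>"
| "ifvars (IEx s i \<phi>) = ifvars \<phi> - {i}"

primrec isat :: "('m, 'b) ring_scheme \<Rightarrow> (nat \<Rightarrow> 'm el) \<Rightarrow> ieq_form \<Rightarrow> bool" where
  "isat M v (IEqual t u) \<longleftrightarrow>
     (\<forall>i \<in> tvars t \<union> tvars u. sort_of (v i) = Home) \<and>
     teval M (un_Real \<circ> v) t = teval M (un_Real \<circ> v) u"
| "isat M v (ISame i j) \<longleftrightarrow> v i = v j"
| "isat M v (IProj n E ts j) \<longleftrightarrow>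
     length ts = n \<and> (\<forall>t \<in> set ts. \<forall>i \<in> tvars t. sort_of (v i) = Home) \<and>
     v j = Class n E (defined_rel M n E `` {map (teval M (un_Real \<circ> v)) ts})"
| "isat M v (INeg \<phi>) \<longleftrightarrow> \<not> isat M v \<phi>"
| "isat M v (IAnd \<phi> \<psi>) \<longleftrightarrow> isat M v \<phi> \<and> isat M v \<psi>"
| "isat M v (IEx s i \<phi>) \<longleftrightarrow> (\<exists>a \<in> eq_els M. sort_of a = s \<and> isat M (v(i := a)) \<phi>)"

definition eq_tuples :: "('m, 'b) ring_scheme \<Rightarrow> sort list \<Rightarrow> 'm el list set" where
  "eq_tuples M \<sigma> = {a \<in> lists (eq_els M). map sort_of a = \<sigma>}"

definition holds :: "('m, 'b) ring_scheme \<Rightarrow> ieq_form \<Rightarrow> 'm el list \<Rightarrow> 'm el list \<Rightarrow> bool" where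
  "holds M \<phi> a b \<longleftrightarrow> isat M (nth (a @ b)) \<phi>"

section \<open>Types\<close>

type_synonym 'm type_over = "(ieq_form \<times> 'm el list) set"

definition tp :: "('m, 'b) ring_scheme \<Rightarrow> 'm el list \<Rightarrow> 'm el set \<Rightarrow> 'm type_over" where
  "tp M a A =
     {(\<phi>, b). b \<in> lists A \<and> ifvars \<phi> \<subseteq> {..<length a + length b} \<and> holds M \<phi> a b}"

definition small :: "'k rel \<Rightarrow> ('m, 'b) ring_scheme \<Rightarrow> 'm el set \<Rightarrow> bool" where
  "small \<kappa> M A \<longleftrightarrow> A \<subseteq> eq_els M \<and> |A| <o \<kappa>"

text \<open>The complete types over \<open>A\<close> in variables of sorts \<open>\<sigma>\<close>. Used for small \<open>A\<close> in a monster model,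
  where all such types are realized.\<close>

definition complete_types ::
    "('m, 'b) ring_scheme \<Rightarrow> sort list \<Rightarrow> 'm el set \<Rightarrow> 'm type_over set" where
  "complete_types M \<sigma> A = (\<lambda>a. tp M a A) ` eq_tuples M \<sigma>"

definition algebraic :: "('m, 'b) ring_scheme \<Rightarrow> sort list \<Rightarrow> 'm type_over \<Rightarrow> bool" where
  "algebraic M \<sigma> p \<longleftrightarrow> (\<exists>(\<phi>, b) \<in> p. finite {a \<in> eq_tuples M \<sigma>. holds M \<phi> a b})"

section \<open>Thorn-forking\<close>

text \<open>\<open>{\<phi>(x, a). a \<in> Y}\<close> is \<open>k\<close>-inconsistent, with \<open>x\<close> of sorts \<open>\<sigma>\<close>.\<close>

definition k_inconsistent ::
    "('m, 'b) ring_scheme \<Rightarrow> sort list \<Rightarrow> ieq_form \<Rightarrow> 'm el list set \<Rightarrow> nat \<Rightarrow> bool" where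
  "k_inconsistent M \<sigma> \<phi> Y k \<longleftrightarrow>
     (\<forall>F \<subseteq> Y. finite F \<and> card F = k \<longrightarrow> \<not> (\<exists>x \<in> eq_tuples M \<sigma>. \<forall>a \<in> F. holds M \<phi> x a))"

definition strongly_divides ::
    "('m, 'b) ring_scheme \<Rightarrow> sort list \<Rightarrow> ieq_form \<Rightarrow> 'm el list \<Rightarrow> 'm el set \<Rightarrow> bool" where
  "strongly_divides M \<sigma> \<phi> a A \<longleftrightarrow>
     a \<in> lists (eq_els M) \<and> ifvars \<phi> \<subseteq> {..<length \<sigma> + length a} \<and>
     \<not> algebraic M (map sort_of a) (tp M a A) \<and>
     (\<exists>k. k_inconsistent M \<sigma> \<phi> {a' \<in> eq_tuples M (map sort_of a). tp M a' A = tp M a A} k)"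

definition thorn_divides ::
    "('m, 'b) ring_scheme \<Rightarrow> sort list \<Rightarrow> ieq_form \<Rightarrow> 'm el list \<Rightarrow> 'm el set \<Rightarrow> bool" where
  "thorn_divides M \<sigma> \<phi> a A \<longleftrightarrow>
     (\<exists>c \<in> lists (eq_els M). strongly_divides M \<sigma> \<phi> a (A \<union> set c))"

definition thorn_forks ::
    "('m, 'b) ring_scheme \<Rightarrow> sort list \<Rightarrow> ieq_form \<Rightarrow> 'm el list \<Rightarrow> 'm el set \<Rightarrow> bool" where
  "thorn_forks M \<sigma> \<phi> a A \<longleftrightarrow>
     (\<exists>\<Psi>. finite \<Psi> \<and> (\<forall>(\<psi>, d) \<in> \<Psi>. thorn_divides M \<sigma> \<psi> d A) \<and>
        (\<forall>x \<in> eq_tuples M \<sigma>. holds M \<phi> x a \<longrightarrow> (\<exists>(\<psi>, d) \<in> \<Psi>. holds M \<psi> x d)))"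

text \<open>Complete types are closed under implication, so it is enough to look at their members.\<close>

definition type_thorn_forks ::
    "('m, 'b) ring_scheme \<Rightarrow> sort list \<Rightarrow> 'm type_over \<Rightarrow> 'm el set \<Rightarrow> bool" where
  "type_thorn_forks M \<sigma> p A \<longleftrightarrow> (\<exists>(\<phi>, b) \<in> p. thorn_forks M \<sigma> \<phi> b A)"

section \<open>Rosy and superrosy theories\<close>

text \<open>Rosiness: thorn-forking in the imaginary expansion has local character. The theory is
  countable, so the bound on the size of the base set is countability.\<close>

definition rosy :: "'k rel \<Rightarrow> ('m, 'b) ring_scheme \<Rightarrow> bool" where
  "rosy \<kappa> M \<longleftrightarrow>
     (\<forall>\<sigma> B. small \<kappa> M B \<longrightarrow> (\<forall>p \<in> complete_types M \<sigma> B.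
        \<exists>A \<subseteq> B. countable A \<and> \<not> type_thorn_forks M \<sigma> p A))"

definition thorn_forking_extension ::
    "'k rel \<Rightarrow> ('m, 'b) ring_scheme \<Rightarrow> 'm type_over \<Rightarrow> 'm type_over \<Rightarrow> bool" where
  "thorn_forking_extension \<kappa> M p q \<longleftrightarrow>
     (\<exists>\<sigma> A B. small \<kappa> M A \<and> small \<kappa> M B \<and> A \<subseteq> B \<and>
        p \<in> complete_types M \<sigma> A \<and> q \<in> complete_types M \<sigma> B \<and> p \<subseteq> q \<and>
        type_thorn_forks M \<sigma> q A)"

text \<open>\<open>U_thorn_ge \<kappa> M r \<alpha> p\<close> says that the thorn U-rank of \<open>p\<close> is at least \<open>\<alpha>\<close>, where an ordinal is
  given as an element \<open>\<alpha>\<close> of a well-order \<open>r\<close> (the ordinal being the order type of the set of its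
  strict predecessors). The single clause, that for each \<open>\<beta> < \<alpha>\<close> some thorn-forking extension of
  \<open>p\<close> has rank at least \<open>\<beta>\<close>, amounts to the usual clauses for zero, successors and limits. It is
  a recursion along \<open>r\<close>, so on well-orders it has only one solution.\<close>

inductive U_thorn_ge ::
    "'k rel \<Rightarrow> ('m, 'b) ring_scheme \<Rightarrow> 'o rel \<Rightarrow> 'o \<Rightarrow> 'm type_over \<Rightarrow> bool"
  for \<kappa> M r where
  "(\<And>\<beta>. (\<beta>, \<alpha>) \<in> r - Id \<Longrightarrow> \<exists>q. thorn_forking_extension \<kappa> M p q \<and> U_thorn_ge \<kappa> M r \<beta> q)
     \<Longrightarrow> U_thorn_ge \<kappa> M r \<alpha> p"

text \<open>The rank is ordinal-valued if it is not at least \<open>\<alpha>\<close> for some ordinal \<open>\<alpha>\<close>. Well-orders on the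
  (infinite) type of all types suffice: the ordinals occurring as ranks of types form an initial
  segment of the ordinals, hence each of them has at most as many predecessors as there are types.\<close>

definition U_thorn_ordinal_valued ::
    "'k rel \<Rightarrow> ('m, 'b) ring_scheme \<Rightarrow> 'm type_over \<Rightarrow> bool" where
  "U_thorn_ordinal_valued \<kappa> M p \<longleftrightarrow>
     (\<exists>(r :: 'm type_over rel) \<alpha>. Well_order r \<and> \<alpha> \<in> Field r \<and> \<not> U_thorn_ge \<kappa> M r \<alpha> p)"

text \<open>A complete theory is superrosy if this is so as computed in a monster model; which one does not
  matter. The type argument says where the elements of the monster model live. For the theory of
  a division ring in type \<open>'a\<close>, there is always a monster model in \<open>nat set \<Rightarrow> 'a\<close> (\<open>\<kappa>\<close> being the
  second uncountable cardinal). Taking \<open>\<kappa>\<close> on that same type is no restriction, as \<open>\<kappa>\<close>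
  does not exceed the cardinality of an infinite \<open>\<kappa>\<close>-saturated structure.\<close>

definition superrosy :: "'m itself \<Rightarrow> rform set \<Rightarrow> bool" where
  "superrosy TYPE('m) T \<longleftrightarrow>
     (\<exists>(M :: 'm ring) (\<kappa> :: 'm rel). is_model M T \<and> monster \<kappa> M \<and> rosy \<kappa> M \<and>
        (\<forall>\<sigma> A. small \<kappa> M A \<longrightarrow> (\<forall>p \<in> complete_types M \<sigma> A. U_thorn_ordinal_valued \<kappa> M p)))"

end

theory Submission
  imports Defs "HOL-Library.Countable_Set_Type" "HOL-Computational_Algebra.Primes"
begin

text \<open>Superrosiness is used through the absence of infinite thorn-forking chains, which excludes
  two configurations: descending chains of definable additive subgroups with infinite successive
  indices, and finite-to-one correspondences from a definable set \<open>A\<close> onto \<open>A \<times> N\<close> with \<open>N\<close>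
  infinite and definable. Let \<open>K\<close> be an infinite noncommutative centralizer in a monster model and
  suppose that \<open>K\<close> is infinite dimensional over the centralizer of each of its noncentral elements. By the chain
  condition the inner derivation of a noncentral element is onto \<open>K\<close>, so \<open>[a, y] = 1\<close> is solvable.
  It is enough to find for each noncentral \<open>a\<close> a noncentral \<open>h\<close> with a strictly larger centralizer,
  as the bicentralizers would form a descending chain. In characteristic \<open>p\<close> this follows
  from taking \<open>p\<close>-th powers. In characteristic 0 one shows that each noncentral \<open>b\<close> is conjugate to
  \<open>b + 1\<close>, hence \<open>a\<close> to \<open>- 1 / a\<close>, and takes \<open>h = a - 1 / a\<close>. To prove the conjugacy, one looks at the
  derivation \<open>[-, b]\<close> of a commutative bicentralizer \<open>C\<close>: if 1 is not a logarithmic derivative,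
  then the logarithmic derivatives are so small in \<open>C\<close> that a finite dimensional \<open>C\<close>-space \<open>A\<close>
  absorbs a further copy of \<open>C\<close>. So the assumption fails, and by the chain condition the monster
  model is finite dimensional over a commutative subfield. This bounds its
  dimension over the center, and the bound is a first-order statement.\<close>

section \<open>Definable relations\<close>

text \<open>Only types of single elements are used. An ordinal-valued rank gives no number to count
  with, so each excluded configuration is turned into an infinite sequence of conditions on one
  element, each of them thorn-dividing over the parameters of the earlier ones. Two things make this
  possible: the algebraic closure of a countable set is countable, while infinite definable families
  in a monster model are uncountable, so that a nonalgebraic next parameter always exists; and
  cosets of a definable group have codes among the imaginaries, so that they can serve as
  parameters. The subgroup condition is applied to left vector spaces over infinite division rings,
  where every proper inclusion has infinite index. This is why centralizers must be shown to be
  infinite. In characteristic 0 the obstacle is that a logarithmic derivative determines an element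
  only up to a constant factor. The powers of an element with derivative 1 are independent over the
  constants; multiplying by suitable ones makes finitely many nonzero elements independent, and one
  further datum, the logarithmic derivative of their sum, then fixes all factors.\<close>

lemma teval_cong: "(\<And>i. i \<in> tvars t \<Longrightarrow> v i = w i) \<Longrightarrow> teval M v t = teval M w t"
  by (induction t) auto

lemma sat_cong: "(\<And>i. i \<in> fvars \<phi> \<Longrightarrow> v i = w i) \<Longrightarrow> sat M v \<phi> = sat M w \<phi>"
proof (induction \<phi> arbitrary: v w)
  case (Equal t u)
  then have "teval M v t = teval M w t" "teval M v u = teval M w u"
    by (auto intro: teval_cong)
  then show ?case by simp
next
  case (Neg \<phi>)
  then show ?case by (metis fvars.simps(2) sat.simps(2))
next
  case (And \<phi> \<psi>)
  then show ?case by (metis UnI1 UnI2 fvars.simps(3) sat.simps(3))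
next
  case (Exists i \<phi>)
  have "sat M (v(i := a)) \<phi> = sat M (w(i := a)) \<phi>" for a
    using Exists.prems by (intro Exists.IH) auto
  then show ?case by simp
qed

lemma finite_tvars: "finite (tvars t)"
  by (induction t) auto

lemma finite_fvars: "finite (fvars \<phi>)"
  by (induction \<phi>) (auto simp: finite_tvars)

section \<open>Renaming of variables\<close>

primrec tren :: "(nat \<Rightarrow> nat) \<Rightarrow> rterm \<Rightarrow> rterm" where
  "tren f (Var i) = Var (f i)"
| "tren f Zero = Zero"
| "tren f One = One"
| "tren f (Add t u) = Add (tren f t) (tren f u)"
| "tren f (Minus t) = Minus (tren f t)"
| "tren f (Mult t u) = Mult (tren f t) (tren f u)"

primrec fren :: "(nat \<Rightarrow> nat) \<Rightarrow> rform \<Rightarrow> rform" where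
  "fren f (Equal t u) = Equal (tren f t) (tren f u)"
| "fren f (Neg \<phi>) = Neg (fren f \<phi>)"
| "fren f (And \<phi> \<psi>) = And (fren f \<phi>) (fren f \<psi>)"
| "fren f (Exists i \<phi>) = Exists (f i) (fren f \<phi>)"

lemma teval_tren: "teval M v (tren f t) = teval M (v \<circ> f) t"
  by (induction t) auto

lemma sat_fren: "inj f \<Longrightarrow> sat M v (fren f \<phi>) = sat M (v \<circ> f) \<phi>"
proof (induction \<phi> arbitrary: v)
  case (Exists i \<phi>)
  have "\<And>a. (v(f i := a)) \<circ> f = (v \<circ> f)(i := a)"
    using Exists.prems by (auto simp: inj_def)
  then show ?case unfolding fren.simps sat.simps Exists.IH[OF Exists.prems] by (simp only:)
qed (auto simp: teval_tren)

lemma tvars_tren: "tvars (tren f t) = f ` tvars t"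
  by (induction t) auto

lemma fvars_fren: "inj f \<Longrightarrow> fvars (fren f \<phi>) = f ` fvars \<phi>"
  by (induction \<phi>) (auto simp: tvars_tren inj_def)

text \<open>Even positions carry the variables and odd positions the parameters. Both supplies stay
  infinite, so formulas can be combined and renamed without tracking how many variables or
  parameters are in use.\<close>

definition mix :: "(nat \<Rightarrow> 'm) \<Rightarrow> (nat \<Rightarrow> 'm) \<Rightarrow> nat \<Rightarrow> 'm" where
  "mix v u i = (if even i then v (i div 2) else u (i div 2))"

text \<open>The valuation \<open>v\<close> interprets the variables, the valuation \<open>u\<close> holds the parameters.\<close>

definition tdef :: "('m, 'b) ring_scheme \<Rightarrow> ((nat \<Rightarrow> 'm) \<Rightarrow> 'm) \<Rightarrow> bool" where
  "tdef M f \<longleftrightarrow> (\<exists>t u. range u \<subseteq> carrier M \<and> (\<forall>v. f v = teval M (mix v u) t))"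

definition dfn :: "('m, 'b) ring_scheme \<Rightarrow> ((nat \<Rightarrow> 'm) \<Rightarrow> bool) \<Rightarrow> bool" where
  "dfn M P \<longleftrightarrow> (\<exists>\<phi> u. range u \<subseteq> carrier M \<and>
     (\<forall>v. range v \<subseteq> carrier M \<longrightarrow> P v = sat M (mix v u) \<phi>))"

text \<open>When two parameter valuations \<open>u1\<close> and \<open>u2\<close> are merged into
  \<open>mix u1 u2\<close>, parameter \<open>i\<close> of the first moves to slot
  \<open>2 * i\<close> and that of the second to slot \<open>2 * i + 1\<close>, while variables stay
  put. \<open>par1\<close> and \<open>par2\<close> are these renamings on the positions of the outer
  \<open>mix\<close>.\<close>

definition par1 :: "nat \<Rightarrow> nat" where
  "par1 i = (if even i then i else 2 * (2 * (i div 2)) + 1)"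

definition par2 :: "nat \<Rightarrow> nat" where
  "par2 i = (if even i then i else 2 * (2 * (i div 2) + 1) + 1)"

lemma mix_simps [simp]: "mix v u (2 * i) = v i" "mix v u (Suc (2 * i)) = u i"
  by (auto simp: mix_def)

lemma par_simps [simp]:
  "par1 (2 * i) = 2 * i" "par1 (Suc (2 * i)) = Suc (2 * (2 * i))"
  "par2 (2 * i) = 2 * i" "par2 (Suc (2 * i)) = Suc (2 * Suc (2 * i))"
  by (auto simp: par1_def par2_def)

lemma mix_simps' [simp]:
  "mix v u (Suc (4 * i)) = u (2 * i)" "mix v u (Suc (Suc (Suc (4 * i)))) = u (Suc (2 * i))"
  using mix_simps(2)[of v u "2 * i"] mix_simps(2)[of v u "Suc (2 * i)"] by simp_all

lemma even_odd_cases: obtains k where "i = 2 * k" | k where "i = Suc (2 * k)"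
  by (metis evenE oddE Suc_eq_plus1)

lemma Suc_double_neq: "2 * a \<noteq> Suc (2 * b)" "Suc (2 * b) \<noteq> 2 * (a::nat)"
  by presburger+

lemma inj_par1: "inj par1"
proof (rule injI)
  fix i j assume "par1 i = par1 j"
  then show "i = j"
    by (cases i rule: even_odd_cases; cases j rule: even_odd_cases; simp; presburger)
qed

lemma inj_par2: "inj par2"
proof (rule injI)
  fix i j assume "par2 i = par2 j"
  then show "i = j"
    by (cases i rule: even_odd_cases; cases j rule: even_odd_cases; simp; presburger)
qed

lemma mix_par1: "mix v (mix u1 u2) \<circ> par1 = mix v u1"
proof
  fix i show "(mix v (mix u1 u2) \<circ> par1) i = mix v u1 i"
    by (cases i rule: even_odd_cases) auto
qed

lemma mix_par2: "mix v (mix u1 u2) \<circ> par2 = mix v u2"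
proof
  fix i show "(mix v (mix u1 u2) \<circ> par2) i = mix v u2 i"
    by (cases i rule: even_odd_cases) auto
qed

lemma range_mix: "range v \<subseteq> S \<Longrightarrow> range u \<subseteq> S \<Longrightarrow> range (mix v u) \<subseteq> S"
  by (auto simp: mix_def)

lemma mix_upd: "(mix v u)(2 * i := a) = mix (v(i := a)) u"
  by (rule ext) (auto simp: mix_def)

lemma tdef_merge:
  assumes "tdef M f" "tdef M g"
  obtains t1 t2 u where "range u \<subseteq> carrier M" "\<And>v. f v = teval M (mix v u) t1"
    "\<And>v. g v = teval M (mix v u) t2"
proof -
  obtain t1 u1 where 1: "range u1 \<subseteq> carrier M" "\<And>v. f v = teval M (mix v u1) t1"
    using assms(1) unfolding tdef_def by blast
  obtain t2 u2 where 2: "range u2 \<subseteq> carrier M" "\<And>v. g v = teval M (mix v u2) t2"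
    using assms(2) unfolding tdef_def by blast
  show ?thesis
    by (rule that[of "mix u1 u2" "tren par1 t1" "tren par2 t2"])
      (simp_all add: 1 2 teval_tren mix_par1 mix_par2 range_mix)
qed

lemma dfn_merge:
  assumes "dfn M P" "dfn M Q"
  obtains \<phi> \<psi> u where "range u \<subseteq> carrier M"
    "\<And>v. range v \<subseteq> carrier M \<Longrightarrow> P v = sat M (mix v u) \<phi>"
    "\<And>v. range v \<subseteq> carrier M \<Longrightarrow> Q v = sat M (mix v u) \<psi>"
proof -
  obtain \<phi> u1 where 1: "range u1 \<subseteq> carrier M" "\<And>v. range v \<subseteq> carrier M \<Longrightarrow> P v = sat M (mix v u1) \<phi>"
    using assms(1) unfolding dfn_def by blast
  obtain \<psi> u2 where 2: "range u2 \<subseteq> carrier M" "\<And>v. range v \<subseteq> carrier M \<Longrightarrow> Q v = sat M (mix v u2) \<psi>"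
    using assms(2) unfolding dfn_def by blast
  show ?thesis
    by (rule that[of "mix u1 u2" "fren par1 \<phi>" "fren par2 \<psi>"])
      (simp_all add: 1 2 sat_fren inj_par1 inj_par2 mix_par1 mix_par2 range_mix)
qed

lemma dfnI:
  assumes "range u \<subseteq> carrier M" "\<And>v. range v \<subseteq> carrier M \<Longrightarrow> P v = sat M (mix v u) \<phi>"
  shows "dfn M P"
  using assms unfolding dfn_def by blast

lemma tdefI:
  assumes "range u \<subseteq> carrier M" "\<And>v. f v = teval M (mix v u) t"
  shows "tdef M f"
  using assms unfolding tdef_def by blast

lemma dfn_eq:
  assumes "tdef M f" "tdef M g"
  shows "dfn M (\<lambda>v. f v = g v)"
proof -
  obtain t1 t2 u where "range u \<subseteq> carrier M" "\<And>v. f v = teval M (mix v u) t1"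
    "\<And>v. g v = teval M (mix v u) t2"
    by (rule tdef_merge[OF assms]) blast
  then show ?thesis by (intro dfnI[of u _ _ "Equal t1 t2"]) auto
qed

lemma dfn_not: "dfn M P \<Longrightarrow> dfn M (\<lambda>v. \<not> P v)"
proof -
  assume "dfn M P"
  then obtain \<phi> u where "range u \<subseteq> carrier M"
    "\<And>v. range v \<subseteq> carrier M \<Longrightarrow> P v = sat M (mix v u) \<phi>"
    unfolding dfn_def by blast
  then show ?thesis by (intro dfnI[of u _ _ "Neg \<phi>"]) auto
qed

lemma dfn_conj:
  assumes "dfn M P" "dfn M Q"
  shows "dfn M (\<lambda>v. P v \<and> Q v)"
proof -
  obtain \<phi> \<psi> u where "range u \<subseteq> carrier M"
    "\<And>v. range v \<subseteq> carrier M \<Longrightarrow> P v = sat M (mix v u) \<phi>"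
    "\<And>v. range v \<subseteq> carrier M \<Longrightarrow> Q v = sat M (mix v u) \<psi>"
    by (rule dfn_merge[OF assms]) blast
  then show ?thesis by (intro dfnI[of u _ _ "And \<phi> \<psi>"]) auto
qed

lemma dfn_disj:
  assumes "dfn M P" "dfn M Q"
  shows "dfn M (\<lambda>v. P v \<or> Q v)"
proof -
  have "dfn M (\<lambda>v. \<not> (\<not> P v \<and> \<not> Q v))"
    by (intro dfn_not dfn_conj assms)
  then show ?thesis by (simp only: de_Morgan_conj not_not)
qed

lemma dfn_imp:
  assumes "dfn M P" "dfn M Q"
  shows "dfn M (\<lambda>v. P v \<longrightarrow> Q v)"
  unfolding imp_conv_disj by (intro dfn_disj dfn_not assms)

lemma dfn_cong:
  assumes "dfn M P" "\<And>v. range v \<subseteq> carrier M \<Longrightarrow> P v = Q v"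
  shows "dfn M Q"
proof -
  obtain \<phi> u where "range u \<subseteq> carrier M"
    "\<And>v. range v \<subseteq> carrier M \<Longrightarrow> P v = sat M (mix v u) \<phi>"
    using assms(1) unfolding dfn_def by blast
  then show ?thesis using assms(2) by (intro dfnI[of u _ _ \<phi>]) auto
qed

lemma dfn_ex_upd: "dfn M P \<Longrightarrow> dfn M (\<lambda>v. \<exists>a \<in> carrier M. P (v(i := a)))"
proof -
  assume "dfn M P"
  then obtain \<phi> u where u: "range u \<subseteq> carrier M"
    and P: "\<And>v. range v \<subseteq> carrier M \<Longrightarrow> P v = sat M (mix v u) \<phi>"
    unfolding dfn_def by blast
  have "(\<exists>a \<in> carrier M. P (v(i := a))) = sat M (mix v u) (Exists (2 * i) \<phi>)"
    if "range v \<subseteq> carrier M" for v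
  proof -
    have "range (v(i := a)) \<subseteq> carrier M" if "a \<in> carrier M" for a
      using \<open>range v \<subseteq> carrier M\<close> that by auto
    then have "P (v(i := a)) = sat M ((mix v u)(2 * i := a)) \<phi>" if "a \<in> carrier M" for a
      using P[of "v(i := a)"] that unfolding mix_upd by blast
    then show ?thesis by auto
  qed
  then show ?thesis by (rule dfnI[OF u])
qed

text \<open>Together with the other closure rules this proves a HOL predicate definable without
  exhibiting a formula. The variable \<open>i\<close> only stores the quantified element, so
  \<open>Q\<close> must not see it otherwise.\<close>

lemma dfn_ex:
  assumes "dfn M (\<lambda>v. Q v (v i))" "\<And>v a b. Q (v(i := a)) b = Q v b"
  shows "dfn M (\<lambda>v. \<exists>a \<in> carrier M. Q v a)"
  using dfn_ex_upd[OF assms(1), of i] unfolding assms(2) fun_upd_same .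

lemma dfn_all:
  assumes "dfn M (\<lambda>v. Q v (v i))" "\<And>v a b. Q (v(i := a)) b = Q v b"
  shows "dfn M (\<lambda>v. \<forall>a \<in> carrier M. Q v a)"
proof -
  have "dfn M (\<lambda>v. \<exists>a \<in> carrier M. \<not> Q v a)"
    by (rule dfn_ex[where i = i]) (simp_all add: assms dfn_not)
  from dfn_not[OF this] show ?thesis by simp
qed

lemma dfn_reindex:
  assumes "dfn M P" "inj g"
  shows "dfn M (\<lambda>v. P (v \<circ> g))"
proof -
  define h where "h i = (if even i then 2 * g (i div 2) else i)" for i
  have h: "h (2 * i) = 2 * g i" "h (Suc (2 * i)) = Suc (2 * i)" for i
    by (auto simp: h_def)
  have "inj h"
  proof (rule injI)
    fix i j assume "h i = h j"
    then show "i = j"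
      by (cases i rule: even_odd_cases; cases j rule: even_odd_cases)
        (use assms(2) in \<open>auto simp: h Suc_double_neq inj_eq\<close>)
  qed
  have mixh: "mix v u \<circ> h = mix (v \<circ> g) u" for v u :: "nat \<Rightarrow> 'a"
  proof
    fix i show "(mix v u \<circ> h) i = mix (v \<circ> g) u i"
      by (cases i rule: even_odd_cases) (auto simp: h)
  qed
  obtain \<phi> u where u: "range u \<subseteq> carrier M"
    and P: "\<And>v. range v \<subseteq> carrier M \<Longrightarrow> P v = sat M (mix v u) \<phi>"
    using assms(1) unfolding dfn_def by blast
  have "P (v \<circ> g) = sat M (mix v u) (fren h \<phi>)" if v: "range v \<subseteq> carrier M" for v
  proof -
    have "range (v \<circ> g) \<subseteq> carrier M" using v by auto
    then show ?thesis using P[of "v \<circ> g"] by (simp add: sat_fren \<open>inj h\<close> mixh)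
  qed
  then show ?thesis by (rule dfnI[OF u])
qed

text \<open>Supplies variables that are fresh for \<open>f\<close>, as needed for
  substitution.\<close>

lemma tdef_support:
  assumes "tdef M f"
  obtains N where "\<And>v w. (\<And>i. i < N \<Longrightarrow> v i = w i) \<Longrightarrow> f v = f w"
proof -
  obtain t u where f: "\<And>v. f v = teval M (mix v u) t"
    using assms unfolding tdef_def by blast
  obtain N where N: "tvars t \<subseteq> {..<N}"
    using finite_nat_set_iff_bounded[of "tvars t"] finite_tvars by fastforce
  have "f v = f w" if "\<And>i. i < N \<Longrightarrow> v i = w i" for v w
    unfolding f
  proof (rule teval_cong)
    fix i assume "i \<in> tvars t"
    then have "i div 2 < N" using N by auto
    then show "mix v u i = mix w u i" using that by (auto simp: mix_def)
  qed
  then show ?thesis by (rule that)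
qed

context
  fixes M :: "('m, 'b) ring_scheme" (structure)
  assumes L: "ring_language_structure M"
begin

lemma tdef_const: "c \<in> carrier M \<Longrightarrow> tdef M (\<lambda>v. c)"
  by (rule tdefI[of "\<lambda>_. c" _ _ "Var 1"]) (simp_all add: mix_def)

lemma tdef_var: "tdef M (\<lambda>v. v i)"
proof (rule tdefI)
  show "range (\<lambda>_::nat. \<zero>) \<subseteq> carrier M"
    using L by (simp add: ring_language_structure_def)
  show "v i = teval M (mix v (\<lambda>_. \<zero>)) (Var (2 * i))" for v
    by simp
qed

lemma tdef_add:
  assumes "tdef M f" "tdef M g"
  shows "tdef M (\<lambda>v. f v \<oplus> g v)"
proof -
  obtain t1 t2 u where "range u \<subseteq> carrier M" "\<And>v. f v = teval M (mix v u) t1"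
    "\<And>v. g v = teval M (mix v u) t2"
    by (rule tdef_merge[OF assms]) blast
  then show ?thesis by (intro tdefI[of u _ _ "Add t1 t2"]) auto
qed

lemma tdef_mult:
  assumes "tdef M f" "tdef M g"
  shows "tdef M (\<lambda>v. f v \<otimes> g v)"
proof -
  obtain t1 t2 u where "range u \<subseteq> carrier M" "\<And>v. f v = teval M (mix v u) t1"
    "\<And>v. g v = teval M (mix v u) t2"
    by (rule tdef_merge[OF assms]) blast
  then show ?thesis by (intro tdefI[of u _ _ "Mult t1 t2"]) auto
qed

lemma tdef_uminus:
  assumes "tdef M f"
  shows "tdef M (\<lambda>v. \<ominus> f v)"
proof -
  obtain t u where "range u \<subseteq> carrier M" "\<And>v. f v = teval M (mix v u) t"
    using assms unfolding tdef_def by blast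
  then show ?thesis by (intro tdefI[of u _ _ "Minus t"]) auto
qed

lemma tdef_minus: "tdef M f \<Longrightarrow> tdef M g \<Longrightarrow> tdef M (\<lambda>v. f v \<ominus> g v)"
  unfolding a_minus_def by (intro tdef_add tdef_uminus)

lemma teval_closed: "range v \<subseteq> carrier M \<Longrightarrow> teval M v t \<in> carrier M"
  by (induction t) (use L in \<open>auto simp: ring_language_structure_def\<close>)

lemma tdef_closed: "tdef M f \<Longrightarrow> range v \<subseteq> carrier M \<Longrightarrow> f v \<in> carrier M"
  unfolding tdef_def using teval_closed range_mix by (metis (no_types, lifting))

text \<open>Substitution is done by quantification: with variables \<open>N\<close>,
  \<open>N + 1\<close>, \<open>N + 2\<close> outside the support of the terms, the claim says that
  there are \<open>a = f v\<close>, \<open>b = g v\<close> and \<open>c = h v\<close> with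
  \<open>R a b c\<close>.\<close>

lemma dfn_sub3:
  assumes R: "dfn M (\<lambda>v. R (v 0) (v 1) (v 2))" and f: "tdef M f" and g: "tdef M g" and h: "tdef M h"
  shows "dfn M (\<lambda>v. R (f v) (g v) (h v))"
proof -
  obtain N1 where N1: "\<And>v w. (\<And>i. i < N1 \<Longrightarrow> v i = w i) \<Longrightarrow> f v = f w"
    using tdef_support[OF f] by blast
  obtain N2 where N2: "\<And>v w. (\<And>i. i < N2 \<Longrightarrow> v i = w i) \<Longrightarrow> g v = g w"
    using tdef_support[OF g] by blast
  obtain N3 where N3: "\<And>v w. (\<And>i. i < N3 \<Longrightarrow> v i = w i) \<Longrightarrow> h v = h w"
    using tdef_support[OF h] by blast
  define N where "N = N1 + N2 + N3"
  have upd: "f (v(i := a)) = f v" "g (v(i := a)) = g v" "h (v(i := a)) = h v" if "i \<ge> N" for v i a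
    by (rule N1 N2 N3, use that in \<open>simp add: N_def\<close>)+
  have "inj ((+) N)" by simp
  from dfn_reindex[OF R this] have R': "dfn M (\<lambda>v. R (v N) (v (N + 1)) (v (N + 2)))"
    by simp
  have "dfn M (\<lambda>v. (v N = f v \<and> v (N + 1) = g v \<and> v (N + 2) = h v) \<and> R (v N) (v (N + 1)) (v (N + 2)))"
    by (intro dfn_conj dfn_eq R' f g h tdef_var)
  then have "dfn M (\<lambda>v. \<exists>c \<in> carrier M. (v N = f v \<and> v (N + 1) = g v \<and> c = h v) \<and> R (v N) (v (N + 1)) c)"
    by (rule dfn_ex) (simp add: upd del: fun_upd_apply; simp?)
  then have "dfn M (\<lambda>v. \<exists>b \<in> carrier M. \<exists>c \<in> carrier M. (v N = f v \<and> b = g v \<and> c = h v) \<and> R (v N) b c)"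
    by (rule dfn_ex) (simp add: upd del: fun_upd_apply; simp?)
  then have "dfn M (\<lambda>v. \<exists>a \<in> carrier M. \<exists>b \<in> carrier M. \<exists>c \<in> carrier M. (a = f v \<and> b = g v \<and> c = h v) \<and> R a b c)"
    by (rule dfn_ex) (simp add: upd del: fun_upd_apply; simp?)
  then show ?thesis
    by (rule dfn_cong) (auto simp: tdef_closed f g h)
qed

lemma dfn_sub2:
  "dfn M (\<lambda>v. R (v 0) (v 1)) \<Longrightarrow> tdef M f \<Longrightarrow> tdef M g \<Longrightarrow> dfn M (\<lambda>v. R (f v) (g v))"
  using dfn_sub3[of "\<lambda>a b c. R a b", OF _ _ _ tdef_var] by blast

lemma dfn_sub1: "dfn M (\<lambda>v. R (v 0)) \<Longrightarrow> tdef M f \<Longrightarrow> dfn M (\<lambda>v. R (f v))"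
  using dfn_sub2[of "\<lambda>a b. R a", OF _ _ tdef_var] by blast

end

definition dset :: "('m, 'b) ring_scheme \<Rightarrow> 'm set \<Rightarrow> bool" where
  "dset M S \<longleftrightarrow> dfn M (\<lambda>v. v 0 \<in> S)"

lemma dset_mem: "ring_language_structure M \<Longrightarrow> dset M S \<Longrightarrow> tdef M f \<Longrightarrow> dfn M (\<lambda>v. f v \<in> S)"
  unfolding dset_def by (rule dfn_sub1)

lemma dset_formula:
  assumes "dset M S" "c \<in> carrier M"
  obtains \<phi> b where "b \<in> lists (carrier M)" "fvars \<phi> \<subseteq> {..<1 + length b}"
    "\<And>a. a \<in> carrier M \<Longrightarrow> a \<in> S \<longleftrightarrow> sat M (nth (a # b)) \<phi>"
proof -
  obtain \<phi> u where u: "range u \<subseteq> carrier M"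
    and P: "\<And>v. range v \<subseteq> carrier M \<Longrightarrow> v 0 \<in> S \<longleftrightarrow> sat M (mix v u) \<phi>"
    using assms unfolding dset_def dfn_def by blast
  obtain N where N: "fvars \<phi> \<subseteq> {..<N}"
    using finite_nat_set_iff_bounded[of "fvars \<phi>"] finite_fvars by fastforce
  \<comment> \<open>Only variable 0 matters. The other variables get the dummy value
    \<open>c\<close>, so that everything after position 0 is independent of \<open>a\<close> and can
    be listed as the parameter tuple \<open>b\<close>.\<close>
  define w where "w a = mix (\<lambda>i. if i = 0 then a else c) u" for a
  define b where "b = map (\<lambda>i. w c (Suc i)) [0..<N]"
  have w_range: "range (w a) \<subseteq> carrier M" if "a \<in> carrier M" for a
    unfolding w_def using that u assms(2) by (intro range_mix) auto
  have wS: "w a (Suc i) = w c (Suc i)" for a i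
    by (auto simp: w_def mix_def)
  have w0: "w a 0 = a" for a
    by (auto simp: w_def mix_def)
  have "a \<in> S \<longleftrightarrow> sat M (nth (a # b)) \<phi>" if a: "a \<in> carrier M" for a
  proof -
    have "a \<in> S \<longleftrightarrow> sat M (w a) \<phi>"
      using P[of "\<lambda>i. if i = 0 then a else c"] a assms(2) by (auto simp: w_def)
    also have "\<dots> \<longleftrightarrow> sat M (nth (a # b)) \<phi>"
    proof (rule sat_cong)
      fix i assume "i \<in> fvars \<phi>"
      then show "w a i = (a # b) ! i"
        using N wS[of a] w0 by (cases i) (auto simp: b_def)
    qed
    finally show ?thesis .
  qed
  moreover have "b \<in> lists (carrier M)"
    using w_range[OF assms(2)] by (auto simp: b_def image_subset_iff)
  moreover have "fvars \<phi> \<subseteq> {..<1 + length b}"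
    using N by (auto simp: b_def)
  ultimately show ?thesis by (intro that)
qed

section \<open>Saturation\<close>

lemma countable_small:
  assumes "countable A" "cardSuc natLeq <o \<kappa>"
  shows "|A| <o \<kappa>"
proof -
  have "|A| \<le>o natLeq"
    using assms(1) by (simp add: countable_card_le_natLeq)
  also have "natLeq <o cardSuc natLeq"
    by (intro cardSuc_greater natLeq_Card_order)
  finally show ?thesis
    using assms(2) by (metis ordLess_transitive)
qed

text \<open>A definable set uses finitely many parameters, so countably many of them use a
  countable, hence small, parameter set.\<close>

lemma saturated_seq:
  fixes M :: "('m, 'b) ring_scheme" and S :: "nat \<Rightarrow> 'm set"
  assumes M: "monster \<kappa> M" and L: "ring_language_structure M"
    and S: "\<And>n. dset M (S n)" and fip: "\<And>n. \<exists>a \<in> carrier M. \<forall>i < n. a \<in> S i"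
  shows "\<exists>a \<in> carrier M. \<forall>n. a \<in> S n"
proof -
  have sat: "saturated \<kappa> M" and k: "cardSuc natLeq <o \<kappa>"
    using M by (auto simp: monster_def)
  have z: "\<zero>\<^bsub>M\<^esub> \<in> carrier M" using L by (auto simp: ring_language_structure_def)
  have "\<exists>\<phi> b. b \<in> lists (carrier M) \<and> fvars \<phi> \<subseteq> {..<1 + length b} \<and>
    (\<forall>a \<in> carrier M. a \<in> S n \<longleftrightarrow> sat M (nth (a # b)) \<phi>)" for n
    using dset_formula[OF S z, of n] by metis
  then obtain \<phi> b where b: "\<And>n. b n \<in> lists (carrier M)" "\<And>n. fvars (\<phi> n) \<subseteq> {..<1 + length (b n)}"
    and \<phi>: "\<And>n a. a \<in> carrier M \<Longrightarrow> a \<in> S n \<longleftrightarrow> sat M (nth (a # b n)) (\<phi> n)"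
    by metis
  define A where "A = (\<Union>n. set (b n))"
  define \<Phi> where "\<Phi> = range (\<lambda>n. (\<phi> n, b n))"
  have 1: "A \<subseteq> carrier M" using b by (auto simp: A_def)
  have 2: "|A| <o \<kappa>" unfolding A_def by (intro countable_small[OF _ k] countable_UN) (simp_all add: countable_finite countableI_type)
  have 3: "\<Phi> \<subseteq> {(\<phi>, b). b \<in> lists A \<and> fvars \<phi> \<subseteq> {..<1 + length b}}"
    using b by (fastforce simp: \<Phi>_def A_def)
  have 4: "\<forall>F \<subseteq> \<Phi>. finite F \<longrightarrow> (\<exists>a \<in> carrier M. \<forall>(\<phi>, b) \<in> F. sat M (nth ([a] @ b)) \<phi>)"
  proof (intro allI impI)
    fix F assume "F \<subseteq> \<Phi>" "finite F"
    then obtain I where I: "finite I" "F = (\<lambda>n. (\<phi> n, b n)) ` I"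
      unfolding \<Phi>_def by (meson finite_subset_image)
    obtain N where "I \<subseteq> {..<N}"
      using finite_nat_set_iff_bounded[of I] I(1) by fastforce
    moreover obtain a where "a \<in> carrier M" "\<forall>i < N. a \<in> S i" using fip by blast
    ultimately show "\<exists>a \<in> carrier M. \<forall>(\<phi>, b) \<in> F. sat M (nth ([a] @ b)) \<phi>"
      using \<phi> by (auto simp: I(2) intro!: bexI[of _ a])
  qed
  have "\<exists>a \<in> carrier M. \<forall>(\<phi>, b) \<in> \<Phi>. sat M (nth ([a] @ b)) \<phi>"
    by (rule sat[unfolded saturated_def, rule_format, of A \<Phi>], intro conjI) (fact 1 2 3 4)+
  then obtain a where "a \<in> carrier M" "\<forall>(\<phi>, b) \<in> \<Phi>. sat M (nth ([a] @ b)) \<phi>"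
    by blast
  then show ?thesis using \<phi> by (auto simp: \<Phi>_def)
qed

lemma infinite_dset_uncountable:
  fixes M :: "('m, 'b) ring_scheme"
  assumes M: "monster \<kappa> M" and L: "ring_language_structure M"
    and S: "dset M S" "S \<subseteq> carrier M" "infinite S"
  shows "uncountable S"
proof
  assume c: "countable S"
  define s where "s = from_nat_into S"
  have s: "range s = S" unfolding s_def using c S(3) by (metis finite.emptyI range_from_nat_into)
  \<comment> \<open>Stage 0 asks for membership in \<open>S\<close>, stage \<open>n + 1\<close>
    avoids the \<open>n\<close>-th element of the enumeration; a common point would be a member of
    \<open>S\<close> that was not enumerated.\<close>
  define T where "T n = (case n of 0 \<Rightarrow> S | Suc n \<Rightarrow> {x. x \<noteq> s n})" for n
  have T: "T 0 = S" "T (Suc n) = {x. x \<noteq> s n}" for n by (simp_all add: T_def)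
  have sn: "s n \<in> carrier M" for n using s S(2) by blast
  have "dset M {x. x \<noteq> s n}" for n
    unfolding dset_def mem_Collect_eq by (intro dfn_not dfn_eq tdef_var tdef_const L sn)
  then have "dset M (T n)" for n
    using S(1) by (cases n) (simp_all add: T)
  moreover have "\<exists>a \<in> carrier M. \<forall>i < n. a \<in> T i" for n
  proof -
    have "infinite (S - s ` {..<n})" using S(3) by simp
    then obtain a where "a \<in> S - s ` {..<n}" using infinite_imp_nonempty by blast
    then have a: "a \<in> S" "\<And>i. i < n \<Longrightarrow> a \<noteq> s i" by auto
    have "a \<in> T i" if "i < n" for i
      using a that by (cases i) (simp_all add: T)
    then show ?thesis using a(1) S(2) by blast
  qed
  ultimately obtain a where "\<forall>n. a \<in> T n"
    using saturated_seq[OF M L, of T] by blast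
  then have "a \<in> T 0" "\<And>n. a \<in> T (Suc n)" by blast+
  then have "a \<in> S" "\<And>n. a \<noteq> s n" by (simp_all add: T)
  then show False using s by blast
qed

section \<open>Chains of thorn-forking extensions\<close>

instance rterm :: countable by countable_datatype
instance rform :: countable by countable_datatype
instance sort :: countable by countable_datatype
instance ieq_form :: countable by countable_datatype

primrec emb :: "rform \<Rightarrow> ieq_form" where
  "emb (Equal t u) = IEqual t u"
| "emb (Neg \<phi>) = INeg (emb \<phi>)"
| "emb (And \<phi> \<psi>) = IAnd (emb \<phi>) (emb \<psi>)"
| "emb (Exists i \<phi>) = IEx Home i (emb \<phi>)"

lemma ifvars_emb: "ifvars (emb \<phi>) = fvars \<phi>"
  by (induction \<phi>) auto

lemma Real_in_eq_els: "Real a \<in> eq_els M \<longleftrightarrow> a \<in> carrier M"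
  by (auto simp: eq_els_def)

lemma eq_els_Home: "e \<in> eq_els M \<and> sort_of e = Home \<longleftrightarrow> (\<exists>a \<in> carrier M. e = Real a)"
  by (cases e) (auto simp: eq_els_def)

lemma isat_emb:
  "(\<And>i. i \<in> fvars \<phi> \<Longrightarrow> sort_of (v i) = Home) \<Longrightarrow> isat M v (emb \<phi>) = sat M (un_Real \<circ> v) \<phi>"
proof (induction \<phi> arbitrary: v)
  case (Exists i \<phi>)
  have *: "isat M (v(i := Real a)) (emb \<phi>) = sat M ((un_Real \<circ> v)(i := a)) \<phi>" for a
  proof -
    have "isat M (v(i := Real a)) (emb \<phi>) = sat M (un_Real \<circ> v(i := Real a)) \<phi>"
      using Exists.prems by (intro Exists.IH) auto
    also have "un_Real \<circ> v(i := Real a) = (un_Real \<circ> v)(i := a)"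
      by auto
    finally show ?thesis .
  qed
  have "isat M v (emb (Exists i \<phi>)) \<longleftrightarrow> (\<exists>e. (e \<in> eq_els M \<and> sort_of e = Home) \<and> isat M (v(i := e)) (emb \<phi>))"
    by auto
  also have "\<dots> \<longleftrightarrow> (\<exists>a \<in> carrier M. isat M (v(i := Real a)) (emb \<phi>))"
    unfolding eq_els_Home by blast
  finally show ?case unfolding * sat.simps .
qed auto

text \<open>The free variables of \<open>\<psi>\<close> are not bounded by the length of the tuple.
  This can only enlarge the set, and what matters is that the set is countable and that elements
  outside it have nonalgebraic types.\<close>

definition acl :: "('m, 'b) ring_scheme \<Rightarrow> 'm el set \<Rightarrow> 'm el set" where
  "acl M A = {e \<in> eq_els M. \<exists>\<psi>. \<exists>d \<in> lists A. isat M (nth (e # d)) \<psi> \<and>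
     finite {e' \<in> eq_els M. sort_of e' = sort_of e \<and> isat M (nth (e' # d)) \<psi>}}"

lemma countable_acl:
  assumes "countable A"
  shows "countable (acl M A)"
proof -
  define S where "S = (\<lambda>(s, \<psi>, d). {e \<in> eq_els M. sort_of e = s \<and> isat M (nth (e # d)) \<psi>})"
  define T where "T p = (if finite (S p) then S p else {})" for p
  have "acl M A \<subseteq> (\<Union>p \<in> UNIV \<times> UNIV \<times> lists A. T p)"
  proof
    fix e assume "e \<in> acl M A"
    then obtain \<psi> d where *: "e \<in> eq_els M" "d \<in> lists A" "isat M (nth (e # d)) \<psi>"
      "finite {e' \<in> eq_els M. sort_of e' = sort_of e \<and> isat M (nth (e' # d)) \<psi>}"
      unfolding acl_def by blast
    then have "e \<in> T (sort_of e, \<psi>, d)" by (simp add: T_def S_def)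
    then show "e \<in> (\<Union>p \<in> UNIV \<times> UNIV \<times> lists A. T p)" using *(2) by blast
  qed
  moreover have "countable (\<Union>p \<in> UNIV \<times> UNIV \<times> lists A. T p)"
  proof (intro countable_UN countable_SIGMA countableI_type countable_lists assms)
    show "countable (T p)" for p by (rule countable_finite) (simp add: T_def)
  qed
  ultimately show ?thesis by (rule countable_subset)
qed

text \<open>The parameters \<open>d\<close> lie in the base, and a type over the base fixes them by
  equations. So the realizations of the type of \<open>e # d\<close> have the form
  \<open>e' # d\<close>, and \<open>k\<close>-inconsistency reduces to families that vary only in an
  element \<open>e'\<close> of the sort of \<open>e\<close>.\<close>

lemma thorn_step:
  assumes A: "A \<subseteq> eq_els M" and e: "e \<in> eq_els M" "e \<notin> acl M A" and d: "d \<in> lists A"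
    and \<chi>: "ifvars \<chi> \<subseteq> {..<2 + length d}"
    and k: "\<And>F. F \<subseteq> {e' \<in> eq_els M. sort_of e' = sort_of e} \<Longrightarrow> finite F \<Longrightarrow> card F = k \<Longrightarrow>
      \<not> (\<exists>y \<in> carrier M. \<forall>e' \<in> F. isat M (nth (Real y # e' # d)) \<chi>)"
  shows "thorn_divides M [Home] \<chi> (e # d) A"
proof -
  have nalg: "\<not> algebraic M (map sort_of (e # d)) (tp M (e # d) A)"
  proof
    assume "algebraic M (map sort_of (e # d)) (tp M (e # d) A)"
    then obtain \<psi> c where c: "(\<psi>, c) \<in> tp M (e # d) A"
      and fin: "finite {a \<in> eq_tuples M (map sort_of (e # d)). holds M \<psi> a c}"
      unfolding algebraic_def by auto
    have cA: "c \<in> lists A" and holds: "isat M (nth (e # d @ c)) \<psi>"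
      using c by (auto simp: tp_def holds_def)
    \<comment> \<open>Solutions \<open>e'\<close> of \<open>\<psi>\<close> with parameters
      \<open>d @ c\<close> embed into the finite set of tuples, so \<open>\<psi>\<close> would put
      \<open>e\<close> into the closure of \<open>A\<close>.\<close>
    have "(\<lambda>e'. e' # d) ` {e' \<in> eq_els M. sort_of e' = sort_of e \<and> isat M (nth (e' # d @ c)) \<psi>}
      \<subseteq> {a \<in> eq_tuples M (map sort_of (e # d)). holds M \<psi> a c}"
      using A d by (auto simp: eq_tuples_def holds_def)
    then have "finite {e' \<in> eq_els M. sort_of e' = sort_of e \<and> isat M (nth (e' # d @ c)) \<psi>}"
      using fin by (meson finite_imageD finite_subset inj_onI list.inject)
    moreover have "d @ c \<in> lists A" using d cA by simp
    ultimately have "e \<in> acl M A" using e(1) holds unfolding acl_def by blast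
    then show False using e(2) by simp
  qed
  have tail: "\<exists>e'. a' = e' # d \<and> e' \<in> eq_els M \<and> sort_of e' = sort_of e"
    if a': "a' \<in> eq_tuples M (map sort_of (e # d))" "tp M a' A = tp M (e # d) A" for a'
  proof -
    have len: "length a' = Suc (length d)" and el: "a' \<in> lists (eq_els M)" and
      srt: "map sort_of a' = map sort_of (e # d)"
      using a'(1) by (auto simp: eq_tuples_def dest: map_eq_imp_length_eq)
    have "a' ! Suc j = d ! j" if j: "j < length d" for j
    proof -
      have dj: "d ! j \<in> A" using d j by (simp add: in_listsD)
      \<comment> \<open>Variable \<open>length a'\<close> is the first parameter slot. The formula
        says that coordinate \<open>Suc j\<close> of the tuple equals the parameter
        \<open>d ! j\<close>.\<close>
      have "(ISame (Suc j) (length a'), [d ! j]) \<in> tp M (e # d) A"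
        using j dj len by (auto simp: tp_def holds_def nth_append)
      then have "(ISame (Suc j) (length a'), [d ! j]) \<in> tp M a' A" using a'(2) by simp
      then show ?thesis using j len by (auto simp: tp_def holds_def nth_append)
    qed
    moreover obtain e' t where "a' = e' # t" using len by (cases a') auto
    ultimately have "a' = e' # d" using len by (auto intro!: nth_equalityI)
    then show ?thesis using el srt by auto
  qed
  have "k_inconsistent M [Home] \<chi> {a' \<in> eq_tuples M (map sort_of (e # d)). tp M a' A = tp M (e # d) A} k"
    unfolding k_inconsistent_def
  proof (intro allI impI notI)
    fix F assume F: "F \<subseteq> {a' \<in> eq_tuples M (map sort_of (e # d)). tp M a' A = tp M (e # d) A}"
      and card: "finite F \<and> card F = k"
      and "\<exists>x \<in> eq_tuples M [Home]. \<forall>a \<in> F. holds M \<chi> x a"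
    then obtain x where x: "x \<in> eq_tuples M [Home]" "\<And>a. a \<in> F \<Longrightarrow> holds M \<chi> x a" by blast
    have "x \<in> lists (eq_els M)" "map sort_of x = [Home]"
      using x(1) by (simp_all add: eq_tuples_def)
    then obtain ey where ey: "x = [ey]" "ey \<in> eq_els M \<and> sort_of ey = Home"
      by (cases x) auto
    obtain y where y: "x = [Real y]" "y \<in> carrier M"
      using ey(2)[unfolded eq_els_Home] ey(1) by blast
    have Ft: "\<exists>e'. a' = e' # d \<and> e' \<in> eq_els M \<and> sort_of e' = sort_of e" if "a' \<in> F" for a'
      using tail F that by blast
    have inj: "inj_on hd F"
    proof (rule inj_onI)
      fix a b assume "a \<in> F" "b \<in> F" "hd a = hd b"
      then show "a = b" using Ft[of a] Ft[of b] by (metis list.sel(1))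
    qed
    have "hd ` F \<subseteq> {e' \<in> eq_els M. sort_of e' = sort_of e}"
    proof
      fix e' assume "e' \<in> hd ` F"
      then obtain a where "a \<in> F" "e' = hd a" by blast
      then show "e' \<in> {e' \<in> eq_els M. sort_of e' = sort_of e}" using Ft[of a] by auto
    qed
    moreover have "finite (hd ` F)" "card (hd ` F) = k" using card card_image[OF inj] by auto
    moreover have "\<forall>e' \<in> hd ` F. isat M (nth (Real y # e' # d)) \<chi>"
    proof
      fix e' assume "e' \<in> hd ` F"
      then obtain a where a: "a \<in> F" "e' = hd a" by blast
      then have "a = e' # d" using Ft[of a] by auto
      then show "isat M (nth (Real y # e' # d)) \<chi>" using x(2)[OF a(1)] y(1) by (simp add: holds_def)
    qed
    ultimately show False using k y(2) by blast
  qed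
  then have "strongly_divides M [Home] \<chi> (e # d) (A \<union> set [])"
    unfolding strongly_divides_def using nalg \<chi> A d e(1) by auto
  then show ?thesis unfolding thorn_divides_def by blast
qed

definition super :: "'m rel \<Rightarrow> 'm ring \<Rightarrow> bool" where
  "super \<kappa> M \<longleftrightarrow> ring_language_structure M \<and> monster \<kappa> M \<and>
     (\<forall>\<sigma> A. small \<kappa> M A \<longrightarrow> (\<forall>p \<in> complete_types M \<sigma> A. U_thorn_ordinal_valued \<kappa> M p))"

text \<open>The types of \<open>x\<close> over the growing sets \<open>A n\<close> form an infinite
  chain of thorn-forking extensions, because \<open>\<chi> n\<close> with the nonalgebraic parameter
  \<open>a n\<close> thorn-divides over \<open>A n\<close>. All of them would then have rank at
  least every ordinal.\<close>

lemma no_thorn_chain: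
  fixes M :: "'m ring" and a :: "nat \<Rightarrow> 'm el" and \<chi> :: "nat \<Rightarrow> ieq_form"
  assumes S: "super \<kappa> M"
    and B: "countable B" "B \<subseteq> eq_els M" and a: "\<And>n. a n \<in> eq_els M"
    and nalg: "\<And>n. a n \<notin> acl M (B \<union> a ` {..<n})"
    and d: "\<And>n. d n \<in> lists B" and \<chi>: "\<And>n. ifvars (\<chi> n) \<subseteq> {..<2 + length (d n)}"
    and k: "\<And>n F. F \<subseteq> {e' \<in> eq_els M. sort_of e' = sort_of (a n)} \<Longrightarrow> finite F \<Longrightarrow> card F = k n \<Longrightarrow>
      \<not> (\<exists>y \<in> carrier M. \<forall>e' \<in> F. isat M (nth (Real y # e' # d n)) (\<chi> n))"
    and x: "x \<in> carrier M" "\<And>n. isat M (nth (Real x # a n # d n)) (\<chi> n)"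
  shows False
proof -
  define A where "A n = B \<union> a ` {..<n}" for n
  define p where "p n = tp M [Real x] (A n)" for n
  have k': "cardSuc natLeq <o \<kappa>" using S by (auto simp: super_def monster_def)
  have A: "small \<kappa> M (A n)" for n
    unfolding small_def A_def using B a countable_small[OF _ k', of "B \<union> a ` {..<n}"] by auto
  have mono: "A n \<subseteq> A (Suc n)" for n by (auto simp: A_def)
  have xt: "[Real x] \<in> eq_tuples M [Home]"
    using x(1) by (simp add: eq_tuples_def Real_in_eq_els)
  have pc: "p n \<in> complete_types M [Home] (A n)" for n
    unfolding p_def complete_types_def using xt by blast
  have ext: "thorn_forking_extension \<kappa> M (p n) (p (Suc n))" for n
  proof -
    have dA: "d n \<in> lists (A n)" using d[of n] by (auto simp: A_def)
    have Ael: "A n \<subseteq> eq_els M" using A by (simp add: small_def)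
    have "thorn_divides M [Home] (\<chi> n) (a n # d n) (A n)"
      by (rule thorn_step[OF Ael a _ dA \<chi> k]) (use nalg[of n] in \<open>auto simp: A_def\<close>)
    then have "thorn_forks M [Home] (\<chi> n) (a n # d n) (A n)"
      unfolding thorn_forks_def by (intro exI[of _ "{(\<chi> n, a n # d n)}"]) auto
    moreover have "(\<chi> n, a n # d n) \<in> p (Suc n)"
      using x(2)[of n] \<chi>[of n] d[of n] by (auto simp: p_def tp_def holds_def A_def)
    ultimately have "type_thorn_forks M [Home] (p (Suc n)) (A n)"
      unfolding type_thorn_forks_def by blast
    moreover have "p n \<subseteq> p (Suc n)"
      unfolding p_def tp_def using mono[of n] by (auto dest: lists_mono[THEN subsetD])
    ultimately show ?thesis
      unfolding thorn_forking_extension_def using A pc mono by blast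
  qed
  have "U_thorn_ordinal_valued \<kappa> M (p 0)"
    using S A pc unfolding super_def by blast
  then obtain r :: "'m type_over rel" and \<alpha> where r: "Well_order r" "\<not> U_thorn_ge \<kappa> M r \<alpha> (p 0)"
    unfolding U_thorn_ordinal_valued_def by blast
  have "wf (r - Id)" using r(1) by (simp add: well_order_on_def)
  \<comment> \<open>The claim is made for all \<open>n\<close> at once, since the rank of
    \<open>p n\<close> is bounded below through that of \<open>p (Suc n)\<close>.\<close>
  then have "\<forall>n. U_thorn_ge \<kappa> M r \<beta> (p n)" for \<beta>
  proof (induction \<beta> rule: wf_induct_rule)
    case (less \<beta>)
    show ?case
    proof
      fix n show "U_thorn_ge \<kappa> M r \<beta> (p n)"
        using less ext by (intro U_thorn_ge.intros) blast
    qed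
  qed
  then show False using r(2) by blast
qed

text \<open>\<open>G\<close> singles out the finite sequences of parameters that are still
  admissible. Each has uncountably many admissible continuations, so one of them avoids the
  countable algebraic closure of the earlier parameters. The infinite branch chosen in this way is
  realized by a single \<open>x\<close>, by saturation.\<close>

lemma no_thorn_tree:
  fixes M :: "'m ring" and \<chi> :: "nat \<Rightarrow> ieq_form" and d :: "nat \<Rightarrow> 'm list"
  assumes S: "super \<kappa> M"
    and d: "\<And>n. d n \<in> lists (carrier M)"
    and \<chi>: "\<And>n. ifvars (\<chi> n) \<subseteq> {..<2 + length (d n)}"
    and k: "\<And>n F. F \<subseteq> {e \<in> eq_els M. sort_of e = s n} \<Longrightarrow> finite F \<Longrightarrow> card F = k n \<Longrightarrow>
      \<not> (\<exists>y \<in> carrier M. \<forall>e \<in> F. isat M (nth (Real y # e # map Real (d n))) (\<chi> n))"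
    and G0: "G []"
    and GS: "\<And>l. G l \<Longrightarrow> uncountable {e \<in> eq_els M. sort_of e = s (length l) \<and> G (l @ [e])}"
    and Gsat: "\<And>l. G l \<Longrightarrow> \<exists>y \<in> carrier M. \<forall>i < length l. isat M (nth (Real y # l ! i # map Real (d i))) (\<chi> i)"
    and Gdef: "\<And>l i. G l \<Longrightarrow> i < length l \<Longrightarrow> dset M {y. isat M (nth (Real y # l ! i # map Real (d i))) (\<chi> i)}"
  shows False
proof -
  define B where "B = Real ` (\<Union>n. set (d n))"
  have B: "countable B" "B \<subseteq> eq_els M"
  proof -
    show "countable B" unfolding B_def
      by (intro countable_image countable_UN) (simp_all add: countable_finite)
    show "B \<subseteq> eq_els M" using d by (force simp: B_def Real_in_eq_els)
  qed
  define Q where "Q l e \<longleftrightarrow> e \<in> eq_els M \<and> sort_of e = s (length l) \<and> G (l @ [e]) \<and> e \<notin> acl M (B \<union> set l)" for l e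
  have Q: "\<exists>e. Q l e" if "G l" for l
  proof -
    have "countable (acl M (B \<union> set l))"
      using B(1) by (intro countable_acl) (simp add: countable_finite)
    then have "\<not> {e \<in> eq_els M. sort_of e = s (length l) \<and> G (l @ [e])} \<subseteq> acl M (B \<union> set l)"
      by (intro notI) (rule notE[OF GS[OF that]], rule countable_subset)
    then obtain e where "e \<in> {e \<in> eq_els M. sort_of e = s (length l) \<and> G (l @ [e])}"
      "e \<notin> acl M (B \<union> set l)" unfolding subset_eq by auto
    then show ?thesis unfolding Q_def by (intro exI[of _ e]) simp
  qed
  define L where "L n = ((\<lambda>l. l @ [SOME e. Q l e]) ^^ n) []" for n
  define a where "a n = (SOME e. Q (L n) e)" for n
  have LS: "L (Suc n) = L n @ [a n]" for n by (simp add: L_def a_def)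
  have GL: "G (L n)" for n
  proof (induction n)
    case 0 then show ?case using G0 by (simp add: L_def)
  next
    case (Suc n)
    then have "Q (L n) (a n)" unfolding a_def using Q by (metis someI)
    then show ?case by (simp add: LS Q_def)
  qed
  then have Qa: "Q (L n) (a n)" for n unfolding a_def using Q by (metis someI)
  have Ln: "L n = map a [0..<n]" for n
  proof (induction n)
    case 0 show ?case by (simp add: L_def)
  qed (simp add: LS)
  have setL: "set (L n) = a ` {..<n}" for n by (auto simp: Ln)
  have "\<exists>x \<in> carrier M. \<forall>n. x \<in> {y. isat M (nth (Real y # a n # map Real (d n))) (\<chi> n)}"
  proof (rule saturated_seq)
    show "monster \<kappa> M" "ring_language_structure M" using S by (auto simp: super_def)
    show "dset M {y. isat M (nth (Real y # a n # map Real (d n))) (\<chi> n)}" for n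
      using Gdef[OF GL[of "Suc n"], of n] by (simp add: Ln del: upt_Suc)
    show "\<exists>y \<in> carrier M. \<forall>i < n. y \<in> {y. isat M (nth (Real y # a i # map Real (d i))) (\<chi> i)}" for n
      using Gsat[OF GL[of n]] by (simp add: Ln)
  qed
  then obtain x where x: "x \<in> carrier M" "\<And>n. isat M (nth (Real x # a n # map Real (d n))) (\<chi> n)"
    by blast
  show False
  proof (rule no_thorn_chain[where a = a and d = "\<lambda>n. map Real (d n)" and \<chi> = \<chi> and k = k, OF S B _ _ _ _ _ x])
    show "a n \<in> eq_els M" for n using Qa by (auto simp: Q_def)
    show "a n \<notin> acl M (B \<union> a ` {..<n})" for n using Qa[of n] by (simp add: Q_def setL)
    show "map Real (d n) \<in> lists B" for n unfolding B_def by (fastforce intro: imageI)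
    show "ifvars (\<chi> n) \<subseteq> {..<2 + length (map Real (d n))}" for n using \<chi> by simp
    have "sort_of (a n) = s n" for n using Qa[of n] by (simp add: Q_def Ln)
    then show "F \<subseteq> {e' \<in> eq_els M. sort_of e' = sort_of (a n)} \<Longrightarrow> finite F \<Longrightarrow> card F = k n \<Longrightarrow>
      \<not> (\<exists>y \<in> carrier M. \<forall>e' \<in> F. isat M (nth (Real y # e' # map Real (d n))) (\<chi> n))" for n F
      using k by simp
  qed
qed

section \<open>Definable subgroups and definable surjections\<close>

definition addsub :: "('m, 'b) ring_scheme \<Rightarrow> 'm set \<Rightarrow> bool" where
  "addsub M H \<longleftrightarrow> H \<subseteq> carrier M \<and> \<zero>\<^bsub>M\<^esub> \<in> H \<and> (\<forall>x \<in> H. \<forall>y \<in> H. x \<ominus>\<^bsub>M\<^esub> y \<in> H)"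

lemma (in ring) addsubD:
  assumes "addsub R H"
  shows "x \<in> H \<Longrightarrow> x \<in> carrier R" "\<zero> \<in> H" "x \<in> H \<Longrightarrow> y \<in> H \<Longrightarrow> x \<ominus> y \<in> H"
    "x \<in> H \<Longrightarrow> \<ominus> x \<in> H" "x \<in> H \<Longrightarrow> y \<in> H \<Longrightarrow> x \<oplus> y \<in> H"
proof -
  show 1: "x \<in> H \<Longrightarrow> x \<in> carrier R" for x using assms by (auto simp: addsub_def)
  show 2: "\<zero> \<in> H" using assms by (auto simp: addsub_def)
  show 3: "x \<in> H \<Longrightarrow> y \<in> H \<Longrightarrow> x \<ominus> y \<in> H" for x y using assms by (auto simp: addsub_def)
  show 4: "x \<in> H \<Longrightarrow> \<ominus> x \<in> H" for x
    using 3[OF 2, of x] 1[of x] by (simp add: a_minus_def)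
  show "x \<in> H \<Longrightarrow> y \<in> H \<Longrightarrow> x \<oplus> y \<in> H"
    using 3[OF _ 4, of x y] 1[of x] 1[of y] by (simp add: a_minus_def)
qed

text \<open>Brings equality of cosets into a form that makes sense for an arbitrary set in place of
  \<open>H\<close>, and then always is an equivalence relation.\<close>

lemma (in ring) cosets_eq:
  assumes H: "addsub R H" and x: "x \<in> carrier R" and y: "y \<in> carrier R"
  shows "(\<forall>w \<in> carrier R. x \<ominus> w \<in> H \<longleftrightarrow> y \<ominus> w \<in> H) \<longleftrightarrow> x \<ominus> y \<in> H"
proof
  assume "\<forall>w \<in> carrier R. x \<ominus> w \<in> H \<longleftrightarrow> y \<ominus> w \<in> H"
  moreover have "y \<ominus> y \<in> H" using addsubD(2)[OF H] y by (simp add: a_minus_def r_neg)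
  ultimately show "x \<ominus> y \<in> H" using y by blast
next
  assume xy: "x \<ominus> y \<in> H"
  show "\<forall>w \<in> carrier R. x \<ominus> w \<in> H \<longleftrightarrow> y \<ominus> w \<in> H"
  proof
    fix w assume w: "w \<in> carrier R"
    have e1: "x \<ominus> w = (x \<ominus> y) \<oplus> (y \<ominus> w)" and e2: "y \<ominus> w = (x \<ominus> w) \<ominus> (x \<ominus> y)"
      using x y w by algebra+
    show "x \<ominus> w \<in> H \<longleftrightarrow> y \<ominus> w \<in> H"
    proof
      assume "x \<ominus> w \<in> H"
      then show "y \<ominus> w \<in> H" by (subst e2) (rule addsubD(3)[OF H _ xy])
    next
      assume "y \<ominus> w \<in> H"
      then show "x \<ominus> w \<in> H" by (subst e1) (rule addsubD(5)[OF H xy])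
    qed
  qed
qed

lemma home_tuples_iff: "xs \<in> home_tuples M (Suc n) \<longleftrightarrow>
    (\<exists>x b. xs = x # b \<and> x \<in> carrier M \<and> b \<in> lists (carrier M) \<and> length b = n)"
  by (cases xs) (auto simp: home_tuples_def)

text \<open>The code of a coset \<open>x + H\<close>, where \<open>H\<close> is defined by \<open>\<phi>\<close> with parameters \<open>b\<close>, is the class of
  \<open>(x, b)\<close> under the relation of defining the same set of \<open>w\<close> with \<open>\<phi>(x - w, b)\<close>. This is an
  equivalence relation for all parameters, not only for those for which \<open>\<phi>\<close> defines a subgroup.\<close>

definition coset_eq :: "nat \<Rightarrow> rform \<Rightarrow> rform" where
  "coset_eq m \<phi> =
    (let f = (\<lambda>i. if i = 0 then 2 * m + 1 else if i < m then i else 2 * m + 1 + i);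
         g = (\<lambda>i. if i = 0 then 2 * m + 1 else if i < m then m + i else 2 * m + 1 + i);
         A = Exists (2 * m + 1) (And (Equal (Var (2 * m + 1)) (Add (Var 0) (Minus (Var (2 * m))))) (fren f \<phi>));
         B = Exists (2 * m + 1) (And (Equal (Var (2 * m + 1)) (Add (Var m) (Minus (Var (2 * m))))) (fren g \<phi>))
     in Neg (Exists (2 * m) (Neg (And (Neg (And A (Neg B))) (Neg (And B (Neg A)))))))"

lemma coset_eq:
  fixes M :: "('m, 'b) ring_scheme"
  assumes L: "ring_language_structure M" and \<phi>: "fvars \<phi> \<subseteq> {..<m}" and m: "m = Suc (length b)" "length c = length b"
    and x: "x \<in> carrier M" "y \<in> carrier M"
  shows "fvars (coset_eq m \<phi>) \<subseteq> {..<2 * m}"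
    and "sat M (nth ((x # b) @ (y # c))) (coset_eq m \<phi>) \<longleftrightarrow>
     (\<forall>w \<in> carrier M. sat M (nth ((x \<ominus>\<^bsub>M\<^esub> w) # b)) \<phi> \<longleftrightarrow> sat M (nth ((y \<ominus>\<^bsub>M\<^esub> w) # c)) \<phi>)"
proof -
  \<comment> \<open>Variables below \<open>m\<close> hold \<open>x # b\<close>, those from
    \<open>m\<close> to \<open>2 * m - 1\<close> hold \<open>y # c\<close>, \<open>2 * m\<close> is
    \<open>w\<close> and \<open>2 * m + 1\<close> is the difference. \<open>f\<close> and
    \<open>g\<close> send variable 0 of \<open>\<phi>\<close> to the difference and the others to
    the respective parameters; their values from \<open>m\<close> on only ensure
    injectivity.\<close>
  define f where "f = (\<lambda>i. if i = 0 then 2 * m + 1 else if i < m then i else 2 * m + 1 + i)"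
  define g where "g = (\<lambda>i. if i = 0 then 2 * m + 1 else if i < m then m + i else 2 * m + 1 + i)"
  have inj: "inj f" "inj g"
    unfolding f_def g_def inj_def by (auto split: if_splits)
  have m0: "m > 0" using m by simp
  define v where "v = nth ((x # b) @ (y # c))"
  define A where "A = Exists (2 * m + 1) (And (Equal (Var (2 * m + 1)) (Add (Var 0) (Minus (Var (2 * m))))) (fren f \<phi>))"
  define B where "B = Exists (2 * m + 1) (And (Equal (Var (2 * m + 1)) (Add (Var m) (Minus (Var (2 * m))))) (fren g \<phi>))"
  have E: "coset_eq m \<phi> = Neg (Exists (2 * m) (Neg (And (Neg (And A (Neg B))) (Neg (And B (Neg A))))))"
    by (simp add: coset_eq_def A_def B_def f_def g_def Let_def)
  have "i \<in> fvars A \<Longrightarrow> i < 2 * m \<or> i = 2 * m" "i \<in> fvars B \<Longrightarrow> i < 2 * m \<or> i = 2 * m" for i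
    using \<phi> m0 by (auto simp: A_def B_def fvars_fren inj) (auto simp: f_def g_def split: if_splits)
  then show "fvars (coset_eq m \<phi>) \<subseteq> {..<2 * m}"
    unfolding E by auto
  have d: "x \<ominus>\<^bsub>M\<^esub> w \<in> carrier M" "y \<ominus>\<^bsub>M\<^esub> w \<in> carrier M" if "w \<in> carrier M" for w
    using L that x by (auto simp: ring_language_structure_def a_minus_def)
  have v: "v 0 = x" "v m = y" using m by (auto simp: v_def nth_append)
  have satA: "sat M (v(2 * m := w)) A \<longleftrightarrow> sat M (nth ((x \<ominus>\<^bsub>M\<^esub> w) # b)) \<phi>" if "w \<in> carrier M" for w
  proof -
    have "sat M (v(2 * m := w)) A \<longleftrightarrow> sat M ((v(2 * m := w, 2 * m + 1 := x \<ominus>\<^bsub>M\<^esub> w)) \<circ> f) \<phi>"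
      using d[OF that] m0 by (simp add: A_def sat_fren[OF inj(1)] v a_minus_def)
    also have "\<dots> \<longleftrightarrow> sat M (nth ((x \<ominus>\<^bsub>M\<^esub> w) # b)) \<phi>"
      by (rule sat_cong) (use \<phi> m in \<open>auto simp: f_def v_def nth_append nth_Cons split: nat.splits\<close>)
    finally show ?thesis .
  qed
  have satB: "sat M (v(2 * m := w)) B \<longleftrightarrow> sat M (nth ((y \<ominus>\<^bsub>M\<^esub> w) # c)) \<phi>" if "w \<in> carrier M" for w
  proof -
    have "sat M (v(2 * m := w)) B \<longleftrightarrow> sat M ((v(2 * m := w, 2 * m + 1 := y \<ominus>\<^bsub>M\<^esub> w)) \<circ> g) \<phi>"
      using d[OF that] m0 by (simp add: B_def sat_fren[OF inj(2)] v a_minus_def)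
    also have "\<dots> \<longleftrightarrow> sat M (nth ((y \<ominus>\<^bsub>M\<^esub> w) # c)) \<phi>"
      by (rule sat_cong) (use \<phi> m in \<open>auto simp: g_def v_def nth_append nth_Cons split: nat.splits\<close>)
    finally show ?thesis .
  qed
  show "sat M (nth ((x # b) @ (y # c))) (coset_eq m \<phi>) \<longleftrightarrow>
     (\<forall>w \<in> carrier M. sat M (nth ((x \<ominus>\<^bsub>M\<^esub> w) # b)) \<phi> \<longleftrightarrow> sat M (nth ((y \<ominus>\<^bsub>M\<^esub> w) # c)) \<phi>)"
    unfolding E v_def[symmetric] sat.simps(2-4) using satA satB by blast
qed

lemma coset_code:
  fixes M :: "'m ring"
  assumes L: "ring_language_structure M" and R: "ring M" and H: "dset M H" "addsub M H"
  obtains s \<chi> d cls where "d \<in> lists (carrier M)" "ifvars \<chi> \<subseteq> {..<2 + length d}"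
    "\<And>x e. x \<in> carrier M \<Longrightarrow> isat M (nth (Real x # e # map Real d)) \<chi> \<longleftrightarrow> e = cls x"
    "\<And>x. x \<in> carrier M \<Longrightarrow> cls x \<in> eq_els M \<and> sort_of (cls x) = s"
    "\<And>x y. x \<in> carrier M \<Longrightarrow> y \<in> carrier M \<Longrightarrow> cls x = cls y \<longleftrightarrow> x \<ominus>\<^bsub>M\<^esub> y \<in> H"
proof -
  interpret ring M by (rule R)
  obtain \<phi> b where b: "b \<in> lists (carrier M)" and \<phi>: "fvars \<phi> \<subseteq> {..<1 + length b}"
    and H\<phi>: "\<And>a. a \<in> carrier M \<Longrightarrow> a \<in> H \<longleftrightarrow> sat M (nth (a # b)) \<phi>"
    using dset_formula[OF H(1) zero_closed] by metis
  define m where "m = Suc (length b)"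
  define E where "E = coset_eq m \<phi>"
  have \<phi>m: "fvars \<phi> \<subseteq> {..<m}" using \<phi> by (simp add: m_def)
  have rel: "(x # c, y # c') \<in> defined_rel M m E \<longleftrightarrow>
      (\<forall>w \<in> carrier M. sat M (nth ((x \<ominus>\<^bsub>M\<^esub> w) # c)) \<phi> \<longleftrightarrow> sat M (nth ((y \<ominus>\<^bsub>M\<^esub> w) # c')) \<phi>)"
    if "x # c \<in> home_tuples M m" "y # c' \<in> home_tuples M m" for x y c c'
  proof -
    have "x \<in> carrier M" "y \<in> carrier M" "m = Suc (length c)" "length c' = length c"
      using that by (auto simp: home_tuples_def m_def)
    then show ?thesis
      using coset_eq(2)[OF L \<phi>m, of c c' x y] that by (simp add: defined_rel_def E_def)
  qed
  have eq: "equiv (home_tuples M m) (defined_rel M m E)"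
  proof (rule equivI)
    show "defined_rel M m E \<subseteq> home_tuples M m \<times> home_tuples M m"
      by (auto simp: defined_rel_def)
    show "refl_on (home_tuples M m) (defined_rel M m E)"
    proof (rule refl_onI)
      fix xs assume xs: "xs \<in> home_tuples M m"
      then obtain x c where "xs = x # c" unfolding m_def home_tuples_iff by blast
      then show "(xs, xs) \<in> defined_rel M m E" using xs rel by blast
    qed
    show "sym (defined_rel M m E)"
    proof (rule symI)
      fix xs ys assume xy: "(xs, ys) \<in> defined_rel M m E"
      then have h: "xs \<in> home_tuples M m" "ys \<in> home_tuples M m" by (auto simp: defined_rel_def)
      then obtain x c y c' where "xs = x # c" "ys = y # c'" unfolding m_def home_tuples_iff by blast
      then show "(ys, xs) \<in> defined_rel M m E" using xy h rel by blast
    qed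
    show "trans (defined_rel M m E)"
    proof (rule transI)
      fix xs ys zs assume xy: "(xs, ys) \<in> defined_rel M m E" and yz: "(ys, zs) \<in> defined_rel M m E"
      then have h: "xs \<in> home_tuples M m" "ys \<in> home_tuples M m" "zs \<in> home_tuples M m"
        by (auto simp: defined_rel_def)
      then obtain x c y c' z c'' where "xs = x # c" "ys = y # c'" "zs = z # c''"
        unfolding m_def home_tuples_iff by blast
      then show "(xs, zs) \<in> defined_rel M m E" using xy yz h rel by simp
    qed
  qed
  define cls where "cls x = Class m E (defined_rel M m E `` {x # b})" for x
  \<comment> \<open>Variable 0 is the element, variable 1 the code, and the parameters
    \<open>b\<close> start at variable 2; hence the shift in the projected tuple.\<close>
  define \<chi> where "\<chi> = IProj m E (Var 0 # map (\<lambda>i. Var (i + 2)) [0..<length b]) 1"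
  have ht: "x # b \<in> home_tuples M m" if "x \<in> carrier M" for x
    using b that by (auto simp: home_tuples_def m_def)
  have 1: "ifvars \<chi> \<subseteq> {..<2 + length b}" by (auto simp: \<chi>_def)
  have 2: "isat M (nth (Real x # e # map Real b)) \<chi> \<longleftrightarrow> e = cls x" if "x \<in> carrier M" for x e
  proof -
    have "map (teval M (un_Real \<circ> nth (Real x # e # map Real b))) (map (\<lambda>i. Var (i + 2)) [0..<length b]) = b"
      by (rule nth_equalityI) auto
    then show ?thesis by (auto simp: \<chi>_def cls_def m_def)
  qed
  have 3: "cls x \<in> eq_els M \<and> sort_of (cls x) = Imag m E" if "x \<in> carrier M" for x
    using ht[OF that] eq coset_eq(1)[OF L \<phi>m, of b b x x] that
    by (auto simp: cls_def eq_els_def E_def m_def intro: quotientI)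
  have 4: "cls x = cls y \<longleftrightarrow> x \<ominus>\<^bsub>M\<^esub> y \<in> H" if x: "x \<in> carrier M" and y: "y \<in> carrier M" for x y
  proof -
    have "cls x = cls y \<longleftrightarrow> (x # b, y # b) \<in> defined_rel M m E"
      unfolding cls_def using eq_equiv_class_iff[OF eq ht[OF x] ht[OF y]] by simp
    also have "\<dots> \<longleftrightarrow> (\<forall>w \<in> carrier M. x \<ominus>\<^bsub>M\<^esub> w \<in> H \<longleftrightarrow> y \<ominus>\<^bsub>M\<^esub> w \<in> H)"
      using rel[OF ht[OF x] ht[OF y]] H\<phi> x y by simp
    also have "\<dots> \<longleftrightarrow> x \<ominus>\<^bsub>M\<^esub> y \<in> H" by (rule cosets_eq[OF H(2) x y])
    finally show ?thesis .
  qed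
  show ?thesis by (rule that[OF b 1 2 3 4])
qed

text \<open>The saturation argument for infinite definable sets, with inequality replaced by
  incongruence modulo \<open>H\<close>. Any labelling \<open>f\<close> of the cosets will
  do.\<close>

lemma uncountable_cosets:
  fixes M :: "'m ring"
  assumes S: "super \<kappa> M" and H: "dset M H" and X: "dset M X" "X \<subseteq> carrier M"
    and f: "\<And>x y. x \<in> carrier M \<Longrightarrow> y \<in> carrier M \<Longrightarrow> f x = f y \<longleftrightarrow> x \<ominus>\<^bsub>M\<^esub> y \<in> H"
    and inf: "infinite (f ` X)"
  shows "uncountable (f ` X)"
proof
  have L: "ring_language_structure M" and M: "monster \<kappa> M" using S by (auto simp: super_def)
  assume c: "countable (f ` X)"
  define s where "s n = inv_into X f (from_nat_into (f ` X) n)" for n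
  have fs: "f (s n) = from_nat_into (f ` X) n" and sX: "s n \<in> X" for n
    using from_nat_into[of "f ` X" n] inf unfolding s_def
    by (auto intro: f_inv_into_f inv_into_into dest: infinite_imp_nonempty simp del: from_nat_into)
  have rng: "range (\<lambda>n. f (s n)) = f ` X"
    unfolding fs using c inf by (metis range_from_nat_into infinite_imp_nonempty)
  define T where "T n = (case n of 0 \<Rightarrow> X | Suc n \<Rightarrow> {x. x \<ominus>\<^bsub>M\<^esub> s n \<notin> H})" for n
  have T: "T 0 = X" "T (Suc n) = {x. x \<ominus>\<^bsub>M\<^esub> s n \<notin> H}" for n by (simp_all add: T_def)
  have sn: "s n \<in> carrier M" for n using sX X(2) by blast
  have "dset M {x. x \<ominus>\<^bsub>M\<^esub> s n \<notin> H}" for n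
    unfolding dset_def mem_Collect_eq
    by (intro dfn_not dset_mem[OF L H] tdef_minus tdef_var tdef_const L sn)
  then have "dset M (T n)" for n
    using X(1) by (cases n) (simp_all add: T)
  moreover have "\<exists>a \<in> carrier M. \<forall>i < n. a \<in> T i" for n
  proof -
    have "infinite (f ` X - (\<lambda>i. f (s i)) ` {..<n})" using inf by simp
    then obtain z where "z \<in> f ` X - (\<lambda>i. f (s i)) ` {..<n}" using infinite_imp_nonempty by blast
    then obtain a where a: "a \<in> X" "\<And>i. i < n \<Longrightarrow> f a \<noteq> f (s i)" by auto
    have aM: "a \<in> carrier M" using a(1) X(2) by blast
    have "a \<in> T i" if "i < n" for i
      using a that f[OF aM sn] by (cases i) (simp_all add: T)
    then show ?thesis using aM by blast
  qed
  ultimately obtain a where aM: "a \<in> carrier M" and a: "\<forall>n. a \<in> T n"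
    using saturated_seq[OF M L, of T] by blast
  then have "a \<in> T 0" "\<And>n. a \<in> T (Suc n)" by blast+
  then have "a \<in> X" "\<And>n. f a \<noteq> f (s n)" using f[OF aM sn] by (simp_all add: T)
  then show False using rng by (metis imageI rangeE)
qed

text \<open>Here \<open>\<chi> n\<close> says that a code is that of the coset of \<open>x\<close>
  modulo \<open>H (Suc n)\<close>; two distinct codes contradict each other. Admissible sequences
  consist of the codes of the cosets of a common element, and the infinite index of
  \<open>H (Suc n)\<close> in \<open>H n\<close> provides the continuations.\<close>

lemma no_subgroup_chain:
  fixes M :: "'m ring" (structure)
  assumes S: "super \<kappa> M" and R: "ring M"
    and H: "\<And>n. dset M (H n)" "\<And>n. addsub M (H n)" "\<And>n. H (Suc n) \<subseteq> H n"
    and inf: "\<And>n::nat. \<exists>T \<subseteq> H n. infinite T \<and> (\<forall>x \<in> T. \<forall>y \<in> T. x \<noteq> y \<longrightarrow> x \<ominus>\<^bsub>M\<^esub> y \<notin> H (Suc n))"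
  shows False
proof -
  interpret ring M by (rule R)
  have L: "ring_language_structure M" using S by (auto simp: super_def)
  have "\<exists>s \<chi> d cls. d \<in> lists (carrier M) \<and> ifvars \<chi> \<subseteq> {..<2 + length d} \<and>
    (\<forall>x \<in> carrier M. \<forall>e. isat M (nth (Real x # e # map Real d)) \<chi> \<longleftrightarrow> e = cls x) \<and>
    (\<forall>x \<in> carrier M. cls x \<in> eq_els M \<and> sort_of (cls x) = s) \<and>
    (\<forall>x \<in> carrier M. \<forall>y \<in> carrier M. cls x = cls y \<longleftrightarrow> x \<ominus>\<^bsub>M\<^esub> y \<in> H (Suc n))" for n
    by (rule coset_code[OF L R H(1,2), of "Suc n"]) blast
  then obtain s \<chi> d cls where d: "\<And>n. d n \<in> lists (carrier M)" and \<chi>: "\<And>n. ifvars (\<chi> n) \<subseteq> {..<2 + length (d n)}"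
    and isat: "\<And>n x e. x \<in> carrier M \<Longrightarrow> isat M (nth (Real x # e # map Real (d n))) (\<chi> n) \<longleftrightarrow> e = cls n x"
    and srt: "\<And>n x. x \<in> carrier M \<Longrightarrow> cls n x \<in> eq_els M \<and> sort_of (cls n x) = s n"
    and cls: "\<And>n x y. x \<in> carrier M \<Longrightarrow> y \<in> carrier M \<Longrightarrow> cls n x = cls n y \<longleftrightarrow> x \<ominus>\<^bsub>M\<^esub> y \<in> H (Suc n)"
    by metis
  have mono: "H n \<subseteq> H i" if "i \<le> n" for i n
    using that H(3) by (simp add: lift_Suc_antimono_le)
  define G where "G l \<longleftrightarrow> (\<exists>x \<in> carrier M. l = map (\<lambda>i. cls i x) [0..<length l])" for l
  show False
  proof (rule no_thorn_tree[OF S d \<chi>, where s = s and k = "\<lambda>_. 2" and G = G])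
    fix n F assume "F \<subseteq> {e \<in> eq_els M. sort_of e = s n}" "finite F" "card F = 2"
    then obtain e e' where "F = {e, e'}" "e \<noteq> e'" by (auto simp: card_2_iff)
    then show "\<not> (\<exists>y \<in> carrier M. \<forall>e \<in> F. isat M (nth (Real y # e # map Real (d n))) (\<chi> n))"
      using isat by auto
  next
    show "G []" by (auto simp: G_def intro: bexI[of _ \<zero>])
  next
    fix l assume "G l"
    then obtain x where x: "x \<in> carrier M" and l: "l = map (\<lambda>i. cls i x) [0..<length l]"
      by (auto simp: G_def)
    define n where "n = length l"
    \<comment> \<open>Moving \<open>x\<close> within its coset modulo \<open>H n\<close> keeps all
      codes chosen so far and varies the next one.\<close>
    define X where "X = {y \<in> carrier M. y \<ominus> x \<in> H n}"
    obtain T where T: "T \<subseteq> H n" "infinite T" "\<And>y z. y \<in> T \<Longrightarrow> z \<in> T \<Longrightarrow> y \<noteq> z \<Longrightarrow> y \<ominus> z \<notin> H (Suc n)"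
      using inf[of n] by blast
    have TM: "y \<in> carrier M" if "y \<in> T" for y using that T(1) addsubD(1)[OF H(2)] by blast
    have canc: "(y \<oplus> x) \<ominus> x = y" "(y \<oplus> x) \<ominus> (z \<oplus> x) = y \<ominus> z" if "y \<in> carrier M" "z \<in> carrier M" for y z
      using x that by algebra+
    have "inj_on (\<lambda>y. cls n (y \<oplus> x)) T"
    proof (rule inj_onI)
      fix y z assume yz: "y \<in> T" "z \<in> T" "cls n (y \<oplus> x) = cls n (z \<oplus> x)"
      then have "(y \<oplus> x) \<ominus> (z \<oplus> x) \<in> H (Suc n)" using cls[of "y \<oplus> x" "z \<oplus> x"] TM x by auto
      then show "y = z" using canc(2)[OF TM TM] T(3) yz by metis
    qed
    then have "infinite ((\<lambda>y. cls n (y \<oplus> x)) ` T)" using T(2) finite_imageD by blast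
    moreover have "(\<lambda>y. cls n (y \<oplus> x)) ` T \<subseteq> cls n ` X"
      using T(1) TM x canc(1) by (auto simp: X_def)
    ultimately have "infinite (cls n ` X)" using finite_subset by blast
    moreover have "dset M X"
    proof -
      have "dfn M (\<lambda>v. v 0 \<ominus> x \<in> H n)"
        by (intro dset_mem[OF L H(1)] tdef_minus tdef_var tdef_const L x)
      then show ?thesis unfolding dset_def by (rule dfn_cong) (auto simp: X_def)
    qed
    ultimately have unc: "uncountable (cls n ` X)"
      by (intro uncountable_cosets[OF S H(1)[of "Suc n"], where f = "cls n"] cls) (auto simp: X_def)
    have "cls n ` X \<subseteq> {e \<in> eq_els M. sort_of e = s (length l) \<and> G (l @ [e])}"
    proof
      fix e assume "e \<in> cls n ` X"
      then obtain y where y: "y \<in> carrier M" "y \<ominus> x \<in> H n" "e = cls n y" by (auto simp: X_def)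
      have "l ! i = cls i y" if i: "i < n" for i
      proof -
        have "y \<ominus> x \<in> H (Suc i)" using y(2) mono[of "Suc i" n] i by auto
        then have "cls i y = cls i x" using cls[OF y(1) x] by simp
        moreover have "l ! i = cls i x" using i by (subst l) (simp add: n_def)
        ultimately show ?thesis by simp
      qed
      then have "l @ [e] = map (\<lambda>i. cls i y) [0..<length (l @ [e])]"
        by (intro nth_equalityI) (auto simp: nth_append n_def y(3) less_Suc_eq simp del: upt_Suc)
      then show "e \<in> {e \<in> eq_els M. sort_of e = s (length l) \<and> G (l @ [e])}"
        using srt[OF y(1), of n] y by (auto simp: G_def n_def)
    qed
    then show "uncountable {e \<in> eq_els M. sort_of e = s (length l) \<and> G (l @ [e])}"
      using unc countable_subset by blast
  next
    fix l assume "G l"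
    then obtain x where x: "x \<in> carrier M" and l: "l = map (\<lambda>i. cls i x) [0..<length l]"
      by (auto simp: G_def)
    have li: "l ! i = cls i x" if "i < length l" for i
      using that by (subst l) simp
    then show "\<exists>y \<in> carrier M. \<forall>i < length l. isat M (nth (Real y # l ! i # map Real (d i))) (\<chi> i)"
      using isat x by blast
  next
    fix l i assume "G l" and i: "i < length l"
    then obtain x where x: "x \<in> carrier M" and l: "l = map (\<lambda>i. cls i x) [0..<length l]"
      by (auto simp: G_def)
    have li: "l ! i = cls i x"
      using i by (subst l) simp
    have "dfn M (\<lambda>v. x \<ominus> v 0 \<in> H (Suc i))"
      by (intro dset_mem[OF L H(1)] tdef_minus tdef_var tdef_const L x)
    then show "dset M {y. isat M (nth (Real y # l ! i # map Real (d i))) (\<chi> i)}"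
      unfolding dset_def li by (rule dfn_cong) (auto simp: isat cls x image_subset_iff)
  qed
qed

section \<open>Finite-to-one correspondences\<close>

lemma drel_formula:
  assumes "dfn M (\<lambda>v. R (v 0) (v 1))" "c \<in> carrier M"
  obtains \<phi> b where "b \<in> lists (carrier M)" "fvars \<phi> \<subseteq> {..<2 + length b}"
    "\<And>x y. x \<in> carrier M \<Longrightarrow> y \<in> carrier M \<Longrightarrow> R x y \<longleftrightarrow> sat M (nth (x # y # b)) \<phi>"
proof -
  obtain \<phi> u where u: "range u \<subseteq> carrier M"
    and P: "\<And>v. range v \<subseteq> carrier M \<Longrightarrow> R (v 0) (v 1) \<longleftrightarrow> sat M (mix v u) \<phi>"
    using assms unfolding dfn_def by blast
  obtain N where N: "fvars \<phi> \<subseteq> {..<N}"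
    using finite_nat_set_iff_bounded[of "fvars \<phi>"] finite_fvars by fastforce
  \<comment> \<open>Under \<open>mix\<close> the two arguments sit at positions 0 and 2. They move
    to the head of the list, and every other position is shifted by 2 into \<open>b\<close>.\<close>
  define f where "f i = (if i = 0 then 0 else if i = 2 then 1 else i + 2)" for i :: nat
  have inj: "inj f" unfolding f_def inj_def by auto
  define w where "w x y = mix (\<lambda>i. if i = 0 then x else if i = 1 then y else c) u" for x y
  define b where "b = map (w c c) [0..<N + 2]"
  have w_range: "range (w x y) \<subseteq> carrier M" if "x \<in> carrier M" "y \<in> carrier M" for x y
    unfolding w_def using that u assms(2) by (intro range_mix) auto
  have w02: "w x y 0 = x" "w x y 2 = y" for x y
    by (auto simp: w_def mix_def)
  have wi: "w x y i = w c c i" if "i \<noteq> 0" "i \<noteq> 2" for x y i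
    using that by (auto simp: w_def mix_def elim!: evenE)
  have "R x y \<longleftrightarrow> sat M (nth (x # y # b)) (fren f \<phi>)" if xy: "x \<in> carrier M" "y \<in> carrier M" for x y
  proof -
    have "R x y \<longleftrightarrow> sat M (w x y) \<phi>"
      using P[of "\<lambda>i. if i = 0 then x else if i = 1 then y else c"] xy assms(2) by (auto simp: w_def)
    also have "\<dots> \<longleftrightarrow> sat M (nth (x # y # b) \<circ> f) \<phi>"
    proof (rule sat_cong)
      fix i assume "i \<in> fvars \<phi>"
      then have "i < N" using N by blast
      then show "w x y i = (nth (x # y # b) \<circ> f) i"
        using wi[of i x y] w02 by (auto simp: f_def b_def simp del: upt_Suc)
    qed
    finally show ?thesis by (simp add: sat_fren[OF inj])
  qed
  moreover have "b \<in> lists (carrier M)"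
    using w_range[OF assms(2,2)] by (auto simp: b_def image_subset_iff)
  moreover have "fvars (fren f \<phi>) \<subseteq> {..<2 + length b}"
    using N by (auto simp: b_def fvars_fren[OF inj] f_def)
  ultimately show ?thesis by (intro that)
qed

text \<open>Iterating \<open>J\<close> attaches to a point of \<open>A\<close> an infinite sequence of elements of \<open>N\<close>, which can be
  chosen generic one after the other.\<close>

lemma no_absorption:
  fixes M :: "'m ring" (structure)
  assumes S: "super \<kappa> M" and z: "\<zero> \<in> carrier M"
    and A: "dset M A" "A \<subseteq> carrier M" "A \<noteq> {}"
    and N: "dset M N" "N \<subseteq> carrier M" "infinite N"
    and J: "dfn M (\<lambda>v. J (v 0) (v 1) (v 2))"
    and onto: "\<And>y e. y \<in> A \<Longrightarrow> e \<in> N \<Longrightarrow> \<exists>x \<in> A. J x y e"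
    and fin: "\<And>x. x \<in> A \<Longrightarrow> finite {(y, e). y \<in> A \<and> e \<in> N \<and> J x y e}"
    and card: "\<And>x. x \<in> A \<Longrightarrow> card {(y, e). y \<in> A \<and> e \<in> N \<and> J x y e} \<le> q"
  shows False
proof -
  have L: "ring_language_structure M" and M: "monster \<kappa> M" using S by (auto simp: super_def)
  \<comment> \<open>\<open>R n x e\<close> says that some chain of \<open>n + 1\<close> steps of
    \<open>J\<close> starting at \<open>x\<close> emits \<open>e\<close> in its last step.\<close>
  define R where "R = rec_nat (\<lambda>x e. e \<in> N \<and> (\<exists>y \<in> carrier M. y \<in> A \<and> J x y e))
    (\<lambda>n P x e. \<exists>y \<in> carrier M. \<exists>e' \<in> carrier M. (y \<in> A \<and> e' \<in> N \<and> J x y e') \<and> P y e)"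
  have R: "R 0 x e \<longleftrightarrow> e \<in> N \<and> (\<exists>y \<in> carrier M. y \<in> A \<and> J x y e)"
    "R (Suc n) x e \<longleftrightarrow> (\<exists>y \<in> carrier M. \<exists>e' \<in> carrier M. (y \<in> A \<and> e' \<in> N \<and> J x y e') \<and> R n y e)" for n x e
    by (simp_all add: R_def)
  have Rdef: "dfn M (\<lambda>v. R n (v 0) (v 1))" for n
  proof (induction n)
    case 0
    have "dfn M (\<lambda>v. v 2 \<in> A \<and> J (v 0) (v 2) (v 1))"
      by (intro dfn_conj dset_mem[OF L A(1)] dfn_sub3[OF L J] tdef_var L)
    then have "dfn M (\<lambda>v. \<exists>y \<in> carrier M. y \<in> A \<and> J (v 0) y (v 1))"
      by (rule dfn_ex) simp
    then show ?case unfolding R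
      by (intro dfn_conj dset_mem[OF L N(1)] tdef_var L)
  next
    case (Suc n)
    have "dfn M (\<lambda>v. (v 2 \<in> A \<and> v 3 \<in> N \<and> J (v 0) (v 2) (v 3)) \<and> R n (v 2) (v 1))"
      by (intro dfn_conj dset_mem[OF L A(1)] dset_mem[OF L N(1)] dfn_sub3[OF L J] dfn_sub2[OF L Suc] tdef_var L)
    then have "dfn M (\<lambda>v. \<exists>e' \<in> carrier M. (v 2 \<in> A \<and> e' \<in> N \<and> J (v 0) (v 2) e') \<and> R n (v 2) (v 1))"
      by (rule dfn_ex) simp
    then show ?case unfolding R
      by (rule dfn_ex) simp
  qed
  \<comment> \<open>At most \<open>q\<close> steps leave each point, so there are at most
    \<open>q ^ Suc n\<close> chains of this length.\<close>
  have Rfin: "finite {e. R n x e} \<and> card {e. R n x e} \<le> q ^ Suc n" if "x \<in> A" for n x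
    using that
  proof (induction n arbitrary: x)
    case 0
    define P where "P = {(y, e). y \<in> A \<and> e \<in> N \<and> J x y e}"
    have sub: "{e. R 0 x e} \<subseteq> snd ` P"
      by (force simp: R P_def)
    have P: "finite P" "card P \<le> q" using fin[OF 0] card[OF 0] by (simp_all add: P_def)
    have "card {e. R 0 x e} \<le> card (snd ` P)" using P(1) sub by (intro card_mono) auto
    also have "\<dots> \<le> q" using card_image_le[OF P(1), of snd] P(2) by simp
    finally show ?case using finite_subset[OF sub] P(1) by simp
  next
    case (Suc n)
    define P where "P = {(y, e). y \<in> A \<and> e \<in> N \<and> J x y e}"
    have sub: "{e. R (Suc n) x e} \<subseteq> (\<Union>p \<in> P. {e. R n (fst p) e})"
      by (auto simp: R P_def)
    have P: "finite P" "card P \<le> q" "\<And>p. p \<in> P \<Longrightarrow> fst p \<in> A"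
      using fin[OF Suc.prems] card[OF Suc.prems] by (auto simp: P_def)
    have fin': "finite (\<Union>p \<in> P. {e. R n (fst p) e})"
      using P Suc.IH by blast
    have "card (\<Union>p \<in> P. {e. R n (fst p) e}) \<le> (\<Sum>p \<in> P. card {e. R n (fst p) e})"
      by (rule card_UN_le[OF P(1)])
    also have "\<dots> \<le> (\<Sum>p \<in> P. q ^ Suc n)"
      using P Suc.IH by (intro sum_mono) blast
    also have "\<dots> \<le> q * q ^ Suc n" using P(2) by simp
    finally have "card (\<Union>p \<in> P. {e. R n (fst p) e}) \<le> q ^ Suc (Suc n)" by simp
    then show ?case using finite_subset[OF sub fin'] card_mono[OF fin' sub] by linarith
  qed
  have RN: "e \<in> N" if "R n x e" for n x e
    using that by (induction n arbitrary: x) (auto simp: R)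
  have AR: "dfn M (\<lambda>v. v 0 \<in> A \<and> R n (v 0) (v 1))" for n
    by (intro dfn_conj dset_mem[OF L A(1)] tdef_var L Rdef)
  have "\<exists>\<phi> b. b \<in> lists (carrier M) \<and> fvars \<phi> \<subseteq> {..<2 + length b} \<and>
    (\<forall>x \<in> carrier M. \<forall>y \<in> carrier M. (x \<in> A \<and> R n x y) \<longleftrightarrow> sat M (nth (x # y # b)) \<phi>)" for n
    by (rule drel_formula[OF AR z, of n]) blast
  then obtain \<phi> d where d: "\<And>n. d n \<in> lists (carrier M)" and \<phi>: "\<And>n. fvars (\<phi> n) \<subseteq> {..<2 + length (d n)}"
    and \<phi>R: "\<And>n x y. x \<in> carrier M \<Longrightarrow> y \<in> carrier M \<Longrightarrow> (x \<in> A \<and> R n x y) \<longleftrightarrow> sat M (nth (x # y # d n)) (\<phi> n)"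
    by metis
  have isat: "isat M (nth (Real x # Real y # map Real (d n))) (emb (\<phi> n)) \<longleftrightarrow> x \<in> A \<and> R n x y"
    if "x \<in> carrier M" "y \<in> carrier M" for n x y
  proof -
    have "sort_of ((Real x # Real y # map Real (d n)) ! i) = Home" if "i \<in> fvars (\<phi> n)" for i
      using \<phi>[of n] that by (auto simp: nth_Cons split: nat.splits)
    then have "isat M (nth (Real x # Real y # map Real (d n))) (emb (\<phi> n)) \<longleftrightarrow>
      sat M (un_Real \<circ> nth (Real x # Real y # map Real (d n))) (\<phi> n)"
      by (rule isat_emb)
    also have "\<dots> \<longleftrightarrow> sat M (nth (x # y # d n)) (\<phi> n)"
      by (rule sat_cong) (use \<phi>[of n] in \<open>auto simp: nth_Cons split: nat.splits\<close>)
    finally show ?thesis using \<phi>R that by simp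
  qed
  define G where "G l \<longleftrightarrow> (\<exists>es \<in> lists N. l = map Real es)" for l :: "'m el list"
  show False
  \<comment> \<open>The value of \<open>k\<close> is one more than the number of elements that can
    be emitted at step \<open>n\<close> from one point.\<close>
  proof (rule no_thorn_tree[OF S d, where \<chi> = "\<lambda>n. emb (\<phi> n)" and s = "\<lambda>_. Home" and k = "\<lambda>n. Suc (q ^ Suc n)" and G = G])
    show "ifvars (emb (\<phi> n)) \<subseteq> {..<2 + length (d n)}" for n using \<phi> by (simp add: ifvars_emb)
    show "G []" by (auto simp: G_def)
    fix l assume Gl: "G l"
    then obtain es where es: "es \<in> lists N" "l = map Real es" by (auto simp: G_def)
    have "Real ` N \<subseteq> {e \<in> eq_els M. sort_of e = Home \<and> G (l @ [e])}"
      using es N(2) by (auto simp: Real_in_eq_els G_def intro!: bexI[of _ "es @ [_]"])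
    moreover have "uncountable (Real ` N)"
      using infinite_dset_uncountable[OF M L N] by (simp add: countable_image_inj_eq inj_on_def)
    ultimately show "uncountable {e \<in> eq_els M. sort_of e = Home \<and> G (l @ [e])}"
      using countable_subset by blast
    \<comment> \<open>The point is built from the back: surjectivity of \<open>J\<close> prepends a
      point that emits \<open>e\<close> and moves on to the point found for the rest.\<close>
    have "\<exists>x \<in> A. \<forall>i < length es. R i x (es ! i)"
      using es(1)
    proof (induction es)
      case Nil then show ?case using A(3) by auto
    next
      case (Cons e es)
      then obtain y where y: "y \<in> A" "\<forall>i < length es. R i y (es ! i)" and e: "e \<in> N" by auto
      obtain x where x: "x \<in> A" "J x y e" using onto y(1) e by blast
      have yM: "y \<in> carrier M" "e \<in> carrier M" using y(1) e A(2) N(2) by auto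
      have "R i x ((e # es) ! i)" if "i < length (e # es)" for i
      proof (cases i)
        case 0 then show ?thesis using x y(1) e yM by (auto simp: R)
      next
        case (Suc j)
        then have "R j y (es ! j)" using that y(2) by simp
        then show ?thesis unfolding Suc R nth_Cons_Suc using x(2) y(1) e yM by blast
      qed
      then show ?case using x(1) by blast
    qed
    then obtain x where x: "x \<in> A" "\<forall>i < length es. R i x (es ! i)" by blast
    have esM: "es ! i \<in> carrier M" if "i < length es" for i
      using es(1) that N(2) by (meson in_listsD nth_mem subsetD)
    show "\<exists>y \<in> carrier M. \<forall>i < length l. isat M (nth (Real y # l ! i # map Real (d i))) (emb (\<phi> i))"
      using x A(2) es(2) isat esM by (intro bexI[of _ x]) auto
    fix i assume i: "i < length l"
    have "dfn M (\<lambda>v. v 0 \<in> A \<and> R i (v 0) (es ! i))"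
      using i es(2) esM
      by (intro dfn_conj dset_mem[OF L A(1)] dfn_sub2[OF L Rdef] tdef_var tdef_const L) auto
    then show "dset M {y. isat M (nth (Real y # l ! i # map Real (d i))) (emb (\<phi> i))}"
      unfolding dset_def by (rule dfn_cong) (use i es(2) esM in \<open>auto simp: isat image_subset_iff\<close>)
  next
    fix n F assume F: "F \<subseteq> {e \<in> eq_els M. sort_of e = Home}" "finite F" "card F = Suc (q ^ Suc n)"
    show "\<not> (\<exists>y \<in> carrier M. \<forall>e \<in> F. isat M (nth (Real y # e # map Real (d n))) (emb (\<phi> n)))"
    proof
      assume "\<exists>y \<in> carrier M. \<forall>e \<in> F. isat M (nth (Real y # e # map Real (d n))) (emb (\<phi> n))"
      then obtain y where y: "y \<in> carrier M" "\<And>e. e \<in> F \<Longrightarrow> isat M (nth (Real y # e # map Real (d n))) (emb (\<phi> n))"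
        by blast
      have *: "y \<in> A \<and> e \<in> Real ` {c. R n y c}" if "e \<in> F" for e
      proof -
        have "e \<in> eq_els M \<and> sort_of e = Home" using F(1) that by auto
        then obtain c where c: "c \<in> carrier M" "e = Real c" unfolding eq_els_Home by auto
        then show ?thesis using y(1) y(2)[OF that] isat by auto
      qed
      have "F \<noteq> {}" using F(3) by auto
      then have "y \<in> A" using * by blast
      then have "card (Real ` {c. R n y c}) \<le> q ^ Suc n" "finite (Real ` {c. R n y c})"
        using Rfin[of y n] card_image_le[of "{c. R n y c}" Real] by auto
      moreover have "F \<subseteq> Real ` {c. R n y c}" using * by blast
      ultimately show False using F(3) card_mono by (metis Suc_n_not_le_n le_trans)
    qed
  qed
qed

section \<open>Division subrings, centralizers and left spaces\<close>

context skew_field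
begin

lemma inv_props:
  assumes "x \<in> carrier R" "x \<noteq> \<zero>"
  shows "inv x \<in> carrier R" "inv x \<otimes> x = \<one>" "x \<otimes> inv x = \<one>" "inv x \<noteq> \<zero>"
proof -
  have u: "x \<in> Units R" using assms skew_field_Units by blast
  show "inv x \<in> carrier R" "inv x \<otimes> x = \<one>" "x \<otimes> inv x = \<one>" using u by auto
  show "inv x \<noteq> \<zero>" using Units_inv_Units[OF u] skew_field_Units by auto
qed

lemma one_nz: "\<one> \<noteq> \<zero>"
  using Units_one_closed skew_field_Units by auto

lemma inv_cancel:
  assumes "x \<in> carrier R" "x \<noteq> \<zero>" "y \<in> carrier R"
  shows "inv x \<otimes> (x \<otimes> y) = y" "x \<otimes> (inv x \<otimes> y) = y" "y \<otimes> x \<otimes> inv x = y" "y \<otimes> inv x \<otimes> x = y"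
  using inv_props[OF assms(1,2)] assms(1,3)
  by (simp_all add: m_assoc) (simp_all add: m_assoc[symmetric])

lemma nz_mult:
  assumes "x \<in> carrier R" "y \<in> carrier R"
  shows "x \<otimes> y = \<zero> \<longleftrightarrow> x = \<zero> \<or> y = \<zero>"
  using assms inv_cancel(1)[of x y] inv_props[of x] by (metis l_null r_null)

lemma diff_zero: "x \<in> carrier R \<Longrightarrow> y \<in> carrier R \<Longrightarrow> x \<ominus> y = \<zero> \<longleftrightarrow> x = y"
  by (rule r_right_minus_eq)

definition divsub :: "'a set \<Rightarrow> bool" where
  "divsub K \<longleftrightarrow> addsub R K \<and> \<one> \<in> K \<and> (\<forall>x \<in> K. \<forall>y \<in> K. x \<otimes> y \<in> K) \<and>
     (\<forall>x \<in> K. x \<noteq> \<zero> \<longrightarrow> inv x \<in> K)"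

lemma divsubD:
  assumes "divsub K"
  shows "addsub R K" "x \<in> K \<Longrightarrow> x \<in> carrier R" "\<zero> \<in> K" "\<one> \<in> K"
    "x \<in> K \<Longrightarrow> y \<in> K \<Longrightarrow> x \<ominus> y \<in> K" "x \<in> K \<Longrightarrow> y \<in> K \<Longrightarrow> x \<oplus> y \<in> K"
    "x \<in> K \<Longrightarrow> \<ominus> x \<in> K" "x \<in> K \<Longrightarrow> y \<in> K \<Longrightarrow> x \<otimes> y \<in> K"
    "x \<in> K \<Longrightarrow> x \<noteq> \<zero> \<Longrightarrow> inv x \<in> K"
  using assms addsubD[of K] unfolding divsub_def by blast+

lemma divsub_carrier: "divsub (carrier R)"
  by (auto simp: divsub_def addsub_def inv_props)

definition cent :: "'a set \<Rightarrow> 'a set \<Rightarrow> 'a set" where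
  "cent K A = {x \<in> K. \<forall>a \<in> A. a \<otimes> x = x \<otimes> a}"

lemma divsub_cent:
  assumes "divsub K" "A \<subseteq> carrier R"
  shows "divsub (cent K A)"
proof -
  note K = divsubD[OF assms(1)]
  have A: "a \<in> carrier R" if "a \<in> A" for a using assms(2) that by blast
  have "a \<otimes> (x \<ominus> y) = (x \<ominus> y) \<otimes> a"
    if "a \<otimes> x = x \<otimes> a" "a \<otimes> y = y \<otimes> a" "x \<in> carrier R" "y \<in> carrier R" "a \<in> carrier R" for a x y
  proof -
    have "a \<otimes> (x \<ominus> y) = a \<otimes> x \<ominus> a \<otimes> y" using that(3-) by algebra
    also have "\<dots> = (x \<ominus> y) \<otimes> a" unfolding that(1,2) using that(3-) by algebra
    finally show ?thesis .
  qed
  moreover have "a \<otimes> (x \<otimes> y) = x \<otimes> y \<otimes> a"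
    if "a \<otimes> x = x \<otimes> a" "a \<otimes> y = y \<otimes> a" "x \<in> carrier R" "y \<in> carrier R" "a \<in> carrier R" for a x y
    using that by (metis m_assoc)
  moreover have "a \<otimes> inv x = inv x \<otimes> a"
    if h: "a \<otimes> x = x \<otimes> a" "x \<noteq> \<zero>" "x \<in> carrier R" "a \<in> carrier R" for a x
  proof -
    have "a \<otimes> inv x = inv x \<otimes> (x \<otimes> a) \<otimes> inv x"
      using inv_props[OF h(3,2)] inv_cancel(1)[OF h(3,2,4)] by simp
    also have "\<dots> = inv x \<otimes> (a \<otimes> x) \<otimes> inv x" using h by simp
    also have "\<dots> = inv x \<otimes> a"
      using inv_cancel(3)[OF h(3,2), of "inv x \<otimes> a"] inv_props(1)[OF h(3,2)] h(3,4)
      by (simp only: m_assoc m_closed)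
    finally show ?thesis .
  qed
  ultimately show ?thesis
    using K A by (auto simp: divsub_def addsub_def cent_def)
qed

lemma cent_sub: "cent K A \<subseteq> K"
  by (auto simp: cent_def)

section \<open>Left vector spaces over division subrings\<close>

definition lsub :: "'a set \<Rightarrow> 'a set \<Rightarrow> bool" where
  "lsub E H \<longleftrightarrow> addsub R H \<and> (\<forall>e \<in> E. \<forall>h \<in> H. e \<otimes> h \<in> H)"

lemma lsubD:
  assumes "lsub E H"
  shows "addsub R H" "x \<in> H \<Longrightarrow> x \<in> carrier R" "\<zero> \<in> H"
    "x \<in> H \<Longrightarrow> y \<in> H \<Longrightarrow> x \<ominus> y \<in> H" "x \<in> H \<Longrightarrow> y \<in> H \<Longrightarrow> x \<oplus> y \<in> H"
    "e \<in> E \<Longrightarrow> x \<in> H \<Longrightarrow> e \<otimes> x \<in> H"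
  using assms addsubD[of H] unfolding lsub_def by blast+

lemma lsubI:
  assumes "H \<subseteq> carrier R" "\<zero> \<in> H" "\<And>x y. x \<in> H \<Longrightarrow> y \<in> H \<Longrightarrow> x \<ominus> y \<in> H"
    "\<And>e x. e \<in> E \<Longrightarrow> x \<in> H \<Longrightarrow> e \<otimes> x \<in> H"
  shows "lsub E H"
  using assms by (auto simp: lsub_def addsub_def)

lemma lsub_inter: "lsub E H \<Longrightarrow> lsub E H' \<Longrightarrow> lsub E (H \<inter> H')"
  by (rule lsubI) (auto dest: lsubD)

lemma lsub_zero: "divsub E \<Longrightarrow> lsub E {\<zero>}"
  by (rule lsubI) (auto dest: divsubD(2) simp: a_minus_def)

lemma lsub_divsub: "divsub K \<Longrightarrow> E \<subseteq> K \<Longrightarrow> lsub E K"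
  by (rule lsubI) (auto dest: divsubD)

fun lspan :: "'a set \<Rightarrow> 'a list \<Rightarrow> 'a set" where
  "lspan E [] = {\<zero>}"
| "lspan E (v # vs) = {e \<otimes> v \<oplus> w | e w. e \<in> E \<and> w \<in> lspan E vs}"

lemma lsub_add_line:
  assumes E: "divsub E" and H: "lsub E H" and w: "w \<in> carrier R"
  shows "lsub E {e \<otimes> w \<oplus> h | e h. e \<in> E \<and> h \<in> H}"
proof (rule lsubI)
  note E = divsubD[OF E] and H = lsubD[OF H]
  show "{e \<otimes> w \<oplus> h | e h. e \<in> E \<and> h \<in> H} \<subseteq> carrier R" using E H w by auto
  have "\<zero> = \<zero> \<otimes> w \<oplus> \<zero>" using w by simp
  then show "\<zero> \<in> {e \<otimes> w \<oplus> h | e h. e \<in> E \<and> h \<in> H}" using E H by blast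
  fix x assume "x \<in> {e \<otimes> w \<oplus> h | e h. e \<in> E \<and> h \<in> H}"
  then obtain e h where x: "x = e \<otimes> w \<oplus> h" "e \<in> E" "h \<in> H" by blast
  {
    fix y assume "y \<in> {e \<otimes> w \<oplus> h | e h. e \<in> E \<and> h \<in> H}"
    then obtain e' h' where y: "y = e' \<otimes> w \<oplus> h'" "e' \<in> E" "h' \<in> H" by blast
    have "e \<in> carrier R" "e' \<in> carrier R" "h \<in> carrier R" "h' \<in> carrier R"
      using x y by (simp_all add: E(2) H(2))
    then have "x \<ominus> y = (e \<ominus> e') \<otimes> w \<oplus> (h \<ominus> h')" unfolding x y using w by algebra
    then show "x \<ominus> y \<in> {e \<otimes> w \<oplus> h | e h. e \<in> E \<and> h \<in> H}"
      using E(5)[OF x(2) y(2)] H(4)[OF x(3) y(3)] by blast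
  }
  fix e' assume e': "e' \<in> E"
  have "e \<in> carrier R" "e' \<in> carrier R" "h \<in> carrier R"
    using x e' by (simp_all add: E(2) H(2))
  then have "e' \<otimes> x = (e' \<otimes> e) \<otimes> w \<oplus> e' \<otimes> h" unfolding x using w by algebra
  then show "e' \<otimes> x \<in> {e \<otimes> w \<oplus> h | e h. e \<in> E \<and> h \<in> H}"
    using E(8)[OF e' x(2)] H(6)[OF e' x(3)] by blast
qed

lemma lsub_lspan: "divsub E \<Longrightarrow> set vs \<subseteq> carrier R \<Longrightarrow> lsub E (lspan E vs)"
proof (induction vs)
  case Nil then show ?case using lsub_zero by simp
next
  case (Cons v vs) then show ?case using lsub_add_line by simp
qed

lemma lspan_least:
  assumes "lsub E H" "set vs \<subseteq> H"
  shows "lspan E vs \<subseteq> H"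
  using assms(2) lsubD(3)[OF assms(1)] lsubD(5)[OF assms(1)] lsubD(6)[OF assms(1)]
  by (induction vs) (auto simp: subset_iff)

lemma lspan_append_left:
  assumes "divsub E" "set us \<subseteq> carrier R" "set vs \<subseteq> carrier R" "x \<in> lspan E us" "y \<in> lspan E vs"
  shows "x \<oplus> y \<in> lspan E (us @ vs)"
  using assms(2,4)
proof (induction us arbitrary: x)
  case Nil
  then show ?case using assms lsubD(2)[OF lsub_lspan[of E vs]] by simp
next
  case (Cons u us)
  then obtain e w where w: "x = e \<otimes> u \<oplus> w" "e \<in> E" "w \<in> lspan E us" by auto
  have c: "e \<in> carrier R" "u \<in> carrier R" "w \<in> carrier R" "y \<in> carrier R"
    using w Cons.prems assms(1,3,5) lsubD(2)[OF lsub_lspan[of E vs], of y] lsubD(2)[OF lsub_lspan[of E us], of w]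
      divsubD(2)[of E e] by simp_all
  have "x \<oplus> y = e \<otimes> u \<oplus> (w \<oplus> y)" unfolding w using c by algebra
  moreover have "w \<oplus> y \<in> lspan E (us @ vs)" using Cons w by simp
  ultimately show ?case using w(2) by auto
qed

lemma lspan_set: "divsub E \<Longrightarrow> set vs \<subseteq> carrier R \<Longrightarrow> v \<in> set vs \<Longrightarrow> v \<in> lspan E vs"
proof (induction vs)
  case (Cons u us)
  have z: "\<zero> \<in> lspan E us" using lsubD(3)[OF lsub_lspan] Cons by simp
  note E = divsubD[OF Cons.prems(1)]
  show ?case
  proof (cases "v = u")
    case True
    have "v = \<one> \<otimes> u \<oplus> \<zero>" using True Cons by simp
    then show ?thesis using z E by auto
  next
    case False
    then have v: "v \<in> lspan E us" using Cons by simp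
    then have "v = \<zero> \<otimes> u \<oplus> v" using Cons lsubD(2)[OF lsub_lspan v] by simp
    then show ?thesis using v E by auto
  qed
qed simp

lemma lspan_mono:
  assumes "divsub E" "set us \<subseteq> set vs" "set vs \<subseteq> carrier R"
  shows "lspan E us \<subseteq> lspan E vs"
  using lspan_least[OF lsub_lspan[OF assms(1,3)]] lspan_set[OF assms(1,3)] assms(2) by blast

text \<open>Induction on \<open>ws\<close>, moving one vector \<open>w\<close> at a time into
  \<open>H'\<close>. Either some vector of \<open>H\<close> has a nonzero
  \<open>w\<close>-coordinate modulo \<open>H'\<close>, and it serves as the one extra generator, or
  \<open>H\<close> meets the enlarged space only inside \<open>H'\<close>.\<close>

lemma finite_codim_inter:
  assumes E: "divsub E" and H: "lsub E H" and "lsub E H'" "set ws \<subseteq> carrier R"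
    and "\<And>x. x \<in> H \<Longrightarrow> \<exists>h \<in> H'. \<exists>w \<in> lspan E ws. x = h \<oplus> w"
  shows "\<exists>us. set us \<subseteq> H \<and> (\<forall>x \<in> H. \<exists>h \<in> H \<inter> H'. \<exists>w \<in> lspan E us. x = h \<oplus> w)"
  using assms(3-)
proof (induction ws arbitrary: H')
  case Nil
  have "x \<in> H'" if x: "x \<in> H" for x
    using Nil(3)[OF x] lsubD(2)[OF Nil(1)] by auto
  then have "\<forall>x \<in> H. \<exists>h \<in> H \<inter> H'. \<exists>w \<in> lspan E []. x = h \<oplus> w"
    using lsubD(2)[OF H] by auto
  then show ?case by (intro exI[of _ "[]"]) simp
next
  case (Cons w ws)
  note ED = divsubD[OF E] and HD = lsubD[OF H] and H'D = lsubD[OF Cons.prems(1)]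
  define H'' where "H'' = {e \<otimes> w \<oplus> h | e h. e \<in> E \<and> h \<in> H'}"
  have wc: "w \<in> carrier R" and wsc: "set ws \<subseteq> carrier R" using Cons.prems by auto
  have H'': "lsub E H''" unfolding H''_def by (rule lsub_add_line[OF E Cons.prems(1) wc])
  have "\<exists>h \<in> H''. \<exists>w \<in> lspan E ws. x = h \<oplus> w" if x: "x \<in> H" for x
  proof -
    obtain h e s where s: "h \<in> H'" "e \<in> E" "s \<in> lspan E ws" "x = h \<oplus> (e \<otimes> w \<oplus> s)"
      using Cons.prems(3)[OF x] by auto
    have "h \<in> carrier R" "e \<in> carrier R" "s \<in> carrier R"
      using s by (simp_all add: ED(2) H'D(2) lsubD(2)[OF lsub_lspan[OF E wsc]])
    then have "x = (e \<otimes> w \<oplus> h) \<oplus> s" unfolding s using wc by algebra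
    then show ?thesis using s unfolding H''_def by blast
  qed
  then obtain us where us: "set us \<subseteq> H" "\<And>x. x \<in> H \<Longrightarrow> \<exists>h \<in> H \<inter> H''. \<exists>w \<in> lspan E us. x = h \<oplus> w"
    using Cons.IH[OF H'' wsc] by blast
  have usc: "set us \<subseteq> carrier R" using us(1) HD(2) by blast
  show ?case
  proof (cases "\<exists>u \<in> H. \<exists>h \<in> H'. \<exists>e \<in> E. e \<noteq> \<zero> \<and> u = e \<otimes> w \<oplus> h")
    case True
    then obtain u h e where u: "u \<in> H" "h \<in> H'" "e \<in> E" "e \<noteq> \<zero>" "u = e \<otimes> w \<oplus> h" by blast
    have "\<exists>h \<in> H \<inter> H'. \<exists>w \<in> lspan E (u # us). x = h \<oplus> w" if x: "x \<in> H" for x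
    proof -
      obtain y s where y: "y \<in> H" "y \<in> H''" "s \<in> lspan E us" "x = y \<oplus> s" using us(2)[OF x] by blast
      obtain e2 h2 where e2: "e2 \<in> E" "h2 \<in> H'" "y = e2 \<otimes> w \<oplus> h2" using y(2) unfolding H''_def by blast
      \<comment> \<open>Subtracting \<open>c \<otimes> u\<close> clears the
        \<open>w\<close>-coordinate of \<open>y\<close>.\<close>
      define c where "c = e2 \<otimes> inv e"
      have c: "c \<in> E" unfolding c_def by (intro ED(8) ED(9) e2(1) u(3,4))
      have cc: "c \<in> carrier R" "e \<in> carrier R" "h \<in> carrier R" "h2 \<in> carrier R" "e2 \<in> carrier R"
        "s \<in> carrier R" "u \<in> carrier R" "y \<in> carrier R"
        using c u(1-3) e2(1,2) y(1,3) by (simp_all add: ED(2) H'D(2) HD(2) lsubD(2)[OF lsub_lspan[OF E usc]])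
      have ce: "c \<otimes> e = e2" unfolding c_def using inv_cancel(4)[OF cc(2) u(4) cc(5)] .
      have "y \<ominus> c \<otimes> u = (e2 \<ominus> c \<otimes> e) \<otimes> w \<oplus> (h2 \<ominus> c \<otimes> h)"
        unfolding e2 u(5) using cc wc by algebra
      also have "\<dots> = h2 \<ominus> c \<otimes> h" unfolding ce using cc wc by (simp add: a_minus_def r_neg)
      finally have "y \<ominus> c \<otimes> u \<in> H'" using H'D(4)[OF e2(2) H'D(6)[OF c u(2)]] by simp
      then have "y \<ominus> c \<otimes> u \<in> H \<inter> H'" using HD(4)[OF y(1) HD(6)[OF c u(1)]] by blast
      moreover have "c \<otimes> u \<oplus> s \<in> lspan E (u # us)" using c y by auto
      moreover have "x = (y \<ominus> c \<otimes> u) \<oplus> (c \<otimes> u \<oplus> s)" unfolding y using cc by algebra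
      ultimately show ?thesis by blast
    qed
    then show ?thesis using us(1) u(1) by (intro exI[of _ "u # us"]) auto
  next
    case False
    have "y \<in> H'" if y: "y \<in> H" "y \<in> H''" for y
    proof -
      obtain e2 h2 where e2: "e2 \<in> E" "h2 \<in> H'" "y = e2 \<otimes> w \<oplus> h2" using y(2) unfolding H''_def by blast
      then have "e2 = \<zero>" using False y(1) by blast
      then show ?thesis using e2 wc H'D(2)[OF e2(2)] by simp
    qed
    then show ?thesis using us by (intro exI[of _ us]) blast
  qed
qed

definition finspan :: "'a set \<Rightarrow> 'a set \<Rightarrow> bool" where
  "finspan E K \<longleftrightarrow> (\<exists>vs. set vs \<subseteq> K \<and> K \<subseteq> lspan E vs)"

text \<open>The preceding lemma with the zero space as \<open>H'\<close>; it places generators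
  inside a subspace of a finitely generated space.\<close>

lemma finite_codim_zero:
  assumes "divsub E" "lsub E H" "set ws \<subseteq> carrier R" "H \<subseteq> lspan E ws"
  shows "finspan E H"
proof -
  have "\<exists>h \<in> {\<zero>}. \<exists>w \<in> lspan E ws. x = h \<oplus> w" if "x \<in> H" for x
    using assms(4) that lsubD(2)[OF assms(2) that] by (auto intro!: bexI[of _ x])
  then obtain us where us: "set us \<subseteq> H" "\<And>x. x \<in> H \<Longrightarrow> \<exists>h \<in> H \<inter> {\<zero>}. \<exists>w \<in> lspan E us. x = h \<oplus> w"
    using finite_codim_inter[OF assms(1,2) lsub_zero[OF assms(1)] assms(3)] by blast
  have usc: "set us \<subseteq> carrier R"
    using lsubD(2)[OF assms(2)] us(1) by blast
  have "x \<in> lspan E us" if x: "x \<in> H" for x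
  proof -
    obtain w where w: "w \<in> lspan E us" "x = \<zero> \<oplus> w" using us(2)[OF x] by blast
    then show ?thesis using lsubD(2)[OF lsub_lspan[OF assms(1) usc] w(1)] by simp
  qed
  then show ?thesis unfolding finspan_def using us(1) by blast
qed

end

section \<open>Surjectivity of inner derivations\<close>

locale super_skew = skew_field M for M :: "'m ring" (structure) +
  fixes \<kappa> :: "'m rel"
  assumes super: "super \<kappa> M"
begin

lemma L: "ring_language_structure M"
  using super by (simp add: super_def)

lemma R: "ring M"
  by unfold_locales

lemma dset_inter: "dset M A \<Longrightarrow> dset M B \<Longrightarrow> dset M (A \<inter> B)"
  unfolding dset_def Int_iff by (rule dfn_conj)

lemma dset_carrier: "dset M (carrier M)"
  unfolding dset_def
  by (rule dfn_cong[OF dfn_eq[OF tdef_var tdef_var, OF L L, of 0 0]]) (auto simp: image_subset_iff)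

lemma dset_sing: "a \<in> carrier M \<Longrightarrow> dset M {a}"
  unfolding dset_def singleton_iff by (intro dfn_eq tdef_var tdef_const L)

lemma dset_cent:
  assumes "dset M K" "dset M A" "A \<subseteq> carrier M"
  shows "dset M (cent K A)"
proof -
  have "dfn M (\<lambda>v. v 1 \<in> A \<longrightarrow> v 1 \<otimes> v 0 = v 0 \<otimes> v 1)"
    by (intro dfn_imp dset_mem[OF L assms(2)] dfn_eq tdef_mult tdef_var L)
  then have "dfn M (\<lambda>v. \<forall>a \<in> carrier M. a \<in> A \<longrightarrow> a \<otimes> v 0 = v 0 \<otimes> a)"
    by (rule dfn_all) simp
  then have "dfn M (\<lambda>v. v 0 \<in> K \<and> (\<forall>a \<in> carrier M. a \<in> A \<longrightarrow> a \<otimes> v 0 = v 0 \<otimes> a))"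
    using assms(1) unfolding dset_def by (rule dfn_conj[rotated])
  then show ?thesis unfolding dset_def
    by (rule dfn_cong) (use assms(3) in \<open>auto simp: cent_def\<close>)
qed

text \<open>For \<open>u\<close> in \<open>H n\<close> outside \<open>H (Suc n)\<close>, the
  multiples of \<open>u\<close> by the infinite \<open>E n\<close> are pairwise incongruent modulo
  \<open>H (Suc n)\<close>, so the index is infinite. The scalars may change along the chain; step
  \<open>n\<close> only needs \<open>E n\<close> to act on both of its ends.\<close>

lemma vec_chain_var:
  assumes E: "\<And>n. divsub (E n)" "\<And>n. infinite (E n)"
    and H: "\<And>n::nat. dset M (H n)" "\<And>n. lsub (E n) (H n)" "\<And>n. lsub (E n) (H (Suc n))"
      "\<And>n. H (Suc n) \<subseteq> H n"
  shows "\<exists>n. H (Suc n) = H n"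
proof (rule ccontr)
  assume "\<nexists>n. H (Suc n) = H n"
  then have "\<exists>u. u \<in> H n - H (Suc n)" for n using H(4)[of n] by blast
  have "\<exists>T \<subseteq> H n. infinite T \<and> (\<forall>x \<in> T. \<forall>y \<in> T. x \<noteq> y \<longrightarrow> x \<ominus> y \<notin> H (Suc n))" for n
  proof -
    obtain u where u: "u \<in> H n" "u \<notin> H (Suc n)" using \<open>\<exists>u. u \<in> H n - H (Suc n)\<close> by blast
    have uc: "u \<in> carrier M" using lsubD(2)[OF H(2) u(1)] .
    have diff: "e = e'" if e: "e \<in> E n" "e' \<in> E n" and h: "e \<otimes> u \<ominus> e' \<otimes> u \<in> H (Suc n)" for e e'
    proof (rule ccontr)
      assume ne: "e \<noteq> e'"
      have c: "e \<in> carrier M" "e' \<in> carrier M" using e divsubD(2)[OF E(1)[of n]] by simp_all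
      then have nz: "e \<ominus> e' \<noteq> \<zero>" using diff_zero ne by simp
      have "e \<otimes> u \<ominus> e' \<otimes> u = (e \<ominus> e') \<otimes> u" using c uc by algebra
      then have "(e \<ominus> e') \<otimes> u \<in> H (Suc n)" using h by simp
      then have "inv (e \<ominus> e') \<otimes> ((e \<ominus> e') \<otimes> u) \<in> H (Suc n)"
        by (rule lsubD(6)[OF H(3) divsubD(9)[OF E(1) divsubD(5)[OF E(1) e] nz]])
      then show False using u(2) inv_cancel(1)[OF _ nz uc] c by simp
    qed
    have H0: "\<zero> \<in> H (Suc n)" by (rule lsubD(3)[OF H(3)])
    define T where "T = (\<lambda>e. e \<otimes> u) ` E n"
    have "inj_on (\<lambda>e. e \<otimes> u) (E n)"
    proof (rule inj_onI)
      fix e e' assume ee: "e \<in> E n" "e' \<in> E n" "e \<otimes> u = e' \<otimes> u"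
      have "e \<otimes> u \<ominus> e' \<otimes> u = \<zero>"
        using ee(3) divsubD(2)[OF E(1) ee(2)] uc diff_zero by simp
      then show "e = e'" using diff[OF ee(1,2)] H0 by simp
    qed
    then have "infinite T" unfolding T_def using E(2)[of n] finite_imageD by blast
    moreover have "T \<subseteq> H n" unfolding T_def using lsubD(6)[OF H(2) _ u(1)] by blast
    moreover have "\<forall>x \<in> T. \<forall>y \<in> T. x \<noteq> y \<longrightarrow> x \<ominus> y \<notin> H (Suc n)" unfolding T_def using diff by blast
    ultimately show ?thesis by blast
  qed
  then show False
    using no_subgroup_chain[OF super R, of H] H lsubD(1) by blast
qed

lemma vec_chain:
  assumes "divsub E" "infinite E"
    and "\<And>n::nat. dset M (H n)" "\<And>n. lsub E (H n)" "\<And>n. H (Suc n) \<subseteq> H n"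
  shows "\<exists>n. H (Suc n) = H n"
  using vec_chain_var[of "\<lambda>_. E" H] assms by blast

definition ad :: "'m \<Rightarrow> 'm \<Rightarrow> 'm" where
  "ad b y = b \<otimes> y \<ominus> y \<otimes> b"

text \<open>Over \<open>E = cent K {b}\<close> the map \<open>ad b\<close> is left linear with
  kernel \<open>E\<close>. Its iterated images stabilize, which makes \<open>K\<close> the sum of
  the image \<open>H\<close> and a finitely generated space, the kernel of an iterate. If
  \<open>H\<close> were proper, the spaces of those \<open>x\<close> with all
  \<open>x \<otimes> c\<close> in \<open>H\<close>, for finite lists of nonzero \<open>c\<close>,
  would still have finite codimension, hence be nonzero, and could be shrunk forever.\<close>

lemma ad_onto:
  assumes K: "divsub K" "dset M K" and b: "b \<in> K" and inf: "infinite (cent K {b})"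
    and nfs: "\<not> finspan (cent K {b}) K" and z: "z \<in> K"
  shows "\<exists>y \<in> K. ad b y = z"
proof -
  define E where "E = cent K {b}"
  note KD = divsubD[OF K(1)]
  have bc: "b \<in> carrier M" using b KD by blast
  have E: "divsub E" unfolding E_def using divsub_cent[OF K(1)] bc by simp
  note ED = divsubD[OF E]
  have infE: "infinite E" using inf by (simp add: E_def)
  have EK: "E \<subseteq> K" unfolding E_def by (rule cent_sub)
  have Kc: "x \<in> carrier M" if "x \<in> K" for x using KD(2)[OF that] .
  define d where "d = ad b"
  have dK: "d y \<in> K" if "y \<in> K" for y
    unfolding d_def ad_def by (intro KD(5) KD(8) b that)
  have d_diff: "d (x \<ominus> y) = d x \<ominus> d y" if "x \<in> K" "y \<in> K" for x y
    unfolding d_def ad_def using Kc[OF that(1)] Kc[OF that(2)] bc by algebra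
  have d_add: "d (x \<oplus> y) = d x \<oplus> d y" if "x \<in> K" "y \<in> K" for x y
    unfolding d_def ad_def using Kc[OF that(1)] Kc[OF that(2)] bc by algebra
  have d_smult: "d (e \<otimes> x) = e \<otimes> d x" if e: "e \<in> E" and x: "x \<in> K" for e x
  proof -
    have be: "b \<otimes> e = e \<otimes> b" and ec: "e \<in> carrier M" using e EK Kc by (auto simp: E_def cent_def)
    have "d (e \<otimes> x) = (b \<otimes> e) \<otimes> x \<ominus> e \<otimes> x \<otimes> b"
      unfolding d_def ad_def using Kc[OF x] ec bc by algebra
    also have "\<dots> = e \<otimes> d x" unfolding be d_def ad_def using Kc[OF x] ec bc by algebra
    finally show ?thesis .
  qed
  have d_zero: "d x = \<zero> \<longleftrightarrow> x \<in> E" if "x \<in> K" for x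
    unfolding d_def ad_def E_def cent_def using that Kc[OF that] bc by (auto simp: diff_zero)
  have dd: "d \<zero> = \<zero>" using d_zero[OF KD(3)] ED(3) by simp
  have funK: "(d ^^ n) y \<in> K" if "y \<in> K" for n y
    using that by (induction n) (auto intro: dK)
  have fun_diff: "(d ^^ n) (x \<ominus> y) = (d ^^ n) x \<ominus> (d ^^ n) y" if "x \<in> K" "y \<in> K" for n x y
    using that by (induction n) (simp_all add: d_diff funK)
  have lsub_im: "lsub E (d ` H)" if H: "lsub E H" "H \<subseteq> K" for H
  proof (rule lsubI)
    show "d ` H \<subseteq> carrier M" using dK Kc H(2) by blast
    show "\<zero> \<in> d ` H" using dd lsubD(3)[OF H(1)] by force
  next
    fix x y assume "x \<in> d ` H" "y \<in> d ` H"
    then obtain x' y' where h: "x' \<in> H" "y' \<in> H" "x = d x'" "y = d y'" by blast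
    then have "x \<ominus> y = d (x' \<ominus> y')" using d_diff H(2) by (simp add: subset_iff)
    then show "x \<ominus> y \<in> d ` H" using lsubD(4)[OF H(1) h(1,2)] by blast
  next
    fix e x assume e: "e \<in> E" and "x \<in> d ` H"
    then obtain x' where h: "x' \<in> H" "x = d x'" by blast
    then have "e \<otimes> x = d (e \<otimes> x')" using d_smult[OF e] H(2) by (simp add: subset_iff)
    then show "e \<otimes> x \<in> d ` H" using lsubD(6)[OF H(1) e h(1)] by blast
  qed
  define D where "D n = (d ^^ n) ` K" for n
  have D: "D 0 = K" "D (Suc n) = d ` D n" for n
    by (simp_all add: D_def image_image)
  have DK: "D n \<subseteq> K" for n unfolding D_def using funK by blast
  have DL: "lsub E (D n)" for n
  proof (induction n)
    case 0 show ?case unfolding D by (rule lsub_divsub[OF K(1) EK])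
  next
    case (Suc n) then show ?case unfolding D using lsub_im DK by blast
  qed
  have Ddef: "dset M (D n)" for n
  proof (induction n)
    case 0 then show ?case unfolding D by (rule K(2))
  next
    case (Suc n)
    have "dfn M (\<lambda>v. v 1 \<in> D n \<and> v 0 = b \<otimes> v 1 \<ominus> v 1 \<otimes> b)"
      by (intro dfn_conj dset_mem[OF L Suc] dfn_eq tdef_minus tdef_mult tdef_var tdef_const L bc)
    then have "dfn M (\<lambda>v. \<exists>y \<in> carrier M. y \<in> D n \<and> v 0 = b \<otimes> y \<ominus> y \<otimes> b)"
      by (rule dfn_ex) simp
    then show ?case unfolding dset_def D
      by (rule dfn_cong) (use DK[of n] Kc in \<open>auto simp: d_def ad_def image_iff\<close>)
  qed
  have Dmono: "D (Suc n) \<subseteq> D n" for n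
    unfolding D_def using dK by (auto simp: funpow_Suc_right simp del: funpow.simps(2))
  obtain n where n: "D (Suc n) = D n"
    using vec_chain[OF E infE, of D, OF Ddef DL Dmono] by blast
  have lspan_lift: "\<exists>y \<in> lspan E us. d y = x" if "set us \<subseteq> K" "x \<in> lspan E (map d us)" for us x
    using that
  proof (induction us arbitrary: x)
    case Nil then show ?case using dd by simp
  next
    case (Cons u us)
    then obtain e w where w: "x = e \<otimes> d u \<oplus> w" "e \<in> E" "w \<in> lspan E (map d us)" by auto
    obtain y where y: "y \<in> lspan E us" "d y = w" using Cons w by auto
    have yK: "y \<in> K" using lspan_least[OF lsub_divsub[OF K(1) EK]] Cons.prems(1) y(1) by auto
    have "d (e \<otimes> u \<oplus> y) = x"
      using d_add[of "e \<otimes> u" y] d_smult[OF w(2), of u] yK Cons.prems(1) KD(8) w(2) EK w(1) y(2) by auto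
    then show ?case using w y by auto
  qed
  have lift: "\<exists>us'. set us' \<subseteq> X \<and> us = map d us'" if "set us \<subseteq> d ` X" for us X
    using that
  proof (induction us)
    case (Cons u us)
    then obtain us' x where "set us' \<subseteq> X" "us = map d us'" "x \<in> X" "u = d x" by auto
    then show ?case by (intro exI[of _ "x # us'"]) simp
  qed simp
  \<comment> \<open>\<open>d\<close> maps the kernel of the next iterate into that of the present
    one, with kernel \<open>E\<close>, so each step adds finitely many generators.\<close>
  have ker: "\<exists>vs. set vs \<subseteq> K \<and> (\<forall>x \<in> K. (d ^^ j) x = \<zero> \<longrightarrow> x \<in> lspan E vs)" for j
  proof (induction j)
    case 0 show ?case by (intro exI[of _ "[]"]) simp
  next
    case (Suc j)
    then obtain ws where ws: "set ws \<subseteq> K" "\<And>x. x \<in> K \<Longrightarrow> (d ^^ j) x = \<zero> \<Longrightarrow> x \<in> lspan E ws" by blast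
    define X where "X = {x \<in> K. (d ^^ Suc j) x = \<zero>}"
    have fs: "(d ^^ Suc j) (e \<otimes> x) = e \<otimes> (d ^^ Suc j) x" if "e \<in> E" "x \<in> K" for e x and j
      using that
    proof (induction j)
      case 0 then show ?case by (simp add: d_smult)
    next
      case (Suc j)
      have "(d ^^ Suc (Suc j)) (e \<otimes> x) = d ((d ^^ Suc j) (e \<otimes> x))" by simp
      also have "\<dots> = e \<otimes> d ((d ^^ Suc j) x)"
        unfolding Suc.IH[OF Suc.prems] by (rule d_smult[OF Suc.prems(1) funK[OF Suc.prems(2)]])
      finally show ?case by simp
    qed
    have X: "lsub E X"
    proof (rule lsubI)
      show "X \<subseteq> carrier M" using Kc by (auto simp: X_def)
      show "\<zero> \<in> X" unfolding X_def using KD(3) dd by (auto simp del: funpow.simps(2)) (induction j; simp)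
    next
      fix x y assume "x \<in> X" "y \<in> X"
      then show "x \<ominus> y \<in> X" unfolding X_def using fun_diff[of x y "Suc j"] KD(5)
        by (simp add: diff_zero del: funpow.simps(2))
    next
      fix e x assume "e \<in> E" "x \<in> X"
      then show "e \<otimes> x \<in> X" unfolding X_def using fs[of e x j] KD(8)[of e x] EK ED(2)
        by (auto simp del: funpow.simps(2))
    qed
    have XK: "X \<subseteq> K" by (auto simp: X_def)
    have "d ` X \<subseteq> lspan E ws"
    proof
      fix y assume "y \<in> d ` X"
      then obtain x where x: "x \<in> K" "(d ^^ Suc j) x = \<zero>" "y = d x" by (auto simp: X_def)
      then have "(d ^^ j) y = \<zero>" by (simp add: funpow_swap1)
      then show "y \<in> lspan E ws" using ws(2) dK x by blast
    qed
    then have "finspan E (d ` X)"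
      using finite_codim_zero[OF E lsub_im[OF X XK]] ws(1) Kc by blast
    then obtain us where us: "set us \<subseteq> d ` X" "d ` X \<subseteq> lspan E us" unfolding finspan_def by blast
    obtain us' where us': "set us' \<subseteq> X" "us = map d us'" using lift[OF us(1)] by blast
    \<comment> \<open>The extra generator \<open>\<one>\<close> accounts for the kernel
      \<open>E\<close> of \<open>d\<close>.\<close>
    have "x \<in> lspan E (\<one> # us')" if x: "x \<in> X" for x
    proof -
      have "d x \<in> lspan E (map d us')" using x us us' by blast
      then obtain y where y: "y \<in> lspan E us'" "d y = d x" using lspan_lift us'(1) XK by blast
      have yK: "y \<in> K" using lspan_least[OF lsub_divsub[OF K(1) EK]] us'(1) XK y(1) by blast
      have xK: "x \<in> K" using x XK by blast
      have "d (x \<ominus> y) = \<zero>" using d_diff[OF xK yK] y(2) Kc[OF dK[OF xK]] by (simp add: diff_zero)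
      then have "x \<ominus> y \<in> E" using d_zero KD(5)[OF xK yK] by blast
      moreover have "x = (x \<ominus> y) \<otimes> \<one> \<oplus> y"
      proof -
        have "x = (x \<ominus> y) \<oplus> y" using Kc[OF xK] Kc[OF yK] by algebra
        then show ?thesis using Kc[OF xK] Kc[OF yK] by simp
      qed
      ultimately show ?thesis using y(1) by auto
    qed
    then show ?case using us'(1) XK KD(4) by (intro exI[of _ "\<one> # us'"]) (auto simp: X_def)
  qed
  obtain vs where vs: "set vs \<subseteq> K" "\<And>x. x \<in> K \<Longrightarrow> (d ^^ n) x = \<zero> \<Longrightarrow> x \<in> lspan E vs"
    using ker[of n] by blast
  define H where "H = d ` K"
  have HL: "lsub E H" and HK: "H \<subseteq> K" and Hdef: "dset M H"
    using DL[of 1] DK[of 1] Ddef[of 1] by (simp_all add: D_def H_def)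
  \<comment> \<open>Stability at \<open>n\<close> gives \<open>y\<close> such that \<open>x\<close>
    and \<open>d y\<close> have the same image under the \<open>n\<close>-th iterate.\<close>
  have codim: "\<exists>h \<in> H. \<exists>w \<in> lspan E vs. x = h \<oplus> w" if x: "x \<in> K" for x
  proof -
    have "(d ^^ n) x \<in> D (Suc n)" unfolding n using x by (simp add: D_def)
    then obtain y where y: "y \<in> K" "(d ^^ n) x = (d ^^ Suc n) y" by (auto simp: D_def)
    have dy: "d y \<in> K" using dK y(1) .
    have "(d ^^ n) (x \<ominus> d y) = \<zero>"
      using fun_diff[OF x dy, of n] y(2) Kc[OF funK[OF x, of n]] by (simp add: diff_zero funpow_swap1)
    then have "x \<ominus> d y \<in> lspan E vs" using vs(2) KD(5)[OF x dy] by blast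
    moreover have "x = d y \<oplus> (x \<ominus> d y)" using Kc[OF x] Kc[OF dy] by algebra
    ultimately show ?thesis using y(1) unfolding H_def by blast
  qed
  have "H = K"
  proof (rule ccontr)
    assume "H \<noteq> K"
    then obtain v where v: "v \<in> K" "v \<notin> H" using HK by blast
    \<comment> \<open>The elements whose right multiples by all members of \<open>xs\<close> fall
      into \<open>H\<close>. Right multiplication commutes with the left scalars, so these are
      subspaces.\<close>
    define P where "P xs = {x \<in> K. \<forall>c \<in> set xs. x \<otimes> c \<in> H}" for xs
    have one: "lsub E {x \<in> K. x \<otimes> c \<in> H}" if c: "c \<in> K" for c
    proof (rule lsubI)
      show "{x \<in> K. x \<otimes> c \<in> H} \<subseteq> carrier M" using Kc by blast
      show "\<zero> \<in> {x \<in> K. x \<otimes> c \<in> H}" using KD(3) lsubD(3)[OF HL] Kc[OF c] by simp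
    next
      fix x y assume xy: "x \<in> {x \<in> K. x \<otimes> c \<in> H}" "y \<in> {x \<in> K. x \<otimes> c \<in> H}"
      then have "x \<in> carrier M" "y \<in> carrier M" using Kc by simp_all
      then have "(x \<ominus> y) \<otimes> c = x \<otimes> c \<ominus> y \<otimes> c" using Kc[OF c] by algebra
      then show "x \<ominus> y \<in> {x \<in> K. x \<otimes> c \<in> H}" using xy KD(5) lsubD(4)[OF HL] by simp
    next
      fix e x assume ex: "e \<in> E" "x \<in> {x \<in> K. x \<otimes> c \<in> H}"
      then have "(e \<otimes> x) \<otimes> c = e \<otimes> (x \<otimes> c)" using Kc c ED(2) by (simp add: m_assoc)
      then show "e \<otimes> x \<in> {x \<in> K. x \<otimes> c \<in> H}" using ex KD(8) EK lsubD(6)[OF HL ex(1)] by auto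
    qed
    have P_Cons: "P (c # xs) = P xs \<inter> {x \<in> K. x \<otimes> c \<in> H}" for c xs
      by (auto simp: P_def)
    have P_Nil: "P [] = K" by (simp add: P_def)
    have PK: "P xs \<subseteq> K" for xs by (auto simp: P_def)
    have PL: "lsub E (P xs)" if "set xs \<subseteq> K" for xs
      using that
    proof (induction xs)
      case Nil show ?case unfolding P_Nil by (rule lsub_divsub[OF K(1) EK])
    next
      case (Cons c xs) then show ?case unfolding P_Cons by (intro lsub_inter one) auto
    qed
    have Pdef: "dset M (P xs)" if "set xs \<subseteq> K" for xs
      using that
    proof (induction xs)
      case Nil show ?case unfolding P_Nil by (rule K(2))
    next
      case (Cons c xs)
      have "dfn M (\<lambda>v. v 0 \<in> K \<and> v 0 \<otimes> c \<in> H)"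
        using Cons.prems Kc by (intro dfn_conj dset_mem[OF L K(2)] dset_mem[OF L Hdef] tdef_mult tdef_var tdef_const L) auto
      then have "dset M {x \<in> K. x \<otimes> c \<in> H}" by (simp add: dset_def)
      then show ?case unfolding P_Cons using Cons by (intro dset_inter) auto
    qed
    have lspan_rmult: "w \<otimes> c \<in> lspan E (map (\<lambda>u. u \<otimes> c) us)"
      if "set us \<subseteq> K" "w \<in> lspan E us" "c \<in> K" for us w c
      using that
    proof (induction us arbitrary: w)
      case Nil then show ?case using Kc by simp
    next
      case (Cons u us)
      then obtain e w' where w: "w = e \<otimes> u \<oplus> w'" "e \<in> E" "w' \<in> lspan E us" by auto
      have w'K: "w' \<in> K" using lspan_least[OF lsub_divsub[OF K(1) EK]] Cons.prems(1) w(3) by auto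
      have cc: "u \<in> carrier M" "c \<in> carrier M" "e \<in> carrier M" "w' \<in> carrier M"
        using Cons.prems w'K w(2) Kc ED(2) by auto
      then have "w \<otimes> c = e \<otimes> (u \<otimes> c) \<oplus> w' \<otimes> c" unfolding w by algebra
      then show ?case using Cons w by auto
    qed
    have Pcodim: "\<exists>us. set us \<subseteq> K \<and> (\<forall>x \<in> K. \<exists>h \<in> P xs. \<exists>w \<in> lspan E us. x = h \<oplus> w)"
      if "set xs \<subseteq> K - {\<zero>}" for xs
      using that
    proof (induction xs)
      case Nil
      have "\<forall>x \<in> K. \<exists>h \<in> P []. \<exists>w \<in> lspan E []. x = h \<oplus> w" using Kc by (simp add: P_Nil)
      then show ?case by (intro exI[of _ "[]"]) simp
    next
      case (Cons c xs)
      then obtain us where us: "set us \<subseteq> K" "\<And>x. x \<in> K \<Longrightarrow> \<exists>h \<in> P xs. \<exists>w \<in> lspan E us. x = h \<oplus> w"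
        by auto
      have c: "c \<in> K" "c \<noteq> \<zero>" and xs: "set xs \<subseteq> K" using Cons.prems by auto
      have ic: "inv c \<in> K" using KD(9) c by blast
      define ws where "ws = map (\<lambda>u. u \<otimes> inv c) vs"
      have wsc: "set ws \<subseteq> carrier M" using vs(1) Kc ic by (auto simp: ws_def)
      have "\<exists>h \<in> {x \<in> K. x \<otimes> c \<in> H}. \<exists>w \<in> lspan E ws. x = h \<oplus> w" if x: "x \<in> P xs" for x
      proof -
        have xK: "x \<in> K" using x PK by blast
        obtain h w where h: "h \<in> H" "w \<in> lspan E vs" "x \<otimes> c = h \<oplus> w"
          using codim[OF KD(8)[OF xK c(1)]] by blast
        have hK: "h \<in> K" using h HK by blast
        have wK: "w \<in> K" using lspan_least[OF lsub_divsub[OF K(1) EK] vs(1)] h(2) by blast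
        have "x = (x \<otimes> c) \<otimes> inv c" using inv_cancel(3)[of c x] c Kc xK by simp
        also have "\<dots> = h \<otimes> inv c \<oplus> w \<otimes> inv c" unfolding h(3) using Kc hK wK ic by (simp add: l_distr)
        finally have "x = h \<otimes> inv c \<oplus> w \<otimes> inv c" .
        moreover have "w \<otimes> inv c \<in> lspan E ws" unfolding ws_def by (rule lspan_rmult[OF vs(1) h(2) ic])
        moreover have "h \<otimes> inv c \<in> {x \<in> K. x \<otimes> c \<in> H}"
          using KD(8)[OF hK ic] inv_cancel(4)[of c h] c Kc hK h(1) by simp
        ultimately show ?thesis by blast
      qed
      then obtain us2 where us2: "set us2 \<subseteq> P xs"
        "\<And>x. x \<in> P xs \<Longrightarrow> \<exists>h \<in> P (c # xs). \<exists>w \<in> lspan E us2. x = h \<oplus> w"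
        using finite_codim_inter[OF E PL[OF xs] one[OF c(1)] wsc] unfolding P_Cons by blast
      have uc: "set us2 \<subseteq> carrier M" "set us \<subseteq> carrier M" using us2(1) us(1) PK Kc by blast+
      have "\<exists>h \<in> P (c # xs). \<exists>w \<in> lspan E (us2 @ us). x = h \<oplus> w" if x: "x \<in> K" for x
      proof -
        obtain h w where h: "h \<in> P xs" "w \<in> lspan E us" "x = h \<oplus> w" using us(2)[OF x] by blast
        obtain h' w' where h': "h' \<in> P (c # xs)" "w' \<in> lspan E us2" "h = h' \<oplus> w'" using us2(2)[OF h(1)] by blast
        have "h' \<in> carrier M" "w' \<in> carrier M" "w \<in> carrier M"
          using h'(1) PK Kc lsubD(2)[OF lsub_lspan[OF E uc(1)] h'(2)] lsubD(2)[OF lsub_lspan[OF E uc(2)] h(2)] by blast+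
        then have "x = h' \<oplus> (w' \<oplus> w)" unfolding h h' by (simp add: a_assoc)
        then show ?thesis using lspan_append_left[OF E uc h'(2) h(2)] h'(1) by blast
      qed
      moreover have "set (us2 @ us) \<subseteq> K" using us(1) us2(1) PK[of xs] by auto
      ultimately show ?case by blast
    qed
    have step: "\<exists>c \<in> K - {\<zero>}. P (c # xs) \<noteq> P xs" if xs: "set xs \<subseteq> K - {\<zero>}" for xs
    proof -
      obtain us where us: "set us \<subseteq> K" "\<And>x. x \<in> K \<Longrightarrow> \<exists>h \<in> P xs. \<exists>w \<in> lspan E us. x = h \<oplus> w"
        using Pcodim[OF xs] by blast
      have "\<exists>h \<in> P xs. h \<noteq> \<zero>"
      proof (rule ccontr)
        assume "\<not> (\<exists>h \<in> P xs. h \<noteq> \<zero>)"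
        then have *: "h = \<zero>" if "h \<in> P xs" for h using that by blast
        have "K \<subseteq> lspan E us"
        proof
          fix x assume "x \<in> K"
          then obtain h w where h: "h \<in> P xs" "w \<in> lspan E us" "x = h \<oplus> w" using us(2) by blast
          have "w \<in> K" using lspan_least[OF lsub_divsub[OF K(1) EK] us(1)] h(2) by blast
          then show "x \<in> lspan E us" using h *[OF h(1)] Kc by simp
        qed
        then show False using nfs us(1) unfolding finspan_def E_def by blast
      qed
      then obtain h where h: "h \<in> P xs" "h \<noteq> \<zero>" by blast
      have hK: "h \<in> K" using h PK by blast
      \<comment> \<open>This multiplier takes \<open>h\<close>, a member of \<open>P xs\<close>, to
        \<open>v\<close> outside \<open>H\<close>, so that \<open>h\<close> drops out of the next
        space.\<close>
      define c where "c = inv h \<otimes> v"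
      have c: "c \<in> K" unfolding c_def using KD(8) KD(9) hK h(2) v(1) by blast
      have hc: "h \<otimes> c = v" unfolding c_def using inv_cancel(2)[of h v] Kc hK h(2) v(1) by simp
      have "v \<noteq> \<zero>" using v(2) lsubD(3)[OF HL] by metis
      then have "c \<noteq> \<zero>" using hc Kc[OF hK] by auto
      moreover have "h \<notin> P (c # xs)" using hc v(2) by (simp add: P_def)
      ultimately show ?thesis using c h(1) by blast
    qed
    define next_c where "next_c xs = (SOME c. c \<in> K - {\<zero>} \<and> P (c # xs) \<noteq> P xs)" for xs
    define X where "X n = ((\<lambda>xs. next_c xs # xs) ^^ n) []" for n
    have XS: "X (Suc n) = next_c (X n) # X n" for n by (simp add: X_def)
    have nc: "next_c xs \<in> K - {\<zero>} \<and> P (next_c xs # xs) \<noteq> P xs" if "set xs \<subseteq> K - {\<zero>}" for xs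
      unfolding next_c_def by (rule someI_ex) (use step[OF that] in blast)
    have XK: "set (X n) \<subseteq> K - {\<zero>}" for n
    proof (induction n)
      case 0 show ?case by (simp add: X_def)
    next
      case (Suc n) then show ?case using nc[OF Suc] by (simp add: XS)
    qed
    have XK': "set (X n) \<subseteq> K" for n using XK by blast
    have Pmono: "P (X (Suc n)) \<subseteq> P (X n)" for n unfolding XS P_Cons by blast
    obtain n where "P (X (Suc n)) = P (X n)"
      using vec_chain[OF E infE, of "\<lambda>n. P (X n)", OF Pdef[OF XK'] PL[OF XK'] Pmono] by blast
    then show False using nc[OF XK[of n]] by (simp add: XS)
  qed
  then have "z \<in> ad b ` K" using z by (simp add: H_def d_def)
  then show ?thesis by (auto simp: image_iff)
qed

end

section \<open>Integer multiples and finite centralizers\<close>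

context skew_field
begin

definition nat_emb :: "nat \<Rightarrow> 'a" where
  "nat_emb n = [n] \<cdot> \<one>"

lemma nat_emb_closed [simp]: "nat_emb n \<in> carrier R"
  by (simp add: nat_emb_def)

lemma nat_emb_simps [simp]: "nat_emb 0 = \<zero>" "nat_emb (Suc 0) = \<one>" "nat_emb (Suc n) = nat_emb n \<oplus> \<one>"
  by (simp_all add: nat_emb_def)

lemma nat_emb_add: "nat_emb (m + n) = nat_emb m \<oplus> nat_emb n"
  by (induction n) (simp_all add: a_assoc)

lemma nat_emb_mult: "nat_emb (m * n) = nat_emb m \<otimes> nat_emb n"
  by (induction n) (simp_all add: nat_emb_add r_distr a_comm)

lemma nat_emb_comm: "x \<in> carrier R \<Longrightarrow> nat_emb n \<otimes> x = x \<otimes> nat_emb n"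
  by (induction n) (simp_all add: l_distr r_distr)

lemma binomial_one:
  assumes u: "u \<in> carrier R"
  shows "(u \<oplus> \<one>) [^] (n::nat) = (\<Oplus>k \<in> {..n}. nat_emb (n choose k) \<otimes> u [^] k)"
proof (induction n)
  case 0 then show ?case using u by simp
next
  case (Suc n)
  define f where "f k = nat_emb (n choose k) \<otimes> u [^] k" for k
  define g where "g k = nat_emb (n choose k) \<otimes> u [^] Suc k" for k
  have c: "f k \<in> carrier R" "g k \<in> carrier R" for k using u by (simp_all add: f_def g_def)
  have fu: "f k \<otimes> u = g k" for k using u by (simp add: f_def g_def m_assoc)
  have "(u \<oplus> \<one>) [^] Suc n = (\<Oplus>k \<in> {..n}. f k) \<otimes> (u \<oplus> \<one>)"
    using Suc by (simp add: f_def)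
  also have "\<dots> = (\<Oplus>k \<in> {..n}. f k) \<otimes> u \<oplus> (\<Oplus>k \<in> {..n}. f k)"
    using u c by (simp add: r_distr)
  also have "(\<Oplus>k \<in> {..n}. f k) \<otimes> u = (\<Oplus>k \<in> {..n}. g k)"
    using u c by (subst finsum_ldistr) (auto simp: fu)
  also have "(\<Oplus>k \<in> {..n}. f k) = (\<Oplus>k \<in> {..Suc n}. f k)"
    using c by (simp add: finsum_Suc f_def binomial_eq_0 u)
  also have "\<dots> = (\<Oplus>k \<in> {..n}. f (Suc k)) \<oplus> f 0"
    using c by (intro finsum_Suc2) auto
  also have "(\<Oplus>k \<in> {..n}. g k) \<oplus> ((\<Oplus>k \<in> {..n}. f (Suc k)) \<oplus> f 0)
    = (\<Oplus>k \<in> {..n}. g k \<oplus> f (Suc k)) \<oplus> f 0"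
    using c by (subst finsum_addf) (auto simp: a_assoc)
  also have "(\<Oplus>k \<in> {..n}. g k \<oplus> f (Suc k)) = (\<Oplus>k \<in> {..n}. nat_emb (Suc n choose Suc k) \<otimes> u [^] Suc k)"
    using u by (intro finsum_cong') (auto simp: f_def g_def nat_emb_add l_distr)
  also have "\<dots> \<oplus> f 0 = (\<Oplus>k \<in> {..Suc n}. nat_emb (Suc n choose k) \<otimes> u [^] k)"
    using u by (subst finsum_Suc2) (auto simp: f_def)
  finally show ?case .
qed

lemma finsum_single:
  assumes "finite A" "i \<in> A" "x \<in> carrier R"
  shows "(\<Oplus>k \<in> A. if k = i then x else \<zero>) = x"
  using add.finprod_singleton[of i A "\<lambda>_. x"] assms by (simp add: eq_commute[of i])

text \<open>The middle binomial coefficients are divisible by \<open>p\<close>. Expanding the power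
  of \<open>w \<oplus> \<one>\<close> with \<open>w = u \<ominus> \<one>\<close> avoids
  signs.\<close>

lemma prime_char_power:
  assumes p: "prime p" "nat_emb p = \<zero>" and u: "u \<in> carrier R"
  shows "(u \<ominus> \<one>) [^] p = u [^] p \<ominus> \<one>"
proof -
  define w where "w = u \<ominus> \<one>"
  have w: "w \<in> carrier R" "w \<oplus> \<one> = u"
    unfolding w_def using u by simp (use u in algebra)
  have p1: "p = Suc (p - 1)" using prime_gt_0_nat[OF p(1)] by simp
  have mid: "nat_emb (p choose k) \<otimes> w [^] k = \<zero>" if "0 < k" "k < p" for k
  proof -
    have "p dvd (p choose k)" by (rule dvd_choose_prime) (use p(1) that in auto)
    then obtain m where "p choose k = p * m" by blast
    then show ?thesis using p(2) w by (simp add: nat_emb_mult)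
  qed
  have "u [^] p = (\<Oplus>k \<in> {..Suc (p - 1)}. nat_emb (p choose k) \<otimes> w [^] k)"
    using binomial_one[OF w(1), of p] w(2) p1 by simp
  also have "\<dots> = w [^] p \<oplus> (\<Oplus>k \<in> {..p - 1}. nat_emb (p choose k) \<otimes> w [^] k)"
    using w p1 by (subst finsum_Suc) auto
  also have "(\<Oplus>k \<in> {..p - 1}. nat_emb (p choose k) \<otimes> w [^] k) = (\<Oplus>k \<in> {..p - 1}. if k = 0 then \<one> else \<zero>)"
    using mid p1 w(1) by (intro finsum_cong') auto
  also have "\<dots> = \<one>" by (rule finsum_single) auto
  finally have "u [^] p = w [^] p \<oplus> \<one>" .
  moreover have "(x \<oplus> \<one>) \<ominus> \<one> = x" if "x \<in> carrier R" for x using that by algebra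
  ultimately have "w [^] p = u [^] p \<ominus> \<one>" using w(1) by simp
  then show ?thesis by (simp add: w_def)
qed

lemma char_cases:
  obtains "\<And>n. n > 0 \<Longrightarrow> nat_emb n \<noteq> \<zero>"
  | p where "prime p" "nat_emb p = \<zero>" "\<And>n. nat_emb n = \<zero> \<Longrightarrow> p dvd n"
proof (cases "\<exists>n > 0. nat_emb n = \<zero>")
  case False then show ?thesis using that(1) by blast
next
  case True
  define p where "p = (LEAST n. n > 0 \<and> nat_emb n = \<zero>)"
  have p: "p > 0" "nat_emb p = \<zero>" using LeastI_ex[OF True] by (auto simp: p_def)
  have least: "n = 0" if "n < p" "nat_emb n = \<zero>" for n
    using not_less_Least[of n "\<lambda>n. n > 0 \<and> nat_emb n = \<zero>"] that by (auto simp: p_def)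
  have dvd: "p dvd n" if "nat_emb n = \<zero>" for n
  proof -
    have "nat_emb n = nat_emb (p * (n div p)) \<oplus> nat_emb (n mod p)"
      by (subst nat_emb_add[symmetric]) simp
    also have "\<dots> = nat_emb (n mod p)" by (simp add: nat_emb_mult p(2))
    finally have "n mod p = 0" using that least p(1) by simp
    then show ?thesis by auto
  qed
  have "p \<noteq> 1" using p(2) one_nz by auto
  moreover have "p dvd a \<or> p dvd b" if pab: "p dvd a * b" for a b
  proof -
    obtain m where "a * b = p * m" using pab by blast
    then have "nat_emb a \<otimes> nat_emb b = \<zero>" by (metis nat_emb_mult p(2) l_null nat_emb_closed)
    then show ?thesis using nz_mult dvd by auto
  qed
  ultimately have "prime_elem p" using p(1) by (intro prime_elemI) auto
  then have "prime p" by simp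
  then show ?thesis using that(2) p(2) dvd by blast
qed

section \<open>Elements with finite centralizer\<close>

lemma pow_comm: "b \<in> carrier R \<Longrightarrow> b \<otimes> b [^] (n::nat) = b [^] n \<otimes> b"
  using nat_pow_mult[of b 1 n] nat_pow_mult[of b n 1] by (simp add: add.commute)

text \<open>The powers of \<open>b\<close> lie in its centralizer, so \<open>b\<close> has a finite
  order \<open>n\<close>. If the characteristic \<open>p\<close> divided \<open>n = p * m\<close>,
  then \<open>b [^] m \<ominus> \<one>\<close> would have \<open>p\<close>-th power zero, against
  the minimality of \<open>n\<close>. So division by the order is possible.\<close>

lemma finite_cent_order:
  assumes K: "divsub K" and b: "b \<in> K" "b \<noteq> \<zero>" and fin: "finite (cent K {b})"
  obtains n :: nat where "n > 0" "b [^] n = \<one>" "nat_emb n \<noteq> \<zero>"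
    "\<And>i. 0 < i \<Longrightarrow> i < n \<Longrightarrow> b [^] i \<noteq> \<one>"
proof -
  note KD = divsubD[OF K]
  have bc: "b \<in> carrier R" using KD b by blast
  have E: "divsub (cent K {b})" using divsub_cent[OF K] bc by simp
  have powE: "b [^] (i::nat) \<in> cent K {b}" for i
  proof (induction i)
    case 0 then show ?case using divsubD(4)[OF E] by simp
  next
    case (Suc i)
    have "b \<in> cent K {b}" using b by (simp add: cent_def)
    then show ?case using divsubD(8)[OF E Suc] by simp
  qed
  have nz: "b [^] (i::nat) \<noteq> \<zero>" for i
    by (induction i) (use bc b(2) nz_mult one_nz in auto)
  have "\<not> inj (\<lambda>i::nat. b [^] i)"
    using fin powE finite_subset[of "range (\<lambda>i::nat. b [^] i)" "cent K {b}"] finite_imageD[of "\<lambda>i::nat. b [^] i" UNIV]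
    by auto
  then obtain i j :: nat where ij: "i < j" "b [^] i = b [^] j"
    by (metis linorder_injI)
  have "b [^] i \<otimes> b [^] (j - i) = b [^] j"
    using nat_pow_mult[OF bc, of i "j - i"] ij(1) by simp
  then have "b [^] i \<otimes> b [^] (j - i) = b [^] i \<otimes> \<one>"
    unfolding ij(2)[symmetric] using bc by simp
  then have "inv (b [^] i) \<otimes> (b [^] i \<otimes> b [^] (j - i)) = inv (b [^] i) \<otimes> (b [^] i \<otimes> \<one>)" by simp
  then have "b [^] (j - i) = \<one>"
    unfolding inv_cancel(1)[OF nat_pow_closed[OF bc] nz nat_pow_closed[OF bc]]
      inv_cancel(1)[OF nat_pow_closed[OF bc] nz one_closed] .
  then have ex: "\<exists>n > 0. b [^] (n::nat) = \<one>"
    using ij(1) by (intro exI[of _ "j - i"]) auto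
  define n where "n = (LEAST n::nat. n > 0 \<and> b [^] n = \<one>)"
  have n: "n > 0" "b [^] n = \<one>" using LeastI_ex[OF ex] by (auto simp: n_def)
  have least: "b [^] i \<noteq> \<one>" if "0 < i" "i < n" for i
    using not_less_Least[of i "\<lambda>n::nat. n > 0 \<and> b [^] n = \<one>"] that by (auto simp: n_def)
  have "nat_emb n \<noteq> \<zero>"
  proof
    assume n0: "nat_emb n = \<zero>"
    show False
    proof (cases rule: char_cases)
      case 1 then show ?thesis using n(1) n0 by blast
    next
      case (2 p)
      then obtain m where m: "n = p * m" using n0 by blast
      have p1: "p > 1" using 2(1) prime_gt_1_nat by blast
      have m0: "0 < m" "m < n" using n(1) p1 unfolding m by auto
      define y where "y = b [^] m"
      have y: "y \<in> carrier R" "y [^] p = \<one>" using bc n(2) by (simp_all add: y_def nat_pow_pow m mult.commute)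
      have "(y \<ominus> \<one>) [^] p = \<zero>"
        using prime_char_power[OF 2(1,2) y(1)] y(2) by (simp add: diff_zero)
      moreover have "z [^] (k::nat) = \<zero> \<longrightarrow> z = \<zero>" if "z \<in> carrier R" for z k
        using that by (induction k) (auto simp: nz_mult one_nz)
      ultimately have "y \<ominus> \<one> = \<zero>" using y(1) by simp
      then show False using least[OF m0] y(1) diff_zero by (simp add: y_def)
    qed
  qed
  then show ?thesis using that n least by blast
qed

lemma finsum_shift:
  assumes f: "\<And>i. f i \<in> carrier R" and "f n = f 0"
  shows "(\<Oplus>i \<in> {..<n}. f (Suc i)) = (\<Oplus>i \<in> {..<n}. f i)"
proof (cases n)
  case (Suc m)
  have "(\<Oplus>i \<in> {..m}. f (Suc i)) \<oplus> f 0 = (\<Oplus>i \<in> {..Suc m}. f i)"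
    using f by (subst finsum_Suc2) auto
  also have "\<dots> = f (Suc m) \<oplus> (\<Oplus>i \<in> {..m}. f i)"
    using f by (subst finsum_Suc) auto
  also have "\<dots> = (\<Oplus>i \<in> {..m}. f i) \<oplus> f 0"
    using f assms(2) Suc by (simp add: a_comm)
  finally show ?thesis using f by (simp add: Suc lessThan_Suc_atMost)
qed simp

lemma finsum_swap:
  fixes m n :: nat
  assumes f: "\<And>i j. f i j \<in> carrier R"
  shows "(\<Oplus>j \<in> {..<n}. \<Oplus>i \<in> {..<m}. f i j) = (\<Oplus>i \<in> {..<m}. \<Oplus>j \<in> {..<n}. f i j)"
proof (induction m)
  case (Suc m)
  have "(\<Oplus>j \<in> {..<n}. \<Oplus>i \<in> {..<Suc m}. f i j) = (\<Oplus>j \<in> {..<n}. f m j \<oplus> (\<Oplus>i \<in> {..<m}. f i j))"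
    using f by (intro finsum_cong') (auto simp: lessThan_Suc intro!: finsum_closed)
  also have "\<dots> = (\<Oplus>j \<in> {..<n}. f m j) \<oplus> (\<Oplus>j \<in> {..<n}. \<Oplus>i \<in> {..<m}. f i j)"
    using f by (intro finsum_addf) (auto intro!: finsum_closed)
  also have "\<dots> = (\<Oplus>i \<in> {..<Suc m}. \<Oplus>j \<in> {..<n}. f i j)"
    unfolding Suc lessThan_Suc using f by (subst finsum_insert) (auto intro!: finsum_closed)
  finally show ?case .
qed simp

text \<open>If \<open>b\<close> has finite order \<open>n\<close>, then \<open>n x\<close> is the sum over \<open>j < n\<close> of the projections of \<open>x\<close> to
  the eigenspaces \<open>{x. b x = x b\<^sup>j}\<close>, and these are as small as the centralizer of \<open>b\<close>.\<close>

lemma infinite_cent: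
  assumes K: "divsub K" and inf: "infinite K" and b: "b \<in> K"
  shows "infinite (cent K {b})"
proof
  assume fin: "finite (cent K {b})"
  note KD = divsubD[OF K]
  have bc: "b \<in> carrier R" using KD b by blast
  have E: "divsub (cent K {b})" using divsub_cent[OF K] bc by simp
  have "b \<noteq> \<zero>"
  proof
    assume "b = \<zero>"
    then have "cent K {b} = K" using KD(2) by (auto simp: cent_def)
    then show False using fin inf by simp
  qed
  then obtain n :: nat where n: "n > 0" "b [^] n = \<one>" "nat_emb n \<noteq> \<zero>"
    and least: "\<And>i. 0 < i \<Longrightarrow> i < n \<Longrightarrow> b [^] i \<noteq> \<one>"
    using finite_cent_order[OF K b _ fin] by blast
  define c where "c = inv b"
  have c: "c \<in> carrier R" "c \<otimes> b = \<one>" "b \<otimes> c = \<one>" "c \<in> K"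
    unfolding c_def using inv_props[OF bc \<open>b \<noteq> \<zero>\<close>] KD(9)[OF b \<open>b \<noteq> \<zero>\<close>] by auto
  have powK: "x [^] (i::nat) \<in> K" if "x \<in> K" for x i
    by (induction i) (use that KD in auto)
  have cb: "c [^] (i::nat) \<otimes> b [^] i = \<one>" for i
  proof (induction i)
    case (Suc i)
    have "c [^] Suc i \<otimes> b [^] Suc i = c [^] i \<otimes> (c \<otimes> b) \<otimes> b [^] i"
      using c(1) bc pow_comm[OF bc, of i, symmetric] by (simp add: m_assoc)
    then show ?case using Suc c bc by simp
  qed simp
  have cn: "c [^] n = \<one>" using cb[of n] n(2) c(1) by simp
  have cnj: "c [^] (n * j) = \<one>" for j
    using c(1) cn by (simp add: nat_pow_pow[symmetric])
  have cleast: "c [^] i \<noteq> \<one>" if "0 < i" "i < n" for i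
    using cb[of i] least[OF that] bc by auto
  \<comment> \<open>Right multiplication by the inverse of one nonzero member maps an eigenspace
    injectively into the centralizer of \<open>b\<close>.\<close>
  define T where "T j = {x \<in> K. b \<otimes> x = x \<otimes> b [^] j}" for j :: nat
  have finT: "finite (T j)" for j
  proof (cases "T j \<subseteq> {\<zero>}")
    case False
    then obtain x0 where x0: "x0 \<in> K" "x0 \<noteq> \<zero>" "b \<otimes> x0 = x0 \<otimes> b [^] j" by (auto simp: T_def)
    have x0c: "x0 \<in> carrier R" using KD x0 by blast
    have "T j \<subseteq> (\<lambda>e. e \<otimes> x0) ` cent K {b}"
    proof
      fix x assume x: "x \<in> T j"
      then have xK: "x \<in> K" "b \<otimes> x = x \<otimes> b [^] j" by (auto simp: T_def)
      have xc: "x \<in> carrier R" using KD xK by blast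
      have i: "inv x0 \<in> carrier R" using inv_props[OF x0c x0(2)] by blast
      have eq: "b [^] j \<otimes> inv x0 = inv x0 \<otimes> b"
      proof -
        have "b [^] j \<otimes> inv x0 = inv x0 \<otimes> (x0 \<otimes> b [^] j) \<otimes> inv x0"
          using inv_cancel(1)[OF x0c x0(2), of "b [^] j"] bc by simp
        also have "\<dots> = inv x0 \<otimes> b \<otimes> x0 \<otimes> inv x0" unfolding x0(3)[symmetric] using i bc x0c by (simp add: m_assoc)
        also have "\<dots> = inv x0 \<otimes> b" using inv_cancel(3)[OF x0c x0(2)] i bc by simp
        finally show ?thesis .
      qed
      have "b \<otimes> (x \<otimes> inv x0) = x \<otimes> b [^] j \<otimes> inv x0" using bc xc i xK(2) by (simp add: m_assoc[symmetric])
      also have "\<dots> = x \<otimes> inv x0 \<otimes> b" using eq xc bc i by (simp add: m_assoc)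
      finally have "x \<otimes> inv x0 \<in> cent K {b}" using KD(8)[OF xK(1) KD(9)[OF x0(1,2)]] by (simp add: cent_def)
      moreover have "x = x \<otimes> inv x0 \<otimes> x0" using inv_cancel(4)[OF x0c x0(2) xc] by simp
      ultimately show "x \<in> (\<lambda>e. e \<otimes> x0) ` cent K {b}" by blast
    qed
    then show ?thesis using fin finite_subset by blast
  qed (auto intro: finite_subset)
  \<comment> \<open>With \<open>c\<close> the inverse of \<open>b\<close>, this is \<open>n\<close>
    times the projection to the \<open>j\<close>-th eigenspace: left multiplication by
    \<open>b\<close> shifts the sum cyclically, up to the factor \<open>b [^] j\<close> on the
    right.\<close>
  define P where "P x j = (\<Oplus>i \<in> {..<n}. b [^] i \<otimes> x \<otimes> c [^] (i * j))" for x and j :: nat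
  have PT: "P x j \<in> T j" if x: "x \<in> K" for x j
  proof -
    have xc: "x \<in> carrier R" using KD x by blast
    define f where "f i = b [^] i \<otimes> x \<otimes> c [^] (i * j) \<otimes> b [^] j" for i
    have fc: "f i \<in> carrier R" for i using xc bc c by (simp add: f_def)
    have f0: "f n = f 0" using xc bc c n(2) cnj by (simp add: f_def)
    have "b \<otimes> P x j = (\<Oplus>i \<in> {..<n}. b \<otimes> (b [^] i \<otimes> x \<otimes> c [^] (i * j)))"
      unfolding P_def using xc bc c by (intro finsum_rdistr) auto
    also have "\<dots> = (\<Oplus>i \<in> {..<n}. f (Suc i))"
    proof (intro finsum_cong' refl)
      fix i assume "i \<in> {..<n}"
      have "c [^] (Suc i * j) \<otimes> b [^] j = c [^] (i * j)"
      proof -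
        have "c [^] (Suc i * j) = c [^] (i * j) \<otimes> c [^] j"
          using nat_pow_mult[OF c(1), of "i * j" j] by (simp add: add.commute)
        then have "c [^] (Suc i * j) \<otimes> b [^] j = c [^] (i * j) \<otimes> (c [^] j \<otimes> b [^] j)"
          using c(1) bc by (simp only: m_assoc nat_pow_closed)
        then show ?thesis using cb[of j] c(1) by simp
      qed
      then have "f (Suc i) = b [^] Suc i \<otimes> x \<otimes> c [^] (i * j)"
        unfolding f_def using xc bc c by (simp add: m_assoc)
      then show "b \<otimes> (b [^] i \<otimes> x \<otimes> c [^] (i * j)) = f (Suc i)"
        using xc bc c pow_comm[OF bc, of i] by (simp add: m_assoc[symmetric])
    qed (use fc in auto)
    also have "\<dots> = (\<Oplus>i \<in> {..<n}. f i)" by (rule finsum_shift[OF fc f0])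
    also have "\<dots> = P x j \<otimes> b [^] j"
      unfolding P_def f_def using xc bc c by (intro finsum_ldistr[symmetric]) auto
    finally have "b \<otimes> P x j = P x j \<otimes> b [^] j" .
    moreover have "P x j \<in> K"
    proof -
      have "(\<Oplus>i \<in> {..<m}. b [^] i \<otimes> x \<otimes> c [^] (i * j)) \<in> K" for m
      proof (induction m)
        case (Suc m)
        have "b [^] m \<otimes> x \<otimes> c [^] (m * j) \<in> K"
          by (rule KD(8)[OF KD(8)[OF powK[OF b] x] powK[OF c(4)]])
        moreover have "(\<Oplus>i \<in> {..<Suc m}. b [^] i \<otimes> x \<otimes> c [^] (i * j)) =
          b [^] m \<otimes> x \<otimes> c [^] (m * j) \<oplus> (\<Oplus>i \<in> {..<m}. b [^] i \<otimes> x \<otimes> c [^] (i * j))"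
          unfolding lessThan_Suc using xc bc c by (subst finsum_insert) auto
        ultimately show ?case using Suc KD(6) by simp
      qed (use KD in simp)
      then show ?thesis by (simp add: P_def)
    qed
    ultimately show ?thesis by (simp add: T_def)
  qed
  have sumP: "(\<Oplus>j \<in> {..<n}. P x j) = x \<otimes> nat_emb n" if x: "x \<in> K" for x
  proof -
    have xc: "x \<in> carrier R" using KD x by blast
    \<comment> \<open>Multiplication by \<open>c [^] i\<close> permutes the summands cyclically, so
      the sum vanishes unless this power is 1, that is unless \<open>i = 0\<close>.\<close>
    have geo: "(\<Oplus>j \<in> {..<n}. c [^] (i * j)) = (if i = 0 then nat_emb n else \<zero>)" if i: "i < n" for i
    proof (cases "i = 0")
      case True
      have "(\<Oplus>j \<in> {..<m}. \<one>) = nat_emb m" for m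
        by (induction m) (simp_all add: lessThan_Suc a_comm)
      then show ?thesis using True by simp
    next
      case False
      define S where "S = (\<Oplus>j \<in> {..<n}. c [^] (i * j))"
      have Sc: "S \<in> carrier R" unfolding S_def using c by (intro finsum_closed) auto
      have "c [^] i \<otimes> S = (\<Oplus>j \<in> {..<n}. c [^] i \<otimes> c [^] (i * j))"
        unfolding S_def using c by (intro finsum_rdistr) auto
      also have "\<dots> = (\<Oplus>j \<in> {..<n}. c [^] (i * Suc j))"
        using c by (intro finsum_cong') (auto simp: nat_pow_mult)
      also have "\<dots> = S" unfolding S_def
        by (rule finsum_shift) (use c cnj[of i] in \<open>auto simp: mult.commute\<close>)
      finally have "(c [^] i \<ominus> \<one>) \<otimes> S = \<zero>"
      proof -
        assume h: "c [^] i \<otimes> S = S"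
        have "(c [^] i \<ominus> \<one>) \<otimes> S = c [^] i \<otimes> S \<ominus> S" using c Sc by (simp add: a_minus_def l_distr l_minus)
        then show ?thesis using h Sc by (simp add: diff_zero)
      qed
      moreover have "c [^] i \<ominus> \<one> \<noteq> \<zero>" using cleast[of i] False i c diff_zero by simp
      ultimately have "S = \<zero>" using nz_mult Sc c by simp
      then show ?thesis using False by (simp add: S_def)
    qed
    have "(\<Oplus>j \<in> {..<n}. P x j) = (\<Oplus>i \<in> {..<n}. \<Oplus>j \<in> {..<n}. b [^] i \<otimes> x \<otimes> c [^] (i * j))"
      unfolding P_def using xc bc c by (intro finsum_swap) auto
    also have "\<dots> = (\<Oplus>i \<in> {..<n}. if i = 0 then x \<otimes> nat_emb n else \<zero>)"
    proof (intro finsum_cong' refl)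
      fix i assume i: "i \<in> {..<n}"
      have "(\<Oplus>j \<in> {..<n}. b [^] i \<otimes> x \<otimes> c [^] (i * j)) = b [^] i \<otimes> x \<otimes> (\<Oplus>j \<in> {..<n}. c [^] (i * j))"
        using xc bc c by (intro finsum_rdistr[symmetric]) auto
      then show "(\<Oplus>j \<in> {..<n}. b [^] i \<otimes> x \<otimes> c [^] (i * j)) = (if i = 0 then x \<otimes> nat_emb n else \<zero>)"
        using geo[of i] i xc bc by auto
    qed (use xc in auto)
    also have "\<dots> = x \<otimes> nat_emb n"
      using n(1) xc by (intro finsum_single) auto
    finally show ?thesis .
  qed
  \<comment> \<open>Every \<open>x\<close> is recovered from its \<open>n\<close> components, each
    taken from a finite set.\<close>
  have "K \<subseteq> (\<lambda>f. (\<Oplus>j \<in> {..<n}. f j) \<otimes> inv (nat_emb n)) ` (PiE {..<n} T)"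
  proof
    fix x assume x: "x \<in> K"
    have xc: "x \<in> carrier R" using KD x by blast
    have Pc: "P x j \<in> carrier R" for j using PT[OF x, of j] KD(2) by (auto simp: T_def)
    have "(\<Oplus>j \<in> {..<n}. restrict (P x) {..<n} j) = x \<otimes> nat_emb n"
      using sumP[OF x] Pc by (subst finsum_cong'[of _ "{..<n}" "P x"]) auto
    then have "x = (\<Oplus>j \<in> {..<n}. restrict (P x) {..<n} j) \<otimes> inv (nat_emb n)"
      using inv_cancel(3)[OF _ n(3) xc] by simp
    moreover have "restrict (P x) {..<n} \<in> PiE {..<n} T" using PT[OF x] by auto
    ultimately show "x \<in> (\<lambda>f. (\<Oplus>j \<in> {..<n}. f j) \<otimes> inv (nat_emb n)) ` (PiE {..<n} T)" by blast
  qed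
  moreover have "finite (PiE {..<n} T)" using finT by (intro finite_PiE) auto
  ultimately show False using inf finite_subset by blast
qed

end

section \<open>Centralizers\<close>

context skew_field
begin

lemma cent_anti: "A \<subseteq> B \<Longrightarrow> cent K B \<subseteq> cent K A"
  by (auto simp: cent_def)

lemma cent_cent: "A \<subseteq> K \<Longrightarrow> A \<subseteq> cent K (cent K A)"
  by (auto simp: cent_def subset_iff)

lemma cent_cent_cent: "A \<subseteq> K \<Longrightarrow> cent K (cent K (cent K A)) = cent K A"
  using cent_anti[OF cent_cent] cent_cent[OF cent_sub] by blast

text \<open>Since \<open>a\<close> lies in its own centralizer, the bicentralizer is contained in
  the set with which it commutes.\<close>

lemma cent_cent_comm:
  assumes "a \<in> K" "x \<in> cent K (cent K {a})" "y \<in> cent K (cent K {a})"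
  shows "x \<otimes> y = y \<otimes> x"
proof -
  have "a \<in> cent K {a}" using assms(1) by (simp add: cent_def)
  then have "y \<in> cent K {a}" using assms(3) by (auto simp: cent_def)
  then show ?thesis using assms(2) by (auto simp: cent_def)
qed

end

context super_skew
begin

text \<open>The bicentralizers \<open>Z n\<close> descend strictly, because the centralizer of
  \<open>Z n\<close> is again that of \<open>a n\<close>, and each is a left space over the
  following one.\<close>

lemma no_cent_chain:
  assumes K: "divsub K" "dset M K" and a: "\<And>n. a n \<in> K"
    and strict: "\<And>n::nat. cent K {a n} \<subset> cent K {a (Suc n)}"
  shows False
proof -
  define Z where "Z n = cent K (cent K {a n})" for n
  have Kc: "K \<subseteq> carrier M" using divsubD(2)[OF K(1)] by blast
  have cc: "cent K {a n} \<subseteq> carrier M" for n using cent_sub Kc by blast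
  have Z: "divsub (Z n)" "dset M (Z n)" for n
  proof -
    show "divsub (Z n)" unfolding Z_def by (rule divsub_cent[OF K(1) cc])
    have "dset M (cent K {a n})"
      using a[of n] Kc by (intro dset_cent K(2) dset_sing) auto
    then show "dset M (Z n)" unfolding Z_def by (rule dset_cent[OF K(2) _ cc])
  qed
  have ZZ: "cent K (Z n) = cent K {a n}" for n
    unfolding Z_def by (rule cent_cent_cent) (use a in simp)
  have mono: "Z (Suc n) \<subseteq> Z n" for n
    unfolding Z_def by (rule cent_anti) (use strict[of n] in blast)
  have ne: "Z (Suc n) \<noteq> Z n" for n using ZZ[of n] ZZ[of "Suc n"] strict[of n] by auto
  \<comment> \<open>A finite member would start an infinite strictly descending sequence of finite
    sets.\<close>
  have "infinite (Z n)" for n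
  proof
    assume fin: "finite (Z n)"
    have "finite (Z (n + k)) \<and> card (Z (n + k)) + k \<le> card (Z n)" for k
    proof (induction k)
      case (Suc k)
      have "Z (n + Suc k) \<subset> Z (n + k)" using mono[of "n + k"] ne[of "n + k"] by auto
      then have "card (Z (n + Suc k)) < card (Z (n + k))" "finite (Z (n + Suc k))"
        using Suc psubset_card_mono finite_subset by blast+
      then show ?case using Suc by simp
    qed (use fin in simp)
    from this[of "Suc (card (Z n))"] show False by simp
  qed
  then have "\<exists>n. Z (Suc n) = Z n"
    \<comment> \<open>The scalars are taken one step further down: \<open>Z (Suc n)\<close> acts
      both on \<open>Z n\<close> and on itself.\<close>
    by (intro vec_chain_var[of "\<lambda>n. Z (Suc n)"] Z mono lsub_divsub) auto
  then show False using ne by blast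
qed

text \<open>If \<open>[a, y] = 1\<close>, then \<open>u = a y\<close> satisfies \<open>u a = a (u - 1)\<close>. Hence \<open>w = u\<close> to the power \<open>p\<^sup>i\<close>
  satisfies \<open>w a = a (w - 1)\<close> and is not central, while \<open>[w, z] = 1\<close> implies that \<open>z\<close> commutes
  with the \<open>p\<close>-th power of \<open>w\<close>. So the centralizers of these powers increase strictly.\<close>

lemma char_p_case:
  assumes K: "divsub K" "dset M K" "infinite K"
    and a: "a \<in> K" "cent K {a} \<noteq> K"
    and big: "\<And>b. b \<in> K \<Longrightarrow> cent K {b} \<noteq> K \<Longrightarrow> \<not> finspan (cent K {b}) K"
    and p: "prime p" "nat_emb p = \<zero>"
  shows False
proof -
  note KD = divsubD[OF K(1)]
  have powK: "x [^] (i::nat) \<in> K" if "x \<in> K" for x i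
    by (induction i) (use that KD in auto)
  have step: "\<exists>y \<in> K. ad x y = \<one>" if "x \<in> K" "cent K {x} \<noteq> K" for x
    by (rule ad_onto[OF K(1,2) that(1) infinite_cent[OF K(1,3) that(1)] big[OF that] KD(4)])
  obtain y where y: "y \<in> K" "ad a y = \<one>" using step[OF a] by blast
  have ac: "a \<in> carrier M" and yc: "y \<in> carrier M" using a y KD(2) by blast+
  have az: "a \<noteq> \<zero>" using y(2) yc one_nz by (auto simp: ad_def a_minus_def)
  define u where "u = a \<otimes> y"
  have u: "u \<in> K" "u \<in> carrier M" unfolding u_def using KD(8)[OF a(1) y(1)] ac yc by auto
  have ua: "u \<otimes> a = a \<otimes> (u \<ominus> \<one>)"
  proof -
    have "u \<otimes> a = a \<otimes> (u \<ominus> (a \<otimes> y \<ominus> y \<otimes> a))" unfolding u_def using ac yc by algebra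
    then show ?thesis using y(2) by (simp add: ad_def)
  qed
  define w where "w i = u [^] (p ^ i)" for i
  have w: "w i \<in> K" "w i \<in> carrier M" for i unfolding w_def using powK u by auto
  have wS: "w (Suc i) = w i [^] p" for i using u by (simp add: w_def nat_pow_pow mult.commute)
  have wm: "(u \<ominus> \<one>) [^] (p ^ i) = w i \<ominus> \<one>" for i
  proof (induction i)
    case 0 then show ?case using u by (simp add: w_def)
  next
    case (Suc i)
    have "(u \<ominus> \<one>) [^] (p ^ Suc i) = ((u \<ominus> \<one>) [^] (p ^ i)) [^] p"
      using u by (simp add: nat_pow_pow mult.commute)
    also have "\<dots> = w (Suc i) \<ominus> \<one>"
      unfolding Suc wS by (rule prime_char_power[OF p w(2)])
    finally show ?case .
  qed
  have conj: "u [^] (k::nat) \<otimes> a = a \<otimes> (u \<ominus> \<one>) [^] k" for k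
  proof (induction k)
    case (Suc k)
    have "u [^] Suc k \<otimes> a = u [^] k \<otimes> (u \<otimes> a)" using u ac by (simp add: m_assoc)
    also have "\<dots> = (u [^] k \<otimes> a) \<otimes> (u \<ominus> \<one>)" unfolding ua using u ac by (simp add: m_assoc)
    also have "\<dots> = a \<otimes> (u \<ominus> \<one>) [^] Suc k" unfolding Suc using u ac by (simp add: m_assoc)
    finally show ?case .
  qed (use ac in simp)
  have noncentral: "cent K {w i} \<noteq> K" for i
  proof
    assume "cent K {w i} = K"
    then have "w i \<otimes> a = a \<otimes> w i" using a(1) by (auto simp: cent_def)
    moreover have "w i \<otimes> a = a \<otimes> (w i \<ominus> \<one>)" using conj[of "p ^ i"] wm[of i] by (simp add: w_def)
    moreover have "a \<otimes> w i \<ominus> a \<otimes> (w i \<ominus> \<one>) = a" if "w i \<in> carrier M"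
    proof -
      have "a \<otimes> w i \<ominus> a \<otimes> (w i \<ominus> \<one>) = a \<otimes> \<one>" using that ac one_closed by algebra
      then show ?thesis using ac by simp
    qed
    ultimately show False using w(2)[of i] ac az diff_zero by (metis m_closed)
  qed
  have "cent K {w i} \<subset> cent K {w (Suc i)}" for i
  proof -
    obtain z where z: "z \<in> K" "ad (w i) z = \<one>" using step[OF w(1) noncentral] by blast
    have zc: "z \<in> carrier M" using z KD by blast
    have eq: "w i \<otimes> z \<ominus> z \<otimes> w i = \<one>" using z(2) by (simp add: ad_def)
    \<comment> \<open>The commutator with \<open>z\<close> is a derivation that sends
      \<open>w i\<close> to 1; hence the usual formula for the derivative of a power, which vanishes
      at exponent \<open>p\<close>.\<close>
    have pw: "w i [^] k \<otimes> z \<ominus> z \<otimes> w i [^] k = nat_emb k \<otimes> w i [^] (k - 1)" for k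
    proof (induction k)
      case 0 then show ?case using zc by (simp add: diff_zero)
    next
      case (Suc k)
      define v where "v = w i [^] k"
      have v: "v \<in> carrier M" unfolding v_def using w by simp
      have "w i [^] Suc k \<otimes> z \<ominus> z \<otimes> w i [^] Suc k =
        (v \<otimes> z \<ominus> z \<otimes> v) \<otimes> w i \<oplus> v \<otimes> (w i \<otimes> z \<ominus> z \<otimes> w i)"
      proof -
        have "(v \<otimes> w i) \<otimes> z \<ominus> z \<otimes> (v \<otimes> w i) = (v \<otimes> z \<ominus> z \<otimes> v) \<otimes> w i \<oplus> v \<otimes> (w i \<otimes> z \<ominus> z \<otimes> w i)"
          using v w(2)[of i] zc by algebra
        then show ?thesis by (simp add: v_def)
      qed
      also have "\<dots> = nat_emb k \<otimes> w i [^] (k - 1) \<otimes> w i \<oplus> v"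
        unfolding eq using Suc v by (simp add: v_def)
      also have "\<dots> = nat_emb k \<otimes> v \<oplus> v"
        using w by (cases k) (simp_all add: v_def m_assoc)
      also have "\<dots> = nat_emb (Suc k) \<otimes> w i [^] (Suc k - 1)"
        using v by (simp add: v_def[symmetric] l_distr)
      finally show ?case .
    qed
    have "w (Suc i) \<otimes> z \<ominus> z \<otimes> w (Suc i) = \<zero>"
      unfolding wS pw[of p] p(2) using w by simp
    then have "z \<in> cent K {w (Suc i)}"
      using z(1) zc w(2)[of "Suc i"] diff_zero by (simp add: cent_def)
    moreover have "z \<notin> cent K {w i}"
      using eq one_nz diff_zero[of "w i \<otimes> z" "z \<otimes> w i"] zc w(2)[of i] by (simp add: cent_def)
    moreover have "cent K {w i} \<subseteq> cent K {w (Suc i)}"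
    proof
      fix x assume x: "x \<in> cent K {w i}"
      then have xc: "x \<in> K" "x \<in> carrier M" using cent_sub[of K] KD(2) by blast+
      have "w i [^] k \<otimes> x = x \<otimes> w i [^] (k::nat)" for k
      proof (induction k)
        case (Suc k)
        have "w i [^] Suc k \<otimes> x = w i [^] k \<otimes> (x \<otimes> w i)"
          using x xc w by (simp add: m_assoc cent_def)
        also have "\<dots> = x \<otimes> w i [^] Suc k" using xc w Suc by (simp add: m_assoc[symmetric])
        finally show ?case .
      qed (use xc in simp)
      then show "x \<in> cent K {w (Suc i)}" unfolding wS using xc by (simp add: cent_def)
    qed
    ultimately show ?thesis by blast
  qed
  then show False using no_cent_chain[OF K(1,2) w(1)] by blast
qed

end

section \<open>Linear combinations\<close>

context ring
begin

text \<open>A sum by recursion on the number of summands follows the syntax of ring terms, so that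
  it is definable and can occur in sentences.\<close>

primrec psum :: "(nat \<Rightarrow> 'a) \<Rightarrow> nat \<Rightarrow> 'a" where
  "psum f 0 = \<zero>"
| "psum f (Suc n) = psum f n \<oplus> f n"

lemma psum_closed: "(\<And>i. i < n \<Longrightarrow> f i \<in> carrier R) \<Longrightarrow> psum f n \<in> carrier R"
  by (induction n) auto

lemma psum_cong: "(\<And>i. i < n \<Longrightarrow> f i = g i) \<Longrightarrow> psum f n = psum g n"
  by (induction n) auto

lemma psum_zero: "psum (\<lambda>i. \<zero>) n = \<zero>"
  by (induction n) auto

lemma psum_finsum:
  assumes "\<And>i. i < n \<Longrightarrow> f i \<in> carrier R"
  shows "psum f n = (\<Oplus>i \<in> {..<n}. f i)"
  using assms
proof (induction n)
  case (Suc n)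
  then have "(\<Oplus>i \<in> {..<n}. f i) \<in> carrier R" by (intro finsum_closed) auto
  then show ?case using Suc unfolding lessThan_Suc by (subst finsum_insert) (auto simp: a_comm)
qed simp

lemma psum_diff:
  assumes "\<And>i. i < n \<Longrightarrow> f i \<in> carrier R" "\<And>i. i < n \<Longrightarrow> g i \<in> carrier R"
  shows "psum (\<lambda>i. f i \<ominus> g i) n = psum f n \<ominus> psum g n"
  using assms
proof (induction n)
  case (Suc n)
  have "psum f n \<in> carrier R" "psum g n \<in> carrier R" "f n \<in> carrier R" "g n \<in> carrier R"
    using Suc.prems psum_closed[of n] by auto
  then have "(psum f n \<ominus> psum g n) \<oplus> (f n \<ominus> g n) = (psum f n \<oplus> f n) \<ominus> (psum g n \<oplus> g n)" by algebra
  then show ?case using Suc by simp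
qed (simp add: a_minus_def)

lemma psum_lmult:
  assumes "\<And>i. i < n \<Longrightarrow> f i \<in> carrier R" "c \<in> carrier R"
  shows "psum (\<lambda>i. c \<otimes> f i) n = c \<otimes> psum f n"
  using assms by (induction n) (simp_all add: r_distr psum_closed)

lemma psum_rmult:
  assumes "\<And>i. i < n \<Longrightarrow> f i \<in> carrier R" "c \<in> carrier R"
  shows "psum (\<lambda>i. f i \<otimes> c) n = psum f n \<otimes> c"
  using assms by (induction n) (simp_all add: l_distr psum_closed)

lemma psum_shift:
  assumes "\<And>i. i < Suc n \<Longrightarrow> f i \<in> carrier R"
  shows "psum f (Suc n) = f 0 \<oplus> psum (\<lambda>i. f (Suc i)) n"
  using assms
proof (induction n)
  case (Suc n)
  have "f 0 \<in> carrier R" "psum (\<lambda>i. f (Suc i)) n \<in> carrier R" "f (Suc n) \<in> carrier R"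
    using Suc.prems psum_closed[of n "\<lambda>i. f (Suc i)"] by auto
  moreover have "psum f (Suc n) = f 0 \<oplus> psum (\<lambda>i. f (Suc i)) n" using Suc by simp
  ultimately show ?case unfolding psum.simps(2)[of f "Suc n"] by (simp add: a_assoc)
qed simp

lemma psum_swap:
  assumes "\<And>i j. i < m \<Longrightarrow> j < n \<Longrightarrow> f i j \<in> carrier R"
  shows "psum (\<lambda>i. psum (f i) n) m = psum (\<lambda>j. psum (\<lambda>i. f i j) m) n"
  using assms
proof (induction m)
  case (Suc m)
  have add: "psum (\<lambda>i. g i \<oplus> h i) k = psum g k \<oplus> psum h k"
    if "\<And>i. i < k \<Longrightarrow> g i \<in> carrier R" "\<And>i. i < k \<Longrightarrow> h i \<in> carrier R" for g h k
    using that
  proof (induction k)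
    case (Suc k)
    then have "psum g k \<in> carrier R" "psum h k \<in> carrier R" "g k \<in> carrier R" "h k \<in> carrier R"
      using psum_closed[of k] by auto
    then show ?case using Suc by (simp add: a_ac)
  qed simp
  have c: "psum (\<lambda>i. f i j) m \<in> carrier R" if "j < n" for j
    using Suc.prems that by (intro psum_closed) auto
  show ?case using Suc by (simp add: add c)
qed (simp add: psum_zero)

end

section \<open>Linear equations and independence over division subrings\<close>

context skew_field
begin

lemma lsub_psum: "lsub E H \<Longrightarrow> (\<And>i. i < n \<Longrightarrow> f i \<in> H) \<Longrightarrow> psum f n \<in> H"
  by (induction n) (simp_all add: lsubD(3,5))

text \<open>Gaussian elimination with the unknowns multiplying from the left: equation
  \<open>j\<close>, with pivot \<open>a i0 j\<close>, eliminates the unknown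
  \<open>i0\<close>.\<close>

lemma homogeneous_system:
  assumes E: "divsub E" and "finite J" "finite I" "card J < card I" "\<And>i j. a i j \<in> E"
  shows "\<exists>e. (\<forall>i. e i \<in> E) \<and> (\<exists>i \<in> I. e i \<noteq> \<zero>) \<and> (\<forall>j \<in> J. (\<Oplus>i \<in> I. e i \<otimes> a i j) = \<zero>)"
  using assms(2-)
proof (induction J arbitrary: I a)
  case empty
  then obtain i where "i \<in> I" by (metis card_gt_0_iff card.empty ex_in_conv)
  then show ?case using divsubD(4)[OF E] one_nz by (intro exI[of _ "\<lambda>_. \<one>"]) auto
next
  case (insert j J)
  note ED = divsubD[OF E]
  show ?case
  proof (cases "\<exists>i \<in> I. a i j \<noteq> \<zero>")
    case False
    have "card J < card I" using insert by simp
    then obtain e where e: "\<And>i. e i \<in> E" "\<exists>i \<in> I. e i \<noteq> \<zero>" "\<And>j. j \<in> J \<Longrightarrow> (\<Oplus>i \<in> I. e i \<otimes> a i j) = \<zero>"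
      using insert.IH[of I a] insert.prems by blast
    have "(\<Oplus>i \<in> I. e i \<otimes> a i j) = (\<Oplus>i \<in> I. \<zero>)"
      using False e(1) ED(2) by (intro finsum_cong') auto
    then show ?thesis using e by (intro exI[of _ e]) auto
  next
    case True
    then obtain i0 where i0: "i0 \<in> I" "a i0 j \<noteq> \<zero>" by blast
    define I' where "I' = I - {i0}"
    have I': "finite I'" "card J < card I'" "i0 \<notin> I'" "I = Set.insert i0 I'"
      unfolding I'_def using insert.prems insert.hyps i0(1) by (auto simp: card_Diff_singleton)
    define q where "q = inv (a i0 j)"
    have q: "q \<in> E" "q \<otimes> a i0 j = \<one>" unfolding q_def
      using ED(9)[OF insert.prems(3) i0(2)] inv_props(2)[OF ED(2)[OF insert.prems(3)] i0(2)] by auto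
    \<comment> \<open>The coefficients after elimination. Equation \<open>j\<close> gives the
      unknown \<open>i0\<close> as \<open>\<ominus> (s \<otimes> q)\<close>, with \<open>s\<close>
      the sum of the other terms of that equation.\<close>
    define a' where "a' i j' = a i j' \<ominus> a i j \<otimes> q \<otimes> a i0 j'" for i j'
    have a': "a' i j' \<in> E" for i j' unfolding a'_def by (intro ED(5) ED(8) insert.prems(3) q)
    obtain e where e: "\<And>i. e i \<in> E" "\<exists>i \<in> I'. e i \<noteq> \<zero>" "\<And>j. j \<in> J \<Longrightarrow> (\<Oplus>i \<in> I'. e i \<otimes> a' i j) = \<zero>"
      using insert.IH[of I' a'] I'(1,2) a' by blast
    have ac: "a i j' \<in> carrier R" "e i \<in> carrier R" "q \<in> carrier R" for i j'
      by (intro ED(2) insert.prems(3) e(1) q(1))+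
    define s where "s = (\<Oplus>i \<in> I'. e i \<otimes> a i j)"
    have s: "s \<in> E" "s \<in> carrier R"
    proof -
      have "(\<Oplus>i \<in> B. e i \<otimes> a i j) \<in> E" if "finite B" for B
        using that by induction (use ac ED(3,6,8) e(1) insert.prems(3) in auto)
      then show "s \<in> E" using I'(1) by (simp add: s_def)
      then show "s \<in> carrier R" by (rule ED(2))
    qed
    define f where "f i = (if i = i0 then \<ominus> (s \<otimes> q) else e i)" for i
    have "f i \<in> E" for i unfolding f_def using e(1) ED(7) ED(8) s(1) q(1) by auto
    moreover have "\<exists>i \<in> I. f i \<noteq> \<zero>" using e(2) I' by (auto simp: f_def)
    moreover have "(\<Oplus>i \<in> I. f i \<otimes> a i j') = \<zero>" if j': "j' \<in> Set.insert j J" for j'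
    proof -
      define x y where "x = a i0 j'" and "y = (\<Oplus>i \<in> I'. e i \<otimes> a i j')"
      have xy: "x \<in> carrier R" "y \<in> carrier R" unfolding x_def y_def using ac by (auto intro!: finsum_closed)
      have "(\<Oplus>i \<in> I. f i \<otimes> a i j') = f i0 \<otimes> a i0 j' \<oplus> (\<Oplus>i \<in> I'. f i \<otimes> a i j')"
        unfolding I'(4) using ac s I'(1,3) by (intro finsum_insert) (auto simp: f_def)
      also have "(\<Oplus>i \<in> I'. f i \<otimes> a i j') = y"
        unfolding y_def using ac I'(3) by (intro finsum_cong') (auto simp: f_def)
      finally have *: "(\<Oplus>i \<in> I. f i \<otimes> a i j') = \<ominus> (s \<otimes> q) \<otimes> x \<oplus> y" by (simp add: f_def x_def)
      have "(\<Oplus>i \<in> I'. e i \<otimes> a' i j') \<oplus> s \<otimes> (q \<otimes> x) = y"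
      proof -
        have "s \<otimes> (q \<otimes> x) = (\<Oplus>i \<in> I'. e i \<otimes> a i j \<otimes> (q \<otimes> x))"
          unfolding s_def using ac xy I'(1) by (intro finsum_ldistr) auto
        moreover have "(\<Oplus>i \<in> I'. e i \<otimes> a' i j') \<oplus> (\<Oplus>i \<in> I'. e i \<otimes> a i j \<otimes> (q \<otimes> x))
          = (\<Oplus>i \<in> I'. e i \<otimes> a' i j' \<oplus> e i \<otimes> a i j \<otimes> (q \<otimes> x))"
          using ac xy ED(2)[OF a'] by (intro finsum_addf[symmetric]) auto
        moreover have "\<dots> = y" unfolding y_def
        proof (intro finsum_cong' refl)
          fix i
          show "e i \<otimes> a' i j' \<oplus> e i \<otimes> a i j \<otimes> (q \<otimes> x) = e i \<otimes> a i j'"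
            unfolding a'_def x_def using ac(1)[of i j'] ac(1)[of i j] ac(1)[of i0 j'] ac(2)[of i] ac(3) by algebra
        qed (use ac in auto)
        ultimately show ?thesis by simp
      qed
      moreover have "(\<Oplus>i \<in> I'. e i \<otimes> a' i j') = \<zero>"
      proof (cases "j' = j")
        case True
        have "a' i j = \<zero>" for i
          unfolding a'_def using ac(1)[of i j] ac(1)[of i0 j] ac(3) q by (simp add: m_assoc diff_zero)
        then have "(\<Oplus>i \<in> I'. e i \<otimes> a' i j') = (\<Oplus>i \<in> I'. \<zero>)"
          using ac True by (intro finsum_cong') auto
        then show ?thesis by simp
      qed (use e(3) j' in auto)
      ultimately have "y = s \<otimes> (q \<otimes> x)" using s xy ac by simp
      then show ?thesis unfolding * using s xy ac by (simp add: l_minus m_assoc l_neg)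
    qed
    ultimately show ?thesis by blast
  qed
qed

definition lin_indep :: "'a set \<Rightarrow> (nat \<Rightarrow> 'a) \<Rightarrow> nat \<Rightarrow> bool" where
  "lin_indep E h n \<longleftrightarrow>
     (\<forall>f. (\<forall>i < n. f i \<in> E) \<longrightarrow> psum (\<lambda>i. f i \<otimes> h i) n = \<zero> \<longrightarrow> (\<forall>i < n. f i = \<zero>))"

lemma lin_indepD:
  "lin_indep E h n \<Longrightarrow> (\<And>i. i < n \<Longrightarrow> f i \<in> E) \<Longrightarrow> psum (\<lambda>i. f i \<otimes> h i) n = \<zero> \<Longrightarrow> i < n \<Longrightarrow> f i = \<zero>"
  unfolding lin_indep_def by blast

lemma lin_indep_cong:
  assumes "\<And>i. i < n \<Longrightarrow> h i = h' i" shows "lin_indep E h n \<longleftrightarrow> lin_indep E h' n"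
  unfolding lin_indep_def using assms psum_cong[of n "\<lambda>i. _ i \<otimes> h i" "\<lambda>i. _ i \<otimes> h' i"] by simp

lemma lin_indep_unique:
  assumes E: "divsub E" and h: "lin_indep E h n" "\<And>i. i < n \<Longrightarrow> h i \<in> carrier R"
    and f: "\<And>i. i < n \<Longrightarrow> f i \<in> E" "\<And>i. i < n \<Longrightarrow> g i \<in> E"
    and eq: "psum (\<lambda>i. f i \<otimes> h i) n = psum (\<lambda>i. g i \<otimes> h i) n" and i: "i < n"
  shows "f i = g i"
proof -
  note ED = divsubD[OF E]
  have c: "f j \<in> carrier R" "g j \<in> carrier R" if "j < n" for j using f[OF that] ED(2) by auto
  have "psum (\<lambda>i. (f i \<ominus> g i) \<otimes> h i) n = psum (\<lambda>i. f i \<otimes> h i \<ominus> g i \<otimes> h i) n"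
  proof (rule psum_cong)
    fix i assume "i < n"
    then have "f i \<in> carrier R" "g i \<in> carrier R" "h i \<in> carrier R" using c h(2) by auto
    then show "(f i \<ominus> g i) \<otimes> h i = f i \<otimes> h i \<ominus> g i \<otimes> h i" by algebra
  qed
  also have "\<dots> = psum (\<lambda>i. f i \<otimes> h i) n \<ominus> psum (\<lambda>i. g i \<otimes> h i) n"
    by (rule psum_diff) (simp_all add: c h(2))
  also have "\<dots> = \<zero>" unfolding eq by (rule iffD2[OF diff_zero]) (simp_all add: psum_closed c h(2))
  finally have "f i \<ominus> g i = \<zero>"
    using lin_indepD[OF h(1), of "\<lambda>i. f i \<ominus> g i" i] ED(5) f i by simp
  then show ?thesis using c[OF i] diff_zero by simp
qed

lemma lin_indep_extend:
  assumes E: "divsub E" and h: "lin_indep E h n" "\<And>i. i < n \<Longrightarrow> h i \<in> carrier R" and x: "x \<in> carrier R"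
    and nx: "\<And>f. (\<And>i. i < n \<Longrightarrow> f i \<in> E) \<Longrightarrow> x \<noteq> psum (\<lambda>i. f i \<otimes> h i) n"
  shows "lin_indep E (h(n := x)) (Suc n)"
  unfolding lin_indep_def
proof (rule allI, rule impI, rule impI)
  note ED = divsubD[OF E]
  fix f assume f: "\<forall>i < Suc n. f i \<in> E" and z: "psum (\<lambda>i. f i \<otimes> (h(n := x)) i) (Suc n) = \<zero>"
  have fc: "f i \<in> carrier R" if "i < Suc n" for i using f that ED(2) by blast
  define S where "S = psum (\<lambda>i. f i \<otimes> h i) n"
  have Sc: "S \<in> carrier R" unfolding S_def by (rule psum_closed) (simp add: fc h(2))
  have "psum (\<lambda>i. f i \<otimes> (h(n := x)) i) n = S" unfolding S_def by (rule psum_cong) simp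
  then have S: "S \<oplus> f n \<otimes> x = \<zero>" using z by simp
  have fn: "f n = \<zero>"
  proof (rule ccontr)
    assume nz: "f n \<noteq> \<zero>"
    define q where "q = inv (f n)"
    have q: "q \<in> E" "q \<in> carrier R" unfolding q_def using ED(9) ED(2) f nz by auto
    have "x = q \<otimes> (f n \<otimes> x)" unfolding q_def using inv_cancel(1)[of "f n" x] fc nz x by simp
    also have "f n \<otimes> x = \<ominus> S" using S Sc x fc[of n] minus_equality[of "f n \<otimes> x" S] a_comm by simp
    also have "q \<otimes> (\<ominus> S) = (\<ominus> q) \<otimes> S" using q Sc by (simp add: l_minus r_minus)
    also have "\<dots> = psum (\<lambda>i. (\<ominus> q) \<otimes> (f i \<otimes> h i)) n"
      unfolding S_def by (rule psum_lmult[symmetric]) (simp_all add: fc h(2) q)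
    also have "\<dots> = psum (\<lambda>i. ((\<ominus> q) \<otimes> f i) \<otimes> h i) n"
      by (rule psum_cong) (simp add: fc h(2) q m_assoc)
    finally show False using nx[of "\<lambda>i. (\<ominus> q) \<otimes> f i"] f q(1) ED(7,8) by simp
  qed
  then have "S = \<zero>" using S Sc x by simp
  then have "f i = \<zero>" if "i < n" for i
    using lin_indepD[OF h(1), of f i] that f by (simp add: S_def)
  then show "\<forall>i < Suc n. f i = \<zero>" using fn by (simp add: less_Suc_eq)
qed

text \<open>Rewriting a combination of the \<open>h i\<close> in terms of the \<open>u j\<close>
  leaves \<open>n\<close> equations for \<open>Suc n\<close> coefficients.\<close>

lemma lin_indep_exchange:
  assumes E: "divsub E" and h: "lin_indep E h (Suc n)"
    and u: "\<And>j. j < n \<Longrightarrow> u j \<in> carrier R" and a: "\<And>i j. a i j \<in> E"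
    and eq: "\<And>i. i < Suc n \<Longrightarrow> h i = psum (\<lambda>j. a i j \<otimes> u j) n"
  shows False
proof -
  note ED = divsubD[OF E]
  obtain e where e: "\<And>i. e i \<in> E" "\<exists>i < Suc n. e i \<noteq> \<zero>" "\<And>j. j < n \<Longrightarrow> (\<Oplus>i \<in> {..<Suc n}. e i \<otimes> a i j) = \<zero>"
  proof -
    have "\<exists>e. (\<forall>i. e i \<in> E) \<and> (\<exists>i \<in> {..<Suc n}. e i \<noteq> \<zero>) \<and> (\<forall>j \<in> {..<n}. (\<Oplus>i \<in> {..<Suc n}. e i \<otimes> a i j) = \<zero>)"
      by (rule homogeneous_system[OF E]) (simp_all add: a)
    then show ?thesis using that by blast
  qed
  have c: "e i \<in> carrier R" "a i j \<in> carrier R" for i j using ED(2) e(1) a by auto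
  have e0: "psum (\<lambda>i. e i \<otimes> a i j) (Suc n) = \<zero>" if "j < n" for j
    using e(3)[OF that] psum_finsum[of "Suc n" "\<lambda>i. e i \<otimes> a i j"] c by simp
  have "psum (\<lambda>i. e i \<otimes> h i) (Suc n) = psum (\<lambda>i. psum (\<lambda>j. e i \<otimes> a i j \<otimes> u j) n) (Suc n)"
  proof (rule psum_cong)
    fix i assume "i < Suc n"
    then have "e i \<otimes> h i = psum (\<lambda>j. e i \<otimes> (a i j \<otimes> u j)) n"
      unfolding eq[OF \<open>i < Suc n\<close>] by (intro psum_lmult[symmetric]) (simp_all add: c u)
    also have "\<dots> = psum (\<lambda>j. e i \<otimes> a i j \<otimes> u j) n"
      by (rule psum_cong) (simp add: c u m_assoc)
    finally show "e i \<otimes> h i = psum (\<lambda>j. e i \<otimes> a i j \<otimes> u j) n" .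
  qed
  also have "\<dots> = psum (\<lambda>j. psum (\<lambda>i. e i \<otimes> a i j \<otimes> u j) (Suc n)) n"
    by (rule psum_swap) (simp add: c u)
  also have "\<dots> = psum (\<lambda>j. \<zero>) n"
  proof (rule psum_cong)
    fix j assume j: "j < n"
    have "psum (\<lambda>i. e i \<otimes> a i j \<otimes> u j) (Suc n) = psum (\<lambda>i. e i \<otimes> a i j) (Suc n) \<otimes> u j"
      by (rule psum_rmult) (simp_all add: c u[OF j])
    then show "psum (\<lambda>i. e i \<otimes> a i j \<otimes> u j) (Suc n) = \<zero>" using e0[OF j] u[OF j] by simp
  qed
  finally have "psum (\<lambda>i. e i \<otimes> h i) (Suc n) = \<zero>" by (simp only: psum_zero)
  then have "e i = \<zero>" if "i < Suc n" for i using lin_indepD[OF h, of e i] e(1) that by blast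
  then show False using e(2) by blast
qed

lemma lin_indep_exists:
  assumes E: "divsub E" and K: "divsub K" and nfs: "\<not> finspan E K"
  shows "\<exists>h. (\<forall>i < n. h i \<in> K) \<and> lin_indep E h n"
proof (induction n)
  case 0 show ?case by (simp add: lin_indep_def)
next
  case (Suc n)
  then obtain h where h: "\<forall>i < n. h i \<in> K" "lin_indep E h n" by blast
  have hc: "h i \<in> carrier R" if "i < n" for i using h(1) that divsubD(2)[OF K] by blast
  have set: "set (map h [0..<n]) \<subseteq> K" using h(1) by auto
  then obtain x where x: "x \<in> K" "x \<notin> lspan E (map h [0..<n])"
    using nfs unfolding finspan_def by blast
  have setc: "set (map h [0..<n]) \<subseteq> carrier R" using hc by auto
  have "x \<noteq> psum (\<lambda>i. f i \<otimes> h i) n" if f: "\<And>i. i < n \<Longrightarrow> f i \<in> E" for f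
  proof
    assume "x = psum (\<lambda>i. f i \<otimes> h i) n"
    moreover have "psum (\<lambda>i. f i \<otimes> h i) n \<in> lspan E (map h [0..<n])"
    proof (rule lsub_psum[OF lsub_lspan[OF E setc]])
      fix i assume i: "i < n"
      have "h i \<in> lspan E (map h [0..<n])" by (rule lspan_set[OF E setc]) (simp add: i)
      then show "f i \<otimes> h i \<in> lspan E (map h [0..<n])" by (rule lsubD(6)[OF lsub_lspan[OF E setc] f[OF i]])
    qed
    ultimately show False using x(2) by simp
  qed
  note ne = this
  have "lin_indep E (h(n := x)) (Suc n)"
    by (rule lin_indep_extend[OF E h(2) hc divsubD(2)[OF K x(1)]]) (simp_all add: ne)
  moreover have "\<forall>i < Suc n. (h(n := x)) i \<in> K" using h(1) x(1) by (simp add: less_Suc_eq)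
  ultimately show ?case by blast
qed

end

section \<open>Logarithmic derivatives\<close>

lemma dfn_ex_block:
  assumes "dfn M P"
  shows "dfn M (\<lambda>v. \<exists>w. range w \<subseteq> carrier M \<and> P (\<lambda>i. if m \<le> i \<and> i < m + N then w i else v i))"
proof (induction N)
  case 0
  have "(\<lambda>i. if m \<le> i \<and> i < m + 0 then w i else v i) = v" for v w :: "nat \<Rightarrow> 'a" by (rule ext) auto
  then show ?case by (intro dfn_cong[OF assms]) auto
next
  case (Suc N)
  define Q where "Q v \<longleftrightarrow> (\<exists>w. range w \<subseteq> carrier M \<and> P (\<lambda>i. if m \<le> i \<and> i < m + N then w i else v i))" for v
  have "dfn M (\<lambda>v. \<exists>a \<in> carrier M. Q (v(m + N := a)))"
    using dfn_ex_upd[OF Suc, of "m + N"] by (simp only: Q_def)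
  then show ?case
  proof (rule dfn_cong)
    fix v :: "nat \<Rightarrow> 'a"
    show "(\<exists>a \<in> carrier M. Q (v(m + N := a))) \<longleftrightarrow>
      (\<exists>w. range w \<subseteq> carrier M \<and> P (\<lambda>i. if m \<le> i \<and> i < m + Suc N then w i else v i))"
    proof
      assume "\<exists>a \<in> carrier M. Q (v(m + N := a))"
      then obtain a w where a: "a \<in> carrier M" "range w \<subseteq> carrier M"
        "P (\<lambda>i. if m \<le> i \<and> i < m + N then w i else (v(m + N := a)) i)" unfolding Q_def by blast
      have "(\<lambda>i. if m \<le> i \<and> i < m + N then w i else (v(m + N := a)) i) =
        (\<lambda>i. if m \<le> i \<and> i < m + Suc N then (w(m + N := a)) i else v i)" by (rule ext) auto
      then have "P (\<lambda>i. if m \<le> i \<and> i < m + Suc N then (w(m + N := a)) i else v i)" using a(3) by simp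
      moreover have "range (w(m + N := a)) \<subseteq> carrier M" using a by auto
      ultimately show "\<exists>w. range w \<subseteq> carrier M \<and> P (\<lambda>i. if m \<le> i \<and> i < m + Suc N then w i else v i)" by blast
    next
      assume "\<exists>w. range w \<subseteq> carrier M \<and> P (\<lambda>i. if m \<le> i \<and> i < m + Suc N then w i else v i)"
      then obtain w where w: "range w \<subseteq> carrier M" "P (\<lambda>i. if m \<le> i \<and> i < m + Suc N then w i else v i)" by blast
      have "(\<lambda>i. if m \<le> i \<and> i < m + Suc N then w i else v i) =
        (\<lambda>i. if m \<le> i \<and> i < m + N then w i else (v(m + N := w (m + N))) i)" by (rule ext) auto
      then have "Q (v(m + N := w (m + N)))" unfolding Q_def using w by auto
      then show "\<exists>a \<in> carrier M. Q (v(m + N := a))" using w(1) by blast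
    qed
  qed
qed

text \<open>The sequence is stored in the variables from \<open>m\<close> on. As \<open>Q\<close>
  sees only the variables below \<open>m\<close> and the first \<open>N\<close> entries of the
  sequence, finitely many quantifiers suffice.\<close>

lemma dfn_ex_fun:
  assumes P: "dfn M (\<lambda>v. Q v (\<lambda>i. v (m + i)))"
    and v: "\<And>v v' w. (\<And>i. i < m \<Longrightarrow> v i = v' i) \<Longrightarrow> Q v w = Q v' w"
    and w: "\<And>v w w'. (\<And>i. i < N \<Longrightarrow> w i = w' i) \<Longrightarrow> Q v w = Q v w'"
  shows "dfn M (\<lambda>v. \<exists>w. range w \<subseteq> carrier M \<and> Q v w)"
proof -
  define P where "P v \<longleftrightarrow> Q v (\<lambda>i. v (m + i))" for v
  have "dfn M P" using P by (simp add: P_def[abs_def])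
  then show ?thesis
  proof (rule dfn_cong[OF dfn_ex_block[of M _ m N]])
    fix v :: "nat \<Rightarrow> 'a" assume v': "range v \<subseteq> carrier M"
    have eq: "P (\<lambda>i. if m \<le> i \<and> i < m + N then w i else v i) \<longleftrightarrow> Q v (\<lambda>i. w (m + i))" for w
      unfolding P_def by (subst v[of _ v]) (auto intro!: w)
    show "(\<exists>w. range w \<subseteq> carrier M \<and> P (\<lambda>i. if m \<le> i \<and> i < m + N then w i else v i)) \<longleftrightarrow>
      (\<exists>w. range w \<subseteq> carrier M \<and> Q v w)"
    proof
      assume "\<exists>w. range w \<subseteq> carrier M \<and> P (\<lambda>i. if m \<le> i \<and> i < m + N then w i else v i)"
      then obtain w where "range w \<subseteq> carrier M" "Q v (\<lambda>i. w (m + i))" unfolding eq by blast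
      then show "\<exists>w. range w \<subseteq> carrier M \<and> Q v w" by (intro exI[of _ "\<lambda>i. w (m + i)"]) auto
    next
      assume "\<exists>w. range w \<subseteq> carrier M \<and> Q v w"
      then obtain w where "range w \<subseteq> carrier M" "Q v w" by blast
      then show "\<exists>w. range w \<subseteq> carrier M \<and> P (\<lambda>i. if m \<le> i \<and> i < m + N then w i else v i)"
        unfolding eq by (intro exI[of _ "\<lambda>i. w (i - m)"]) auto
    qed
  qed
qed

lemma dfn_all_fun:
  assumes P: "dfn M (\<lambda>v. Q v (\<lambda>i. v (m + i)))"
    and v: "\<And>v v' w. (\<And>i. i < m \<Longrightarrow> v i = v' i) \<Longrightarrow> Q v w = Q v' w"
    and w: "\<And>v w w'. (\<And>i. i < N \<Longrightarrow> w i = w' i) \<Longrightarrow> Q v w = Q v w'"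
  shows "dfn M (\<lambda>v. \<forall>w. range w \<subseteq> carrier M \<longrightarrow> Q v w)"
proof -
  have "dfn M (\<lambda>v. \<exists>w. range w \<subseteq> carrier M \<and> \<not> Q v w)"
    by (rule dfn_ex_fun[where Q = "\<lambda>v w. \<not> Q v w" and m = m and N = N]) (use dfn_not[OF P] v w in blast)+
  from dfn_not[OF this] show ?thesis by simp
qed

lemma dfn_true: "ring_language_structure M \<Longrightarrow> dfn M (\<lambda>v. True)"
  using dfn_eq[OF tdef_var[where i = 0] tdef_var[where i = 0], where M = M] by simp

lemma dfn_ball:
  assumes "ring_language_structure M" "finite I" "\<And>i. i \<in> I \<Longrightarrow> dfn M (P i)"
  shows "dfn M (\<lambda>v. \<forall>i \<in> I. P i v)"
  using assms(2,3)
proof (induction I)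
  case empty then show ?case using dfn_true[OF assms(1)] by simp
next
  case (insert i I)
  then have "dfn M (\<lambda>v. P i v \<and> (\<forall>i \<in> I. P i v))" by (intro dfn_conj) auto
  then show ?case by simp
qed

lemma dfn_bex:
  assumes "ring_language_structure M" "finite I" "\<And>i. i \<in> I \<Longrightarrow> dfn M (P i)"
  shows "dfn M (\<lambda>v. \<exists>i \<in> I. P i v)"
proof -
  have "dfn M (\<lambda>v. \<forall>i \<in> I. \<not> P i v)" by (intro dfn_ball dfn_not assms)
  from dfn_not[OF this] show ?thesis by simp
qed

lemma (in ring) tdef_psum:
  assumes "ring_language_structure R" "\<And>i. i < n \<Longrightarrow> tdef R (f i)"
  shows "tdef R (\<lambda>v. psum (\<lambda>i. f i v) n)"
  using assms(2) by (induction n) (auto intro!: tdef_const tdef_add assms(1))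

text \<open>Where \<open>[p, b] = 1\<close>, the map \<open>D = [-, b]\<close> is a derivation of the field \<open>C\<close> with constants \<open>F\<close>, \<open>D p = 1\<close>,
  and \<open>Ld\<close> is the group of logarithmic derivatives. That 1 belongs to \<open>Ld\<close> says that \<open>b\<close> is conjugate
  to \<open>b + 1\<close> by an element of \<open>C\<close>.\<close>

locale log_derivations = super_skew +
  fixes K b p
  assumes K: "divsub K" "dset M K" and b: "b \<in> K" and p: "p \<in> K" "p \<otimes> b \<ominus> b \<otimes> p = \<one>"
    and char_zero: "\<And>n. n > 0 \<Longrightarrow> nat_emb n \<noteq> \<zero>"
begin

definition C :: "'a set" where "C = cent K (cent K {p})"

definition D :: "'a \<Rightarrow> 'a" where "D x = x \<otimes> b \<ominus> b \<otimes> x"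

definition F :: "'a set" where "F = cent C {b}"

definition Ld :: "'a set" where "Ld = {s \<in> C. \<exists>g \<in> C. g \<noteq> \<zero> \<and> D g = s \<otimes> g}"

lemma bc: "b \<in> carrier M" and pc: "p \<in> carrier M"
  using divsubD(2)[OF K(1)] b p by blast+

lemma Kc: "K \<subseteq> carrier M"
  using divsubD(2)[OF K(1)] by blast

lemma C: "divsub C" "dset M C" "C \<subseteq> K" "p \<in> C" "C \<subseteq> cent K {p}"
proof -
  have c: "cent K {p} \<subseteq> carrier M" using cent_sub Kc by blast
  show "divsub C" unfolding C_def by (rule divsub_cent[OF K(1) c])
  have "dset M (cent K {p})" using pc by (intro dset_cent K dset_sing) auto
  then show "dset M C" unfolding C_def by (rule dset_cent[OF K(2) _ c])
  show "C \<subseteq> K" unfolding C_def by (rule cent_sub)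
  show "p \<in> C" unfolding C_def using p by (auto simp: cent_def)
  show "C \<subseteq> cent K {p}" unfolding C_def using p by (auto simp: cent_def)
qed

lemmas CD = divsubD[OF C(1)]

lemma C_comm: "x \<in> C \<Longrightarrow> y \<in> C \<Longrightarrow> x \<otimes> y = y \<otimes> x"
  unfolding C_def by (rule cent_cent_comm[OF p(1)])

lemma F: "divsub F" "dset M F" "F \<subseteq> C"
proof -
  show "divsub F" unfolding F_def using bc by (intro divsub_cent C) auto
  show "dset M F" unfolding F_def using bc by (intro dset_cent C dset_sing) auto
  show "F \<subseteq> C" unfolding F_def by (rule cent_sub)
qed

lemma nat_C: "nat_emb n \<in> C"
  using CD by (induction n) auto

lemma nat_F: "nat_emb n \<in> F"
  using nat_C nat_emb_comm[OF bc] by (simp add: F_def cent_def)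

lemma D_closed: "x \<in> carrier M \<Longrightarrow> D x \<in> carrier M"
  unfolding D_def using bc by simp

text \<open>For \<open>y\<close> commuting with \<open>p\<close>, the commutator \<open>z\<close> of
  \<open>y\<close> and \<open>b\<close> commutes with \<open>p\<close> too, by the Jacobi identity
  and because \<open>[p, b] = 1\<close> is central. So \<open>x\<close> commutes with
  \<open>y\<close> and \<open>z\<close>, and the Jacobi identity shows that \<open>D x\<close>
  commutes with \<open>y\<close>.\<close>

lemma D_C: "x \<in> C \<Longrightarrow> D x \<in> C"
proof -
  assume x: "x \<in> C"
  have xc: "x \<in> carrier M" and xK: "x \<in> K" using x CD(2) C(3) by blast+
  have "y \<otimes> D x = D x \<otimes> y" if y: "y \<in> cent K {p}" for y
  proof -
    have yK: "y \<in> K" and yp: "p \<otimes> y = y \<otimes> p" using y by (auto simp: cent_def)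
    have yc: "y \<in> carrier M" using yK Kc by blast
    have e: "x \<otimes> z = z \<otimes> x" if "z \<in> cent K {p}" for z
      using x that by (auto simp: C_def cent_def)
    define z where "z = y \<otimes> b \<ominus> b \<otimes> y"
    have zK: "z \<in> K" unfolding z_def using divsubD(5,8)[OF K(1)] b yK by blast
    have "p \<otimes> z \<ominus> z \<otimes> p = (p \<otimes> y \<ominus> y \<otimes> p) \<otimes> b \<ominus> b \<otimes> (p \<otimes> y \<ominus> y \<otimes> p)
      \<oplus> y \<otimes> (p \<otimes> b \<ominus> b \<otimes> p) \<ominus> (p \<otimes> b \<ominus> b \<otimes> p) \<otimes> y"
      unfolding z_def using pc yc bc by algebra
    also have "\<dots> = \<zero>" unfolding yp p(2) using pc yc bc by (simp add: a_minus_def r_neg)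
    finally have "z \<in> cent K {p}"
      using zK Kc pc diff_zero[of "p \<otimes> z" "z \<otimes> p"] by (auto simp: cent_def)
    then have xz: "x \<otimes> z = z \<otimes> x" by (rule e)
    have xy: "x \<otimes> y = y \<otimes> x" by (rule e[OF y])
    have "y \<otimes> D x \<ominus> D x \<otimes> y = b \<otimes> (x \<otimes> y \<ominus> y \<otimes> x) \<ominus> (x \<otimes> y \<ominus> y \<otimes> x) \<otimes> b \<oplus> (x \<otimes> z \<ominus> z \<otimes> x)"
      unfolding z_def D_def using xc yc bc by algebra
    also have "\<dots> = \<zero>" unfolding xz xy using xc yc bc zK Kc by (auto simp: a_minus_def r_neg)
    finally show ?thesis using diff_zero[of "y \<otimes> D x" "D x \<otimes> y"] D_closed[OF xc] yc by simp
  qed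
  moreover have "D x \<in> K" unfolding D_def using divsubD(5,8)[OF K(1)] b xK by blast
  ultimately show ?thesis unfolding C_def by (auto simp: cent_def)
qed

lemma D_mult:
  assumes "x \<in> carrier M" "y \<in> carrier M"
  shows "D (x \<otimes> y) = D x \<otimes> y \<oplus> x \<otimes> D y"
  unfolding D_def using assms bc by algebra

lemma D_add:
  assumes "x \<in> carrier M" "y \<in> carrier M"
  shows "D (x \<oplus> y) = D x \<oplus> D y"
  unfolding D_def using assms bc by algebra

lemma D_F: "x \<in> F \<longleftrightarrow> x \<in> C \<and> D x = \<zero>"
proof -
  have "D x = \<zero> \<longleftrightarrow> x \<otimes> b = b \<otimes> x" if "x \<in> carrier M"
    unfolding D_def by (rule diff_zero) (use that bc in auto)
  then show ?thesis using CD(2) by (auto simp: F_def cent_def)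
qed

lemma D_psum: "(\<And>i. i < n \<Longrightarrow> f i \<in> carrier M) \<Longrightarrow> D (psum f n) = psum (\<lambda>i. D (f i)) n"
proof (induction n)
  case 0 then show ?case using bc by (simp add: D_def a_minus_def)
qed (simp add: D_add psum_closed)

lemma D_pow: "D (p [^] n) = nat_emb n \<otimes> p [^] (n - 1)"
proof (induction n)
  case 0 then show ?case using bc by (simp add: D_def a_minus_def r_neg)
next
  case (Suc n)
  have "D (p [^] Suc n) = D (p [^] n) \<otimes> p \<oplus> p [^] n \<otimes> D p" using pc by (simp add: D_mult)
  also have "D p = \<one>" using p(2) by (simp add: D_def)
  also have "D (p [^] n) \<otimes> p = nat_emb n \<otimes> p [^] n"
    unfolding Suc using pc by (cases n) (simp_all add: m_assoc)
  finally show ?case using pc by (simp add: l_distr)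
qed

lemma pow_C: "p [^] (n::nat) \<in> C"
  using CD C(4) by (induction n) auto

text \<open>Differentiating a relation lowers the exponents by one and multiplies the coefficients
  by nonzero integers. Induction then removes all coefficients but the one of exponent 0.\<close>

lemma pow_indep: "lin_indep F (\<lambda>i. p [^] i) n"
proof (induction n)
  case 0 show ?case by (simp add: lin_indep_def)
next
  case (Suc n)
  show ?case unfolding lin_indep_def
  proof (rule allI, rule impI, rule impI)
    fix f assume f: "\<forall>i < Suc n. f i \<in> F" and z: "psum (\<lambda>i. f i \<otimes> p [^] i) (Suc n) = \<zero>"
    have fc: "f i \<in> carrier M" if "i < Suc n" for i using f that F(3) CD(2) by blast
    have "\<zero> = D (psum (\<lambda>i. f i \<otimes> p [^] i) (Suc n))"
      unfolding z D_def using bc by (simp add: a_minus_def)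
    also have "\<dots> = psum (\<lambda>i. D (f i \<otimes> p [^] i)) (Suc n)"
      by (rule D_psum) (simp add: fc pc)
    also have "\<dots> = psum (\<lambda>i. f i \<otimes> (nat_emb i \<otimes> p [^] (i - 1))) (Suc n)"
    proof (rule psum_cong)
      fix i assume i: "i < Suc n"
      have "D (f i) = \<zero>" using f i D_F by blast
      then show "D (f i \<otimes> p [^] i) = f i \<otimes> (nat_emb i \<otimes> p [^] (i - 1))"
        using fc[OF i] pc by (simp add: D_mult D_pow)
    qed
    also have "\<dots> = f 0 \<otimes> (nat_emb 0 \<otimes> p [^] (0 - 1 :: nat)) \<oplus> psum (\<lambda>i. f (Suc i) \<otimes> (nat_emb (Suc i) \<otimes> p [^] (Suc i - 1))) n"
      by (rule psum_shift) (simp add: fc pc)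
    also have "\<dots> = psum (\<lambda>i. f (Suc i) \<otimes> nat_emb (Suc i) \<otimes> p [^] i) n"
    proof -
      have "psum (\<lambda>i. f (Suc i) \<otimes> (nat_emb (Suc i) \<otimes> p [^] (Suc i - 1))) n = psum (\<lambda>i. f (Suc i) \<otimes> nat_emb (Suc i) \<otimes> p [^] i) n"
        by (rule psum_cong) (simp add: fc pc m_assoc)
      moreover have "psum (\<lambda>i. f (Suc i) \<otimes> nat_emb (Suc i) \<otimes> p [^] i) n \<in> carrier M"
        by (rule psum_closed) (simp add: fc pc)
      ultimately show ?thesis using fc[of 0] by simp
    qed
    finally have s: "psum (\<lambda>i. f (Suc i) \<otimes> nat_emb (Suc i) \<otimes> p [^] i) n = \<zero>" by simp
    have "f (Suc i) \<otimes> nat_emb (Suc i) = \<zero>" if "i < n" for i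
      using lin_indepD[OF Suc _ s that] f nat_F divsubD(8)[OF F(1)] by blast
    then have fs: "f (Suc i) = \<zero>" if "i < n" for i
      using that char_zero[of "Suc i"] nz_mult[of "f (Suc i)" "nat_emb (Suc i)"] fc[of "Suc i"] by fastforce
    have "psum (\<lambda>i. f (Suc i) \<otimes> p [^] Suc i) n = psum (\<lambda>i. \<zero>) n"
      by (rule psum_cong) (simp add: fs pc del: nat_pow_Suc)
    moreover have "psum (\<lambda>i. f i \<otimes> p [^] i) (Suc n) = f 0 \<otimes> p [^] (0::nat) \<oplus> psum (\<lambda>i. f (Suc i) \<otimes> p [^] Suc i) n"
      by (rule psum_shift) (simp add: fc pc)
    ultimately have "f 0 = \<zero>" using z fc[of 0] by (simp add: psum_zero)
    then show "\<forall>i < Suc n. f i = \<zero>" using fs by (metis less_Suc_eq_0_disj)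
  qed
qed

text \<open>The \<open>n + 1\<close> elements \<open>g \<otimes> p [^] \<nu>\<close> are independent
  over \<open>F\<close>, hence cannot all be combinations of \<open>n\<close> elements. The bound on
  the exponent later keeps the number of cases finite.\<close>

lemma indep_twist:
  assumes h: "lin_indep F h n" "\<And>i. i < n \<Longrightarrow> h i \<in> C" and g: "g \<in> C" "g \<noteq> \<zero>"
  shows "\<exists>\<nu> \<le> n. lin_indep F (h(n := g \<otimes> p [^] \<nu>)) (Suc n)"
proof (rule ccontr)
  assume no: "\<not> ?thesis"
  have gc: "g \<in> carrier M" and hc: "\<And>i. i < n \<Longrightarrow> h i \<in> carrier M" using g h(2) CD(2) by auto
  have gp: "g \<otimes> p [^] \<nu> \<in> carrier M" for \<nu> :: nat using gc pc by simp
  have "\<exists>f. (\<forall>i. f i \<in> F) \<and> g \<otimes> p [^] \<nu> = psum (\<lambda>i. f i \<otimes> h i) n" if "\<nu> < Suc n" for \<nu> :: nat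
  proof (rule ccontr)
    assume none: "\<not> ?thesis"
    have ne: "g \<otimes> p [^] \<nu> \<noteq> psum (\<lambda>i. f i \<otimes> h i) n" if f: "\<And>i. i < n \<Longrightarrow> f i \<in> F" for f
    proof
      assume eq: "g \<otimes> p [^] \<nu> = psum (\<lambda>i. f i \<otimes> h i) n"
      define f' where "f' i = (if i < n then f i else \<zero>)" for i
      have "psum (\<lambda>i. f i \<otimes> h i) n = psum (\<lambda>i. f' i \<otimes> h i) n" by (rule psum_cong) (simp add: f'_def)
      moreover have "\<forall>i. f' i \<in> F" using f divsubD(3)[OF F(1)] by (simp add: f'_def)
      ultimately show False using none eq by auto
    qed
    have "lin_indep F (h(n := g \<otimes> p [^] \<nu>)) (Suc n)"
      by (rule lin_indep_extend[OF F(1) h(1) hc gp]) (simp_all add: ne)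
    then show False using no that by (simp add: less_Suc_eq_le)
  qed
  then have "\<exists>f. (\<forall>i. f i \<in> F) \<and> (\<nu> < Suc n \<longrightarrow> g \<otimes> p [^] \<nu> = psum (\<lambda>i. f i \<otimes> h i) n)" for \<nu> :: nat
    using divsubD(3)[OF F(1)] by (cases "\<nu> < Suc n") (auto intro: exI[of _ "\<lambda>_. \<zero>"])
  then obtain a where a: "\<And>\<nu> i. a \<nu> i \<in> F" "\<And>\<nu>. \<nu> < Suc n \<Longrightarrow> g \<otimes> p [^] \<nu> = psum (\<lambda>i. a \<nu> i \<otimes> h i) n"
    by metis
  have "lin_indep F (\<lambda>\<nu>. g \<otimes> p [^] \<nu>) (Suc n)"
    unfolding lin_indep_def
  proof (rule allI, rule impI, rule impI)
    fix f assume f: "\<forall>i < Suc n. f i \<in> F" and z: "psum (\<lambda>i. f i \<otimes> (g \<otimes> p [^] i)) (Suc n) = \<zero>"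
    have fc: "f i \<in> carrier M" if "i < Suc n" for i using f that F(3) CD(2) by blast
    have "psum (\<lambda>i. f i \<otimes> (g \<otimes> p [^] i)) (Suc n) = psum (\<lambda>i. g \<otimes> (f i \<otimes> p [^] i)) (Suc n)"
    proof (rule psum_cong)
      fix i assume i: "i < Suc n"
      have "f i \<otimes> g = g \<otimes> f i" using f i F(3) g C_comm by blast
      then show "f i \<otimes> (g \<otimes> p [^] i) = g \<otimes> (f i \<otimes> p [^] i)"
        using fc[OF i] gc pc by (simp add: m_assoc[symmetric])
    qed
    also have "\<dots> = g \<otimes> psum (\<lambda>i. f i \<otimes> p [^] i) (Suc n)"
      by (rule psum_lmult) (simp_all add: fc gc pc)
    finally have "psum (\<lambda>i. f i \<otimes> p [^] i) (Suc n) = \<zero>"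
      using z g(2) nz_mult[OF gc, of "psum (\<lambda>i. f i \<otimes> p [^] i) (Suc n)"]
        psum_closed[of "Suc n" "\<lambda>i. f i \<otimes> p [^] i"] fc pc by simp
    then show "\<forall>i < Suc n. f i = \<zero>" using lin_indepD[OF pow_indep, of "Suc n" f] f by blast
  qed
  then show False by (rule lin_indep_exchange[OF F(1) _ hc a])
qed

lemma Ld_zero: "\<zero> \<in> Ld"
proof -
  have "D \<one> = \<zero>" unfolding D_def using bc by (simp add: a_minus_def r_neg)
  then show ?thesis unfolding Ld_def using CD(3,4) one_nz by (auto intro!: bexI[of _ \<one>])
qed

text \<open>The difference is the logarithmic derivative of a quotient, as \<open>C\<close> is
  commutative.\<close>

lemma Ld_diff:
  assumes "s \<in> Ld" "t \<in> Ld" shows "s \<ominus> t \<in> Ld"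
proof -
  obtain g h where g: "s \<in> C" "g \<in> C" "g \<noteq> \<zero>" "D g = s \<otimes> g" and h: "t \<in> C" "h \<in> C" "h \<noteq> \<zero>" "D h = t \<otimes> h"
    using assms unfolding Ld_def by blast
  have c: "s \<in> carrier M" "g \<in> carrier M" "t \<in> carrier M" "h \<in> carrier M" using g h CD(2) by auto
  define k where "k = inv h"
  have k: "k \<in> C" "k \<in> carrier M" "k \<noteq> \<zero>" "k \<otimes> h = \<one>" "h \<otimes> k = \<one>"
    unfolding k_def using CD(9)[OF h(2,3)] inv_props[OF c(4) h(3)] by auto
  have "D k = \<ominus> (t \<otimes> k)"
  proof -
    have "\<zero> = D (k \<otimes> h)" unfolding k(4) D_def using bc by (simp add: a_minus_def r_neg)
    also have "\<dots> = D k \<otimes> h \<oplus> k \<otimes> (t \<otimes> h)" unfolding D_mult[OF k(2) c(4)] h(4) ..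
    also have "\<dots> = (D k \<oplus> k \<otimes> t) \<otimes> h" using D_closed[OF k(2)] k c by (simp add: l_distr m_assoc)
    finally have "(D k \<oplus> k \<otimes> t) \<otimes> h = \<zero>" ..
    then have "D k \<oplus> k \<otimes> t = \<zero>" using nz_mult[OF _ c(4), of "D k \<oplus> k \<otimes> t"] h(3) D_closed[OF k(2)] k(2) c(3) by simp
    then have "D k = \<ominus> (k \<otimes> t)" using D_closed[OF k(2)] k(2) c(3) minus_equality by simp
    then show ?thesis using C_comm[OF k(1) h(1)] by simp
  qed
  then have "D (g \<otimes> k) = (s \<otimes> g) \<otimes> k \<oplus> g \<otimes> (\<ominus> (t \<otimes> k))" using D_mult c k g(4) by simp
  also have "\<dots> = (s \<otimes> g) \<otimes> k \<ominus> (g \<otimes> t) \<otimes> k" using c k by (simp add: a_minus_def r_minus m_assoc)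
  also have "\<dots> = (s \<ominus> t) \<otimes> (g \<otimes> k)" unfolding C_comm[OF g(2) h(1)] using c k by algebra
  finally have "D (g \<otimes> k) = (s \<ominus> t) \<otimes> (g \<otimes> k)" .
  moreover have "g \<otimes> k \<in> C" "g \<otimes> k \<noteq> \<zero>" using CD(8)[OF g(2) k(1)] nz_mult c k g by auto
  ultimately show ?thesis unfolding Ld_def using CD(5)[OF g(1) h(1)] by blast
qed

lemma Ld_addsub: "addsub M Ld"
  unfolding addsub_def using Ld_zero Ld_diff CD(2) by (auto simp: Ld_def)

lemma dset_Ld: "dset M Ld"
proof -
  have "dfn M (\<lambda>v. v 1 \<in> C \<and> v 1 \<noteq> \<zero> \<and> v 1 \<otimes> b \<ominus> b \<otimes> v 1 = v 0 \<otimes> v 1)"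
    by (intro dfn_conj dset_mem[OF L C(2)] dfn_not dfn_eq tdef_mult tdef_minus tdef_var tdef_const L bc zero_closed)
  then have "dfn M (\<lambda>v. \<exists>g \<in> carrier M. g \<in> C \<and> g \<noteq> \<zero> \<and> g \<otimes> b \<ominus> b \<otimes> g = v 0 \<otimes> g)"
    by (rule dfn_ex) simp
  then have "dfn M (\<lambda>v. v 0 \<in> C \<and> (\<exists>g \<in> carrier M. g \<in> C \<and> g \<noteq> \<zero> \<and> g \<otimes> b \<ominus> b \<otimes> g = v 0 \<otimes> g))"
    by (intro dfn_conj dset_mem[OF L C(2)] tdef_var L)
  then show ?thesis unfolding dset_def
    by (rule dfn_cong) (use CD(2) in \<open>auto simp: Ld_def D_def\<close>)
qed

end

section \<open>Smallness of the group of logarithmic derivatives\<close>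

context log_derivations
begin

text \<open>The inverse of \<open>n! h\<close> is a suitable \<open>c\<close> for the multiples up to \<open>n\<close>; saturation gives one for
  all of them.\<close>

lemma no_small_multiple:
  assumes one: "\<one> \<notin> Ld" and h: "h \<in> C" "h \<noteq> \<zero>"
  obtains c where "c \<in> C" "\<And>n. n > 0 \<Longrightarrow> nat_emb n \<otimes> (c \<otimes> h) \<notin> Ld"
proof -
  have hc: "h \<in> carrier M" using h CD(2) by blast
  define S where "S n = {c \<in> C. nat_emb (Suc n) \<otimes> (c \<otimes> h) \<notin> Ld}" for n
  have "dset M (S n)" for n
  proof -
    have "dfn M (\<lambda>v. v 0 \<in> C \<and> nat_emb (Suc n) \<otimes> (v 0 \<otimes> h) \<notin> Ld)"
      by (intro dfn_conj dset_mem[OF L C(2)] dfn_not dset_mem[OF L dset_Ld] tdef_mult tdef_var tdef_const L hc nat_emb_closed)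
    then show ?thesis by (simp add: dset_def S_def)
  qed
  moreover have "\<exists>a \<in> carrier M. \<forall>i < n. a \<in> S i" for n
  proof -
    define q where "q = nat_emb (fact n) \<otimes> h"
    have q: "q \<in> C" "q \<in> carrier M" "q \<noteq> \<zero>"
      unfolding q_def using CD(8)[OF nat_C h(1)] hc nz_mult[OF _ hc] char_zero[of "fact n"] h(2) by auto
    define c where "c = inv q"
    have c: "c \<in> C" "c \<in> carrier M" "c \<otimes> q = \<one>" unfolding c_def using CD(9) inv_props[OF q(2,3)] q by auto
    have "c \<in> S i" if "i < n" for i
    proof -
      have "Suc i dvd fact n" using that by (intro dvd_fact) auto
      then obtain m where m: "fact n = m * Suc i" by (metis dvd_def mult.commute)
      define x where "x = nat_emb (Suc i) \<otimes> (c \<otimes> h)"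
      have xc: "x \<in> carrier M" unfolding x_def using c hc by (simp del: nat_emb_simps)
      have "nat_emb j \<otimes> x \<in> Ld" if "x \<in> Ld" for j
      proof (induction j)
        case 0 then show ?case using Ld_zero xc by simp
      next
        case (Suc j)
        have "nat_emb (Suc j) \<otimes> x = nat_emb j \<otimes> x \<oplus> x" using xc by (simp add: l_distr)
        then show ?case using addsubD(5)[OF Ld_addsub Suc that] by simp
      qed
      moreover have "nat_emb m \<otimes> x = \<one>"
      proof -
        have "nat_emb m \<otimes> x = nat_emb (fact n) \<otimes> (c \<otimes> h)"
          unfolding x_def m nat_emb_mult using c hc by (simp add: m_assoc del: nat_emb_simps)
        also have "\<dots> = c \<otimes> q" unfolding q_def using nat_emb_comm[OF c(2)] c hc by (simp add: m_assoc[symmetric])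
        finally show ?thesis using c(3) by simp
      qed
      ultimately have "x \<notin> Ld" using one by metis
      then show ?thesis using c(1) by (simp add: S_def x_def del: nat_emb_simps)
    qed
    then show ?thesis using c(2) by blast
  qed
  ultimately obtain c where c: "\<And>n. c \<in> S n"
    using saturated_seq[OF _ L, of \<kappa> S] super by (auto simp: super_def)
  have "nat_emb n \<otimes> (c \<otimes> h) \<notin> Ld" if n: "n > 0" for n
    using c[of "n - 1"] n by (simp add: S_def del: nat_emb_simps)
  moreover have "c \<in> C" using c[of 0] by (simp add: S_def)
  ultimately show ?thesis using that by blast
qed

text \<open>Otherwise each finite list leaves some nonzero \<open>h\<close>. If no positive multiple
  of \<open>c \<otimes> h\<close> lies in \<open>Ld\<close>, then adding \<open>c\<close> to the
  list puts the multiples of \<open>h\<close> into distinct cosets modulo the next intersection, and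
  the intersections form a chain with infinite indices.\<close>

lemma finitely_many_translates:
  assumes one: "\<one> \<notin> Ld"
  obtains cs where "set cs \<subseteq> C" "\<And>x. x \<in> C \<Longrightarrow> (\<And>c. c \<in> set cs \<Longrightarrow> c \<otimes> x \<in> Ld) \<Longrightarrow> x = \<zero>"
proof (rule ccontr)
  assume no: "\<not> thesis"
  note outer = that
  define P where "P cs = {x \<in> C. \<forall>c \<in> set cs. c \<otimes> x \<in> Ld}" for cs
  have bad: "\<exists>h \<in> P cs. h \<noteq> \<zero>" if "set cs \<subseteq> C" for cs
    using no outer[OF that] unfolding P_def by blast
  have P: "addsub M (P cs)" "dset M (P cs)" if cs: "set cs \<subseteq> C" for cs
  proof -
    have cc: "c \<in> carrier M" if "c \<in> set cs" for c using cs that CD(2) by blast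
    have "c \<otimes> (x \<ominus> y) = c \<otimes> x \<ominus> c \<otimes> y" if "c \<in> set cs" "x \<in> C" "y \<in> C" for c x y
    proof -
      have "c \<in> carrier M" "x \<in> carrier M" "y \<in> carrier M" using that cc CD(2) by auto
      then show ?thesis by algebra
    qed
    then show "addsub M (P cs)"
      unfolding addsub_def P_def using Ld_zero Ld_diff CD(2,3,5) cc by auto
    have "dfn M (\<lambda>v. v 0 \<in> C \<and> (\<forall>c \<in> set cs. c \<otimes> v 0 \<in> Ld))"
      by (intro dfn_conj dset_mem[OF L C(2)] dfn_ball[OF L] dset_mem[OF L dset_Ld] tdef_mult tdef_var tdef_const L cc) auto
    then show "dset M (P cs)" by (simp add: dset_def P_def)
  qed
  have step: "\<exists>c \<in> C. \<exists>T \<subseteq> P cs. infinite T \<and> (\<forall>x \<in> T. \<forall>y \<in> T. x \<noteq> y \<longrightarrow> x \<ominus> y \<notin> P (c # cs))"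
    if cs: "set cs \<subseteq> C" for cs
  proof -
    obtain h where h: "h \<in> P cs" "h \<noteq> \<zero>" using bad[OF cs] by blast
    have hC: "h \<in> C" using h by (simp add: P_def)
    have hc: "h \<in> carrier M" using hC CD(2) by blast
    obtain c where c: "c \<in> C" "\<And>n. n > 0 \<Longrightarrow> nat_emb n \<otimes> (c \<otimes> h) \<notin> Ld"
      using no_small_multiple[OF one hC h(2)] by blast
    have cc: "c \<in> carrier M" using c CD(2) by blast
    have ccs: "set (c # cs) \<subseteq> C" using c cs by simp
    define t where "t n = nat_emb n \<otimes> h" for n
    have tc: "t n \<in> carrier M" for n unfolding t_def using hc by simp
    have tP: "t n \<in> P cs" for n
    proof (induction n)
      case 0 then show ?case using addsubD(2)[OF P(1)[OF cs]] hc by (simp add: t_def)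
    next
      case (Suc n)
      have "t (Suc n) = t n \<oplus> h" using hc by (simp add: t_def l_distr)
      then show ?case using addsubD(5)[OF P(1)[OF cs] Suc h(1)] by simp
    qed
    have lt: "t (m + d) \<ominus> t m \<notin> P (c # cs)" if "d > 0" for m d
    proof
      assume "t (m + d) \<ominus> t m \<in> P (c # cs)"
      moreover have "t (m + d) \<ominus> t m = nat_emb d \<otimes> h"
      proof -
        have "nat_emb m \<in> carrier M" "nat_emb d \<in> carrier M" by auto
        then show ?thesis unfolding t_def nat_emb_add using hc by algebra
      qed
      ultimately have "c \<otimes> (nat_emb d \<otimes> h) \<in> Ld" by (simp add: P_def)
      then show False using c(2)[OF that] nat_emb_comm[OF cc] cc hc by (simp add: m_assoc[symmetric])
    qed
    have ne: "t m \<ominus> t n \<notin> P (c # cs)" if "m \<noteq> n" for m n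
    proof (cases "n < m")
      case True then show ?thesis using lt[of "m - n" n] by simp
    next
      case False
      then have "t n \<ominus> t m \<notin> P (c # cs)" using lt[of "n - m" m] that by simp
      moreover have "t n \<ominus> t m = \<ominus> (t m \<ominus> t n)" using tc[of m] tc[of n] by algebra
      ultimately show ?thesis using addsubD(4)[OF P(1)[OF ccs]] by metis
    qed
    have "t m \<noteq> t n" if "m \<noteq> n" for m n
      using ne[OF that] addsubD(2)[OF P(1)[OF ccs]] tc diff_zero[of "t m" "t n"] by metis
    then have "infinite (range t)" by (intro range_inj_infinite injI) blast
    moreover have "x \<ominus> y \<notin> P (c # cs)" if "x \<in> range t" "y \<in> range t" "x \<noteq> y" for x y
    proof -
      obtain m n where "x = t m" "y = t n" using \<open>x \<in> range t\<close> \<open>y \<in> range t\<close> by blast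
      then show ?thesis using ne[of m n] \<open>x \<noteq> y\<close> by blast
    qed
    moreover have "range t \<subseteq> P cs" using tP by blast
    ultimately show ?thesis using c(1) by (intro bexI[of _ c] exI[of _ "range t"] conjI ballI impI)
  qed
  define Q where "Q cs c \<longleftrightarrow> c \<in> C \<and> (\<exists>T \<subseteq> P cs. infinite T \<and> (\<forall>x \<in> T. \<forall>y \<in> T. x \<noteq> y \<longrightarrow> x \<ominus> y \<notin> P (c # cs)))" for cs c
  define nxt where "nxt cs = (SOME c. Q cs c)" for cs
  have nxt: "Q cs (nxt cs)" if "set cs \<subseteq> C" for cs
    unfolding nxt_def by (rule someI_ex) (use step[OF that] in \<open>auto simp: Q_def\<close>)
  define X where "X n = ((\<lambda>cs. nxt cs # cs) ^^ n) []" for n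
  have XS: "X (Suc n) = nxt (X n) # X n" for n by (simp add: X_def)
  have XC: "set (X n) \<subseteq> C" for n
  proof (induction n)
    case 0 show ?case by (simp add: X_def)
  next
    case (Suc n) then show ?case using nxt[OF Suc] by (simp add: XS Q_def)
  qed
  show False
  proof (rule no_subgroup_chain[OF super R, of "\<lambda>n. P (X n)"])
    show "P (X (Suc n)) \<subseteq> P (X n)" for n by (auto simp: XS P_def)
    show "\<exists>T \<subseteq> P (X n). infinite T \<and> (\<forall>x \<in> T. \<forall>y \<in> T. x \<noteq> y \<longrightarrow> x \<ominus> y \<notin> P (X (Suc n)))" for n
      using nxt[OF XC[of n]] unfolding XS Q_def by blast
  qed (use P XC in auto)
qed

end

section \<open>The absorbing correspondence\<close>

locale log_absorption = log_derivations +
  fixes cs X N k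
  assumes cs: "set cs \<subseteq> C" "\<And>x. x \<in> C \<Longrightarrow> (\<And>c. c \<in> set cs \<Longrightarrow> c \<otimes> x \<in> Ld) \<Longrightarrow> x = \<zero>"
    and k: "k = length cs" and N: "N = 2 * k"
    and X: "\<And>i. i < N \<Longrightarrow> X i \<in> K" "lin_indep C X N"
begin

lemma Xc: "i < N \<Longrightarrow> X i \<in> carrier M"
  using X(1) Kc by blast

lemma k_pos: "k > 0"
proof (rule ccontr)
  assume "\<not> k > 0"
  then have "\<one> = \<zero>" by (intro cs(2)) (simp_all add: k CD)
  then show False using one_nz by simp
qed

text \<open>Indices are read modulo \<open>k\<close>, so that each of the two blocks of
  \<open>k\<close> coordinates runs through all of \<open>cs\<close>: one block detects the last
  coordinate of \<open>y\<close>, the other detects \<open>e\<close>.\<close>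

definition c :: "nat \<Rightarrow> 'a" where "c i = cs ! (i mod k)"

lemma c_C: "c i \<in> C"
proof -
  have "i mod k < length cs" using k_pos k by simp
  then show ?thesis unfolding c_def using cs(1) nth_mem by blast
qed

text \<open>The correspondence sends \<open>(y, e)\<close> with \<open>y = \<Sum> y\<^sub>i X\<^sub>i\<close> to \<open>x\<close> with the \<open>N = 2k\<close> coordinates
  \<open>c\<^sub>i z\<^sub>i + s\<^sub>i\<close>, where \<open>z\<^sub>i\<close> is the last coordinate of \<open>y\<close> for \<open>i < k\<close> and \<open>e\<close> for the other \<open>i\<close>, and \<open>s\<^sub>i\<close>
  is the logarithmic derivative of \<open>g\<^sub>i\<close>. By the choice of \<open>cs\<close>, \<open>x\<close> determines \<open>y\<^sub>N\<^sub>-\<^sub>1\<close>, \<open>e\<close> and \<open>s\<close>, hence \<open>g\<close> up to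
  constant factors. For \<open>i < N - 1\<close>, \<open>g\<^sub>i\<close> is \<open>y\<^sub>i\<close> or \<open>y\<^sub>i + 1\<close>, and the last one is the sum
  of the \<open>h\<^sub>i\<close>, which are independent over the constants and multiples of 1 and of
  the other \<open>g\<^sub>i\<close>; this forces all the constant factors to be 1. Only finitely many exponents \<open>\<nu>\<close>
  and shifts \<open>\<tau>\<close> are needed.\<close>

definition h :: "(nat \<Rightarrow> 'a) \<Rightarrow> (nat \<Rightarrow> nat) \<Rightarrow> (nat \<Rightarrow> 'a) \<Rightarrow> nat \<Rightarrow> 'a" where
  "h \<tau> \<nu> w i = (if i = 0 then \<one> else (w (i - 1) \<oplus> \<tau> (i - 1)) \<otimes> p [^] (\<nu> (i - 1)))"

definition g :: "(nat \<Rightarrow> 'a) \<Rightarrow> (nat \<Rightarrow> nat) \<Rightarrow> (nat \<Rightarrow> 'a) \<Rightarrow> nat \<Rightarrow> 'a" where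
  "g \<tau> \<nu> w i = (if i = N - 1 then psum (h \<tau> \<nu> w) N else w i \<oplus> \<tau> i)"

text \<open>The witness \<open>w\<close> packs two sequences into one: the coordinates of
  \<open>y\<close> at the positions below \<open>N\<close>, and the logarithmic derivatives at
  \<open>N + i\<close>.\<close>

definition coeff :: "'a \<Rightarrow> (nat \<Rightarrow> 'a) \<Rightarrow> nat \<Rightarrow> 'a" where
  "coeff e w i = c i \<otimes> (if i < k then w (N - 1) else e) \<oplus> w (N + i)"

definition rel :: "(nat \<Rightarrow> 'a) \<Rightarrow> (nat \<Rightarrow> nat) \<Rightarrow> 'a \<Rightarrow> 'a \<Rightarrow> 'a \<Rightarrow> (nat \<Rightarrow> 'a) \<Rightarrow> bool" where
  "rel \<tau> \<nu> x y e w \<longleftrightarrow> (\<forall>i \<in> {..<2 * N}. w i \<in> C) \<and> y = psum (\<lambda>i. w i \<otimes> X i) N \<and>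
     x = psum (\<lambda>i. coeff e w i \<otimes> X i) N \<and>
     (\<forall>i \<in> {..<N}. g \<tau> \<nu> w i \<noteq> \<zero> \<and> D (g \<tau> \<nu> w i) = w (N + i) \<otimes> g \<tau> \<nu> w i) \<and>
     lin_indep F (h \<tau> \<nu> w) N"

definition A :: "'a set" where
  "A = {psum (\<lambda>i. f i \<otimes> X i) N | f. \<forall>i. f i \<in> C}"

lemma A_I:
  assumes "\<And>i. i < N \<Longrightarrow> f i \<in> C" shows "psum (\<lambda>i. f i \<otimes> X i) N \<in> A"
proof -
  define f' where "f' i = (if i < N then f i else \<zero>)" for i
  have "psum (\<lambda>i. f i \<otimes> X i) N = psum (\<lambda>i. f' i \<otimes> X i) N" by (rule psum_cong) (simp add: f'_def)
  moreover have "f' i \<in> C" for i using assms CD(3) by (simp add: f'_def)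
  ultimately show ?thesis unfolding A_def by blast
qed

lemma h_C:
  assumes "\<And>i. i < N \<Longrightarrow> w i \<in> C" "\<And>i. i < N \<Longrightarrow> \<tau> i \<in> C" "i < N"
  shows "h \<tau> \<nu> w i \<in> C"
proof (cases i)
  case (Suc j)
  then have "j < N" using assms(3) by simp
  then show ?thesis unfolding h_def Suc using CD(8)[OF CD(6)[OF assms(1,2)] pow_C] by simp
qed (simp add: h_def CD)

lemma g_C:
  assumes "\<And>i. i < N \<Longrightarrow> w i \<in> C" "\<And>i. i < N \<Longrightarrow> \<tau> i \<in> C" "i < N"
  shows "g \<tau> \<nu> w i \<in> C"
proof -
  have "psum (h \<tau> \<nu> w) n \<in> C" if "n \<le> N" for n
    using that
  proof (induction n)
    case (Suc n)
    have "h \<tau> \<nu> w n \<in> C" using Suc.prems by (intro h_C assms) auto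
    then show ?case using Suc CD(6) by simp
  qed (simp add: CD)
  then show ?thesis unfolding g_def using CD(6) assms by simp
qed

text \<open>The derivative of the quotient vanishes, so the quotient is a constant.\<close>

lemma equal_log_derivative:
  assumes "x \<in> C" "y \<in> C" "x \<noteq> \<zero>" "D x = s \<otimes> x" "D y = s \<otimes> y" "s \<in> C"
  shows "\<exists>l \<in> F. y = l \<otimes> x"
proof -
  have c: "x \<in> carrier M" "y \<in> carrier M" "s \<in> carrier M" using assms CD(2) by auto
  define l where "l = y \<otimes> inv x"
  have l: "l \<in> C" "l \<in> carrier M" unfolding l_def using CD(8)[OF assms(2) CD(9)[OF assms(1,3)]] CD(2) by auto
  have y: "y = l \<otimes> x" unfolding l_def using inv_cancel(4)[OF c(1) assms(3) c(2)] by simp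
  have "s \<otimes> y = D l \<otimes> x \<oplus> l \<otimes> (s \<otimes> x)" using D_mult[OF l(2) c(1)] assms(4,5) y by simp
  also have "l \<otimes> (s \<otimes> x) = s \<otimes> y"
    unfolding y using C_comm[OF l(1) assms(6)] l c by (simp add: m_assoc[symmetric])
  finally have "D l \<otimes> x = \<zero>" using c l D_closed[OF l(2)] by (simp add: y)
  then have "D l = \<zero>" using nz_mult[OF D_closed[OF l(2)] c(1)] assms(3) by simp
  then show ?thesis using y l D_F by blast
qed

lemma rel_unique:
  assumes \<tau>: "\<And>i. i < N \<Longrightarrow> \<tau> i \<in> C" and e: "e \<in> C" "e' \<in> C"
    and r: "rel \<tau> \<nu> x y e w" and r': "rel \<tau> \<nu> x y' e' w'"
  shows "y = y' \<and> e = e'"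
proof -
  have N0: "N - 1 < N" "k < N" using N k_pos by auto
  have w: "w i \<in> C" "w' i \<in> C" if "i < 2 * N" for i
    using r r' that unfolding rel_def by auto
  have w1: "w i \<in> C" "w' i \<in> C" if "i < N" for i using w[of i] that by auto
  have wc: "w i \<in> carrier M" "w' i \<in> carrier M" if "i < 2 * N" for i using w[OF that] CD(2) by auto
  have gC: "g \<tau> \<nu> w i \<in> C" "g \<tau> \<nu> w' i \<in> C" if "i < N" for i
    using g_C[of w \<tau> i \<nu>] g_C[of w' \<tau> i \<nu>] w1 \<tau> that by auto
  have co: "coeff e w i \<in> C" "coeff e' w' i \<in> C" if "i < N" for i
    unfolding coeff_def by (intro CD(6,8) c_C; use that e w N0 in simp)+
  have eq: "coeff e w i = coeff e' w' i" if "i < N" for i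
    by (rule lin_indep_unique[OF C(1) X(2) Xc co _ that]) (use r r' in \<open>auto simp: rel_def\<close>)
  have dl: "w (N + i) \<in> Ld" "w' (N + i) \<in> Ld" if "i < N" for i
    using r r' that w[of "N + i"] gC[OF that] unfolding rel_def Ld_def by auto
  define z z' where "z i = (if i < k then w (N - 1) else e)" and "z' i = (if i < k then w' (N - 1) else e')" for i
  have z: "z i \<in> C" "z' i \<in> C" for i using w[of "N - 1"] N0 e by (auto simp: z_def z'_def)
  have dz: "c i \<otimes> (z i \<ominus> z' i) = w' (N + i) \<ominus> w (N + i)" if "i < N" for i
  proof -
    have cc: "c i \<in> carrier M" "z i \<in> carrier M" "z' i \<in> carrier M" "w (N + i) \<in> carrier M" "w' (N + i) \<in> carrier M"
      using c_C z wc[of "N + i"] that CD(2) by auto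
    have "c i \<otimes> (z i \<ominus> z' i) = (c i \<otimes> z i \<oplus> w (N + i)) \<ominus> (c i \<otimes> z' i \<oplus> w' (N + i)) \<oplus> (w' (N + i) \<ominus> w (N + i))"
      using cc by algebra
    also have "c i \<otimes> z i \<oplus> w (N + i) = c i \<otimes> z' i \<oplus> w' (N + i)"
      using eq[OF that] by (simp add: coeff_def z_def z'_def)
    finally show ?thesis using cc by (simp add: a_minus_def r_neg)
  qed
  \<comment> \<open>The positions 0 and \<open>k\<close> start the two blocks. Within a block
    \<open>z\<close> is constant and \<open>c\<close> runs through all of \<open>cs\<close>, so the
    choice of \<open>cs\<close> makes the difference zero.\<close>
  have zz: "z i = z' i" if i: "i = 0 \<or> i = k" for i
  proof -
    have "z i \<ominus> z' i = \<zero>"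
    proof (rule cs(2))
      show "z i \<ominus> z' i \<in> C" by (rule CD(5)[OF z])
      fix a assume "a \<in> set cs"
      then obtain j where j: "j < k" "a = cs ! j" using k by (auto simp: in_set_conv_nth)
      have ij: "i + j < N" using i j N by auto
      have "c (i + j) = a" using i j by (auto simp: c_def)
      moreover have "z (i + j) = z i" "z' (i + j) = z' i" using i j k_pos by (auto simp: z_def z'_def)
      ultimately show "a \<otimes> (z i \<ominus> z' i) \<in> Ld" using dz[OF ij] Ld_diff[OF dl(2)[OF ij] dl(1)[OF ij]] by simp
    qed
    then show ?thesis using z CD(2) diff_zero by simp
  qed
  have last: "w (N - 1) = w' (N - 1)" and ee: "e = e'"
    using zz[of 0] zz[of k] k_pos by (auto simp: z_def z'_def)
  have ss: "w (N + i) = w' (N + i)" if "i < N" for i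
  proof -
    have "z i = z' i" using last ee by (simp add: z_def z'_def)
    then have "w' (N + i) \<ominus> w (N + i) = \<zero>"
      using dz[OF that] z c_C CD(2) by (simp add: a_minus_def r_neg)
    then show ?thesis using wc[of "N + i"] that diff_zero by simp
  qed
  have "\<exists>l \<in> F. g \<tau> \<nu> w' i = l \<otimes> g \<tau> \<nu> w i" if "i < N" for i
    by (rule equal_log_derivative[of _ _ "w (N + i)"])
      (use r r' that ss[OF that] w[of "N + i"] gC[OF that] in \<open>auto simp: rel_def\<close>)
  then obtain l where l: "\<And>i. i < N \<Longrightarrow> l i \<in> F" "\<And>i. i < N \<Longrightarrow> g \<tau> \<nu> w' i = l i \<otimes> g \<tau> \<nu> w i" by metis
  have lc: "l i \<in> carrier M" if "i < N" for i using l(1)[OF that] F(3) CD(2) by blast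
  \<comment> \<open>The constant factors between the two versions of \<open>h\<close>. The entry at
    0 is 1 on both sides, which later pins down the common value of all factors.\<close>
  define m where "m i = (if i = 0 then \<one> else l (i - 1))" for i
  have m: "m i \<in> F" if "i < N" for i using l(1)[of "i - 1"] that divsubD(4)[OF F(1)] by (simp add: m_def)
  have hC: "h \<tau> \<nu> w i \<in> C" if "i < N" for i by (rule h_C[OF _ \<tau> that]) (simp add: w1)
  have hc: "h \<tau> \<nu> w i \<in> carrier M" if "i < N" for i using hC[OF that] CD(2) by blast
  have hm: "h \<tau> \<nu> w' i = m i \<otimes> h \<tau> \<nu> w i" if i: "i < N" for i
  proof (cases i)
    case 0 then show ?thesis by (simp add: h_def m_def)
  next
    case (Suc j)
    then have j: "j < N" "j \<noteq> N - 1" using i by auto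
    have "w' j \<oplus> \<tau> j = l j \<otimes> (w j \<oplus> \<tau> j)" using l(2)[OF j(1)] j(2) by (simp add: g_def)
    then show ?thesis unfolding Suc h_def m_def
      using lc[OF j(1)] wc[of j] j(1) \<tau>[OF j(1)] CD(2) pc by (simp add: m_assoc)
  qed
  \<comment> \<open>The last \<open>g\<close> is the sum of the \<open>h\<close>, so independence
    compares its factor with those of the summands.\<close>
  have "m i = l (N - 1)" if i: "i < N" for i
  proof (rule lin_indep_unique[OF F(1) _ hc m _ _ i])
    show "lin_indep F (h \<tau> \<nu> w) N" using r by (simp add: rel_def)
    have "psum (\<lambda>i. m i \<otimes> h \<tau> \<nu> w i) N = psum (h \<tau> \<nu> w') N" by (rule psum_cong) (simp add: hm)
    also have "\<dots> = l (N - 1) \<otimes> psum (h \<tau> \<nu> w) N" using l(2)[OF N0(1)] by (simp add: g_def)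
    also have "\<dots> = psum (\<lambda>i. l (N - 1) \<otimes> h \<tau> \<nu> w i) N"
      by (rule psum_lmult[symmetric]) (simp_all only: hc lc[OF N0(1)])
    finally show "psum (\<lambda>i. m i \<otimes> h \<tau> \<nu> w i) N = psum (\<lambda>i. l (N - 1) \<otimes> h \<tau> \<nu> w i) N" .
  qed (use l N0 in auto)
  note mi = this
  have m1: "l (N - 1) = \<one>" using mi[of 0] N0 by (simp add: m_def)
  have "w i = w' i" if i: "i < N" for i
  proof (cases "i = N - 1")
    case True then show ?thesis using last by simp
  next
    case False
    then have "l i = \<one>" using mi[of "Suc i"] m1 i by (simp add: m_def)
    then have "w' i \<oplus> \<tau> i = w i \<oplus> \<tau> i"
      using l(2)[OF i] False wc[of i] \<tau>[OF i] CD(2) i by (simp add: g_def)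
    then show ?thesis using wc[of i] i \<tau>[OF i] CD(2) by simp
  qed
  then have "psum (\<lambda>i. w i \<otimes> X i) N = psum (\<lambda>i. w' i \<otimes> X i) N" by (intro psum_cong) simp
  then show ?thesis using r r' ee by (simp add: rel_def)
qed

lemma rel_exists:
  assumes y: "y \<in> A" and e: "e \<in> C"
  obtains \<tau> \<nu> x w where "\<And>i. \<tau> i \<in> {\<zero>, \<one>}" "\<And>i. \<nu> i \<le> N" "x \<in> A" "range w \<subseteq> C"
    "\<And>i. i \<ge> 2 * N \<Longrightarrow> w i = \<zero>" "rel \<tau> \<nu> x y e w"
proof -
  have N0: "N - 1 < N" using N k_pos by auto
  obtain f where f: "\<And>i. f i \<in> C" "y = psum (\<lambda>i. f i \<otimes> X i) N" using y unfolding A_def by blast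
  \<comment> \<open>The shift repairs the zero coordinates, which have no logarithmic
    derivative.\<close>
  define \<tau> where "\<tau> i = (if f i = \<zero> then \<one> else \<zero>)" for i
  have \<tau>: "\<tau> i \<in> C" "f i \<oplus> \<tau> i \<noteq> \<zero>" for i using CD(3,4) one_nz f(1)[of i] CD(2) by (auto simp: \<tau>_def)
  have \<tau>01: "\<tau> i \<in> {\<zero>, \<one>}" for i by (simp add: \<tau>_def)
  \<comment> \<open>The exponents are fixed one after the other. Entry \<open>n\<close> affects
    \<open>h\<close> only at \<open>Suc n\<close>, so the independence reached before is
    kept.\<close>
  have "n < N \<Longrightarrow> \<exists>\<nu>. (\<forall>i. \<nu> i \<le> N) \<and> lin_indep F (h \<tau> \<nu> f) (Suc n)" for n
  proof (induction n)
    case 0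
    have "f' 0 = \<zero>" if "f' 0 \<in> F" "f' 0 \<otimes> \<one> = \<zero>" for f' :: "nat \<Rightarrow> 'a"
      using that F(3) CD(2) by (metis r_one subsetD)
    then have "lin_indep F (h \<tau> (\<lambda>_. 0) f) (Suc 0)"
      unfolding lin_indep_def using F(3) CD(2) by (auto simp: h_def)
    then show ?case by (intro exI[of _ "\<lambda>_. 0"]) simp
  next
    case (Suc n)
    then obtain \<nu> where \<nu>: "\<forall>i. \<nu> i \<le> N" "lin_indep F (h \<tau> \<nu> f) (Suc n)" by auto
    have hC: "h \<tau> \<nu> f i \<in> C" if "i < Suc n" for i
      by (rule h_C) (use f \<tau> that Suc.prems in auto)
    obtain \<nu>0 where \<nu>0: "\<nu>0 \<le> Suc n" "lin_indep F ((h \<tau> \<nu> f)(Suc n := (f n \<oplus> \<tau> n) \<otimes> p [^] \<nu>0)) (Suc (Suc n))"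
      using indep_twist[OF \<nu>(2) hC CD(6)[OF f(1) \<tau>(1)] \<tau>(2)] by blast
    have "((h \<tau> \<nu> f)(Suc n := (f n \<oplus> \<tau> n) \<otimes> p [^] \<nu>0)) i = h \<tau> (\<nu>(n := \<nu>0)) f i" if "i < Suc (Suc n)" for i
      using that by (auto simp: h_def)
    from iffD1[OF lin_indep_cong[OF this] \<nu>0(2)]
    have "lin_indep F (h \<tau> (\<nu>(n := \<nu>0)) f) (Suc (Suc n))" .
    moreover have "\<forall>i. (\<nu>(n := \<nu>0)) i \<le> N" using \<nu>(1) \<nu>0(1) Suc.prems by auto
    ultimately show ?case by blast
  qed
  from this[OF N0] obtain \<nu> where \<nu>: "\<And>i. \<nu> i \<le> N" "lin_indep F (h \<tau> \<nu> f) N" using N0 by auto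
  have hC: "h \<tau> \<nu> f i \<in> C" if "i < N" for i by (rule h_C[OF f(1) \<tau>(1) that])
  have gC: "g \<tau> \<nu> f i \<in> C" if "i < N" for i by (rule g_C[OF f(1) \<tau>(1) that])
  have gnz: "g \<tau> \<nu> f i \<noteq> \<zero>" if "i < N" for i
  proof (cases "i = N - 1")
    \<comment> \<open>The last \<open>g\<close> is a sum of independent elements with coefficients
      1.\<close>
    case True
    show ?thesis
    proof
      assume "g \<tau> \<nu> f i = \<zero>"
      moreover have "psum (\<lambda>i. \<one> \<otimes> h \<tau> \<nu> f i) N = psum (h \<tau> \<nu> f) N"
        by (rule psum_cong) (use hC CD(2) in simp)
      ultimately have "psum (\<lambda>i. \<one> \<otimes> h \<tau> \<nu> f i) N = \<zero>" using True by (simp add: g_def)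
      then show False using lin_indepD[OF \<nu>(2), of "\<lambda>_. \<one>" 0] divsubD(4)[OF F(1)] N0 one_nz by simp
    qed
  qed (use \<tau>(2) in \<open>simp add: g_def\<close>)
  define s where "s i = D (g \<tau> \<nu> f i) \<otimes> inv (g \<tau> \<nu> f i)" for i
  have s: "s i \<in> C" "D (g \<tau> \<nu> f i) = s i \<otimes> g \<tau> \<nu> f i" if "i < N" for i
  proof -
    show "s i \<in> C" unfolding s_def by (intro CD(8) CD(9) D_C gC gnz that)
    have "g \<tau> \<nu> f i \<in> carrier M" using gC[OF that] CD(2) by blast
    then show "D (g \<tau> \<nu> f i) = s i \<otimes> g \<tau> \<nu> f i"
      unfolding s_def using inv_cancel(4)[OF _ gnz[OF that] D_closed] by simp
  qed
  define w where "w i = (if i < N then f i else if i < 2 * N then s (i - N) else \<zero>)" for i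
  have w: "w i \<in> C" for i using f(1) s(1)[of "i - N"] CD(3) by (auto simp: w_def)
  have hw: "h \<tau> \<nu> w i = h \<tau> \<nu> f i" if "i < N" for i using that by (auto simp: h_def w_def)
  have pw: "psum (h \<tau> \<nu> w) N = psum (h \<tau> \<nu> f) N" by (rule psum_cong) (rule hw)
  have gw: "g \<tau> \<nu> w i = g \<tau> \<nu> f i" if "i < N" for i using that pw by (auto simp: g_def w_def)
  have "lin_indep F (h \<tau> \<nu> w) N" using \<nu>(2) lin_indep_cong[of N "h \<tau> \<nu> w" "h \<tau> \<nu> f" F] hw by blast
  moreover have "psum (\<lambda>i. w i \<otimes> X i) N = y" unfolding f(2) by (rule psum_cong) (simp add: w_def)
  ultimately have r: "rel \<tau> \<nu> (psum (\<lambda>i. coeff e w i \<otimes> X i) N) y e w"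
    unfolding rel_def using w gw gnz s by (auto simp: w_def)
  have xA: "psum (\<lambda>i. coeff e w i \<otimes> X i) N \<in> A"
    by (rule A_I) (unfold coeff_def, intro CD(6,8) c_C, use e w in simp_all)
  have "range w \<subseteq> C" using w by blast
  moreover have "w i = \<zero>" if "i \<ge> 2 * N" for i using that by (simp add: w_def)
  ultimately show ?thesis by (rule that[OF \<tau>01 \<nu>(1) xA _ _ r])
qed

end

section \<open>Definability of the correspondence\<close>

context super_skew
begin

text \<open>A predicate of a truncated sequence depends on finitely many entries, as the quantifier
  rules for sequences require.\<close>

definition trunc :: "nat \<Rightarrow> (nat \<Rightarrow> 'm) \<Rightarrow> nat \<Rightarrow> 'm" where
  "trunc n w i = (if i < n then w i else \<zero>)"

lemma tdef_trunc: "tdef M (\<lambda>v. trunc n (\<lambda>i. v (m + i)) j)"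
  by (cases "j < n") (simp_all add: trunc_def tdef_var[OF L] tdef_const L)

lemma lin_indep_trunc:
  assumes E: "E \<subseteq> carrier M" "\<zero> \<in> E"
  shows "lin_indep E H n \<longleftrightarrow> (\<forall>f. range f \<subseteq> carrier M \<longrightarrow> (\<forall>i \<in> {..<n}. trunc n f i \<in> E) \<longrightarrow>
    psum (\<lambda>i. trunc n f i \<otimes> H i) n = \<zero> \<longrightarrow> (\<forall>i \<in> {..<n}. trunc n f i = \<zero>))" (is "_ \<longleftrightarrow> ?r")
proof
  assume "lin_indep E H n"
  then show ?r unfolding lin_indep_def by auto
next
  assume r: ?r
  show "lin_indep E H n" unfolding lin_indep_def
  proof (rule allI, rule impI, rule impI)
    fix f assume f: "\<forall>i < n. f i \<in> E" and z: "psum (\<lambda>i. f i \<otimes> H i) n = \<zero>"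
    define f' where "f' = trunc n f"
    have t: "trunc n f' i = f i" if "i < n" for i using that by (simp add: f'_def trunc_def)
    have "range f' \<subseteq> carrier M" using f E by (auto simp: f'_def trunc_def)
    moreover have "psum (\<lambda>i. trunc n f' i \<otimes> H i) n = \<zero>"
      unfolding z[symmetric] by (rule psum_cong) (simp add: t)
    moreover have "\<forall>i \<in> {..<n}. trunc n f' i \<in> E" using f by (simp add: t)
    ultimately have "\<forall>i \<in> {..<n}. trunc n f' i = \<zero>" using r by blast
    then show "\<forall>i < n. f i = \<zero>" by (simp add: t)
  qed
qed

lemma dfn_lin_indep:
  assumes E: "dset M E" "E \<subseteq> carrier M" "\<zero> \<in> E"
    and H: "\<And>i. i < n \<Longrightarrow> tdef M (\<lambda>v. H v i)" "\<And>v v'. (\<And>i. i < m \<Longrightarrow> v i = v' i) \<Longrightarrow> H v = H v'"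
  shows "dfn M (\<lambda>v. lin_indep E (H v) n)"
proof -
  define Q where "Q v f \<longleftrightarrow> (\<forall>i \<in> {..<n}. trunc n f i \<in> E) \<longrightarrow>
    psum (\<lambda>i. trunc n f i \<otimes> H v i) n = \<zero> \<longrightarrow> (\<forall>i \<in> {..<n}. trunc n f i = \<zero>)" for v f
  have "dfn M (\<lambda>v. \<forall>f. range f \<subseteq> carrier M \<longrightarrow> Q v f)"
  proof (rule dfn_all_fun[where m = m and N = n])
    show "dfn M (\<lambda>v. Q v (\<lambda>i. v (m + i)))" unfolding Q_def
      by (intro dfn_imp dfn_ball[OF L] dset_mem[OF L E(1)] dfn_eq tdef_psum[OF L] tdef_mult tdef_trunc tdef_const H L) auto
    show "Q v w = Q v' w" if "\<And>i. i < m \<Longrightarrow> v i = v' i" for v v' w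
      using H(2)[of v v'] that by (simp add: Q_def)
    show "Q v w = Q v w'" if "\<And>i. i < n \<Longrightarrow> w i = w' i" for v w w'
    proof -
      have "trunc n w = trunc n w'" using that by (intro ext) (simp add: trunc_def)
      then show ?thesis by (simp add: Q_def)
    qed
  qed
  then show ?thesis unfolding lin_indep_trunc[OF E(2,3)] Q_def .
qed

end

context log_absorption
begin

lemma rel_cong:
  assumes r: "rel \<tau> \<nu> x y e w" and eq: "\<And>i. i < N \<Longrightarrow> \<tau> i = \<tau>' i" "\<And>i. i < N \<Longrightarrow> \<nu> i = \<nu>' i"
  shows "rel \<tau>' \<nu>' x y e w"
proof -
  have hh: "h \<tau> \<nu> w i = h \<tau>' \<nu>' w i" if "i < N" for i
    using eq(1)[of "i - 1"] eq(2)[of "i - 1"] that by (simp add: h_def)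
  have "psum (h \<tau> \<nu> w) N = psum (h \<tau>' \<nu>' w) N" by (rule psum_cong) (rule hh)
  then have "g \<tau> \<nu> w i = g \<tau>' \<nu>' w i" if "i < N" for i using eq(1) that by (simp add: g_def)
  moreover have "lin_indep F (h \<tau> \<nu> w) N \<longleftrightarrow> lin_indep F (h \<tau>' \<nu>' w) N" by (rule lin_indep_cong) (rule hh)
  ultimately show ?thesis using r by (auto simp: rel_def)
qed

lemma dfn_rel:
  assumes \<tau>: "\<And>i. i < N \<Longrightarrow> \<tau> i \<in> carrier M"
  shows "dfn M (\<lambda>v. \<exists>w. range w \<subseteq> carrier M \<and> rel \<tau> \<nu> (v 0) (v 1) (v 2) (trunc (2 * N) w))"
proof (rule dfn_ex_fun[where m = 3 and N = "2 * N"])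
  have Xt: "tdef M (\<lambda>v. X i)" if "i < N" for i by (rule tdef_const[OF L Xc[OF that]])
  have ct: "tdef M (\<lambda>v. c i)" for i by (rule tdef_const[OF L]) (rule CD(2)[OF c_C])
  have ht: "tdef M (\<lambda>v. h \<tau> \<nu> (trunc (2 * N) (\<lambda>i. v (3 + i))) i)" if "i < N" for i
    unfolding h_def using \<tau>[of "i - 1"] that pc
    by (cases "i = 0") (simp_all add: tdef_const[OF L] tdef_mult[OF L] tdef_add[OF L] tdef_trunc)
  have gt: "tdef M (\<lambda>v. g \<tau> \<nu> (trunc (2 * N) (\<lambda>i. v (3 + i))) i)" if "i < N" for i
    unfolding g_def using \<tau>[OF that]
    by (cases "i = N - 1") (simp_all add: tdef_psum[OF L] ht tdef_const[OF L] tdef_add[OF L] tdef_trunc)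
  have cft: "tdef M (\<lambda>v. coeff (v 2) (trunc (2 * N) (\<lambda>i. v (3 + i))) i)" for i
    unfolding coeff_def
    by (cases "i < k") (simp_all add: ct tdef_mult[OF L] tdef_add[OF L] tdef_var[OF L] tdef_trunc)
  have li: "dfn M (\<lambda>v. lin_indep F (h \<tau> \<nu> (trunc (2 * N) (\<lambda>i. v (3 + i)))) N)"
  proof (rule dfn_lin_indep[OF F(2) _ _ ht, where m = "3 + 2 * N"])
    show "F \<subseteq> carrier M" "\<zero> \<in> F" using divsubD(2,3)[OF F(1)] by blast+
    show "h \<tau> \<nu> (trunc (2 * N) (\<lambda>i. v (3 + i))) = h \<tau> \<nu> (trunc (2 * N) (\<lambda>i. v' (3 + i)))"
      if "\<And>i. i < 3 + 2 * N \<Longrightarrow> v i = v' i" for v v' :: "nat \<Rightarrow> 'a"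
    proof -
      have "trunc (2 * N) (\<lambda>i. v (3 + i)) = trunc (2 * N) (\<lambda>i. v' (3 + i))"
        using that by (intro ext) (simp add: trunc_def)
      then show ?thesis by simp
    qed
  qed
  show "dfn M (\<lambda>v. rel \<tau> \<nu> (v 0) (v 1) (v 2) (trunc (2 * N) (\<lambda>i. v (3 + i))))"
    unfolding rel_def D_def
    by (intro dfn_conj dfn_ball[OF L] dset_mem[OF L C(2)] dfn_not dfn_eq li tdef_psum[OF L] tdef_mult
      tdef_minus gt cft Xt tdef_trunc tdef_var tdef_const L bc zero_closed) auto
  show "rel \<tau> \<nu> (v 0) (v 1) (v 2) (trunc (2 * N) w) = rel \<tau> \<nu> (v' 0) (v' 1) (v' 2) (trunc (2 * N) w)"
    if "\<And>i. i < 3 \<Longrightarrow> v i = v' i" for v v' w :: "nat \<Rightarrow> 'a"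
    using that by simp
  show "rel \<tau> \<nu> (v 0) (v 1) (v 2) (trunc (2 * N) w) = rel \<tau> \<nu> (v 0) (v 1) (v 2) (trunc (2 * N) w')"
    if "\<And>i. i < 2 * N \<Longrightarrow> w i = w' i" for v w w' :: "nat \<Rightarrow> 'a"
  proof -
    have "trunc (2 * N) w = trunc (2 * N) w'" using that by (intro ext) (simp add: trunc_def)
    then show ?thesis by simp
  qed
qed

lemma dset_A: "dset M A"
proof -
  have "dfn M (\<lambda>v. \<exists>w. range w \<subseteq> carrier M \<and> ((\<forall>i \<in> {..<N}. trunc N w i \<in> C) \<and>
    v 0 = psum (\<lambda>i. trunc N w i \<otimes> X i) N))"
  proof (rule dfn_ex_fun[where m = 1 and N = N])
    have Xt: "tdef M (\<lambda>v. X i)" if "i < N" for i by (rule tdef_const[OF L Xc[OF that]])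
    show "dfn M (\<lambda>v. (\<forall>i \<in> {..<N}. trunc N (\<lambda>i. v (1 + i)) i \<in> C) \<and>
      v 0 = psum (\<lambda>i. trunc N (\<lambda>i. v (1 + i)) i \<otimes> X i) N)"
      by (intro dfn_conj dfn_ball[OF L] dset_mem[OF L C(2)] dfn_eq tdef_psum[OF L] tdef_mult Xt tdef_trunc tdef_var L) auto
    show "((\<forall>i \<in> {..<N}. trunc N w i \<in> C) \<and> v 0 = psum (\<lambda>i. trunc N w i \<otimes> X i) N) =
      ((\<forall>i \<in> {..<N}. trunc N w' i \<in> C) \<and> v 0 = psum (\<lambda>i. trunc N w' i \<otimes> X i) N)"
      if "\<And>i. i < N \<Longrightarrow> w i = w' i" for v w w' :: "nat \<Rightarrow> 'a"
    proof -
      have "trunc N w = trunc N w'" using that by (intro ext) (simp add: trunc_def)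
      then show ?thesis by simp
    qed
  qed simp
  then show ?thesis unfolding dset_def
  proof (rule dfn_cong)
    fix v :: "nat \<Rightarrow> 'a"
    show "(\<exists>w. range w \<subseteq> carrier M \<and> ((\<forall>i \<in> {..<N}. trunc N w i \<in> C) \<and>
      v 0 = psum (\<lambda>i. trunc N w i \<otimes> X i) N)) \<longleftrightarrow> v 0 \<in> A"
    proof
      assume "v 0 \<in> A"
      then obtain f where f: "\<forall>i. f i \<in> C" "v 0 = psum (\<lambda>i. f i \<otimes> X i) N" unfolding A_def by blast
      have "psum (\<lambda>i. f i \<otimes> X i) N = psum (\<lambda>i. trunc N f i \<otimes> X i) N"
        by (rule psum_cong) (simp add: trunc_def)
      moreover have "range f \<subseteq> carrier M" using f(1) CD(2) by blast
      ultimately show "\<exists>w. range w \<subseteq> carrier M \<and> ((\<forall>i \<in> {..<N}. trunc N w i \<in> C) \<and>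
        v 0 = psum (\<lambda>i. trunc N w i \<otimes> X i) N)"
        using f by (intro exI[of _ f]) (simp add: trunc_def)
    qed (auto intro!: A_I)
  qed
qed

text \<open>For each of the finitely many choices of shifts and exponents, \<open>x\<close>
  determines \<open>y\<close> and \<open>e\<close>. The union of these relations is thus at most
  \<open>card Opt\<close> to one and absorbs a copy of \<open>C\<close>, which is infinite as it
  contains the multiples of 1.\<close>

lemma contradiction: False
proof -
  \<comment> \<open>Functions restricted to the indices below \<open>N\<close> leave finitely many
    options, and \<open>rel\<close> depends on no other values.\<close>
  define Opt where "Opt = (PiE {..<N} (\<lambda>_. {\<zero>, \<one>}) \<times> PiE {..<N} (\<lambda>_. {..N}) :: ((nat \<Rightarrow> 'a) \<times> (nat \<Rightarrow> nat)) set)"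
  have Opt: "finite Opt" unfolding Opt_def by (intro finite_cartesian_product finite_PiE) auto
  have \<tau>: "fst o' i \<in> C" if "o' \<in> Opt" "i < N" for o' i
  proof -
    have "fst o' \<in> PiE {..<N} (\<lambda>_. {\<zero>, \<one>})" using that(1) by (simp add: Opt_def mem_Times_iff)
    then have "fst o' i \<in> {\<zero>, \<one>}" by (rule PiE_mem) (simp add: that(2))
    then show ?thesis using CD(3) CD(4) by auto
  qed
  define J1 where "J1 o' x y e \<longleftrightarrow> (\<exists>w. range w \<subseteq> carrier M \<and> rel (fst o') (snd o') x y e (trunc (2 * N) w))" for o' x y e
  define J where "J x y e \<longleftrightarrow> (\<exists>o' \<in> Opt. J1 o' x y e)" for x y e
  have one: "finite S \<and> card S \<le> 1" if "\<And>a b. a \<in> S \<Longrightarrow> b \<in> S \<Longrightarrow> a = b" for S :: "('a \<times> 'a) set"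
  proof (cases "S = {}")
    case False
    then obtain a where "a \<in> S" by blast
    then have "S = {a}" using that by blast
    then show ?thesis by simp
  qed simp
  have U1: "finite {(y, e). y \<in> A \<and> e \<in> C \<and> J1 o' x y e} \<and> card {(y, e). y \<in> A \<and> e \<in> C \<and> J1 o' x y e} \<le> 1"
    if o': "o' \<in> Opt" for o' x
  proof (rule one)
    fix a b assume "a \<in> {(y, e). y \<in> A \<and> e \<in> C \<and> J1 o' x y e}" "b \<in> {(y, e). y \<in> A \<and> e \<in> C \<and> J1 o' x y e}"
    then obtain y e y' e' w w' where ab: "a = (y, e)" "b = (y', e')" "e \<in> C" "e' \<in> C"
      "rel (fst o') (snd o') x y e w" "rel (fst o') (snd o') x y' e' w'" unfolding J1_def by blast
    then show "a = b" using rel_unique[OF \<tau>[OF o'] ab(3-6)] by simp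
  qed
  have U: "{(y, e). y \<in> A \<and> e \<in> C \<and> J x y e} = (\<Union>o' \<in> Opt. {(y, e). y \<in> A \<and> e \<in> C \<and> J1 o' x y e})" for x
    by (auto simp: J_def)
  have inj: "inj nat_emb"
  proof (rule linorder_injI)
    fix m n :: nat assume "m < n"
    then have "nat_emb n = nat_emb m \<oplus> nat_emb (n - m)" by (simp add: nat_emb_add[symmetric])
    then show "nat_emb m \<noteq> nat_emb n" using char_zero[of "n - m"] \<open>m < n\<close> by auto
  qed
  show False
  proof (rule no_absorption[OF super zero_closed dset_A _ _ C(2), where J = J and q = "card Opt"])
    show "A \<subseteq> carrier M" unfolding A_def using CD(2) Xc by (auto intro!: psum_closed)
    have "psum (\<lambda>i. \<zero> \<otimes> X i) N \<in> A" by (rule A_I) (rule CD(3))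
    then show "A \<noteq> {}" by blast
    show "C \<subseteq> carrier M" using CD(2) by blast
    show "infinite C" using nat_C range_inj_infinite[OF inj] finite_subset[of "range nat_emb" C] by blast
    show "dfn M (\<lambda>v. J (v 0) (v 1) (v 2))" unfolding J_def J1_def
      by (rule dfn_bex[OF L Opt], rule dfn_rel) (use \<tau> CD(2) in blast)
    fix y e assume "y \<in> A" "e \<in> C"
    then show "\<exists>x \<in> A. J x y e"
    proof (rule rel_exists)
      fix \<tau> \<nu> x w
      assume r: "\<And>i. \<tau> i \<in> {\<zero>, \<one>}" "\<And>i. \<nu> i \<le> N" "x \<in> A" "range w \<subseteq> C"
        "\<And>i. i \<ge> 2 * N \<Longrightarrow> w i = \<zero>" "rel \<tau> \<nu> x y e w"
      have o': "(restrict \<tau> {..<N}, restrict \<nu> {..<N}) \<in> Opt" unfolding Opt_def using r(1,2) by auto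
      have "trunc (2 * N) w = w" using r(5) by (intro ext) (simp add: trunc_def)
      moreover have "rel (restrict \<tau> {..<N}) (restrict \<nu> {..<N}) x y e w" by (rule rel_cong[OF r(6)]) auto
      moreover have "range w \<subseteq> carrier M" using r(4) CD(2) by blast
      ultimately have "J1 (restrict \<tau> {..<N}, restrict \<nu> {..<N}) x y e"
        unfolding J1_def by (intro exI[of _ w]) simp
      then show "\<exists>x \<in> A. J x y e" using o' r(3) unfolding J_def by blast
    qed
  next
    show "finite {(y, e). y \<in> A \<and> e \<in> C \<and> J x y e}" for x
      unfolding U using Opt U1 by blast
    show "card {(y, e). y \<in> A \<and> e \<in> C \<and> J x y e} \<le> card Opt" for x
    proof -
      have "card (\<Union>o' \<in> Opt. {(y, e). y \<in> A \<and> e \<in> C \<and> J1 o' x y e})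
        \<le> (\<Sum>o' \<in> Opt. card {(y, e). y \<in> A \<and> e \<in> C \<and> J1 o' x y e})" by (rule card_UN_le[OF Opt])
      also have "\<dots> \<le> (\<Sum>o' \<in> Opt. 1)" using U1 by (intro sum_mono) blast
      finally show ?thesis unfolding U by simp
    qed
  qed
qed

end

context log_derivations
begin

text \<open>Since \<open>C\<close> is contained in the centralizer of \<open>p\<close>,
  \<open>K\<close> is infinite dimensional over \<open>C\<close> as well, and there are enough
  independent vectors for the coordinates of the correspondence.\<close>

lemma one_in_Ld:
  assumes nfs: "\<not> finspan (cent K {p}) K"
  shows "\<one> \<in> Ld"
proof (rule ccontr)
  assume one: "\<one> \<notin> Ld"
  obtain cs where cs: "set cs \<subseteq> C" "\<And>x. x \<in> C \<Longrightarrow> (\<And>c. c \<in> set cs \<Longrightarrow> c \<otimes> x \<in> Ld) \<Longrightarrow> x = \<zero>"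
    using finitely_many_translates[OF one] by blast
  have "\<not> finspan C K"
  proof
    assume "finspan C K"
    then obtain vs where vs: "set vs \<subseteq> K" "K \<subseteq> lspan C vs" unfolding finspan_def by blast
    have E: "divsub (cent K {p})" using pc by (intro divsub_cent K) auto
    have vc: "set vs \<subseteq> carrier M" using vs(1) Kc by blast
    have "lsub C (lspan (cent K {p}) vs)"
      using lsub_lspan[OF E vc] C(5) unfolding lsub_def by blast
    then have "lspan C vs \<subseteq> lspan (cent K {p}) vs"
      by (rule lspan_least) (use lspan_set[OF E vc] in blast)
    then show False using nfs vs unfolding finspan_def by blast
  qed
  then obtain X where "\<forall>i < 2 * length cs. X i \<in> K" "lin_indep C X (2 * length cs)"
    using lin_indep_exists[OF C(1) K(1)] by blast
  then interpret log_absorption M \<kappa> K b p cs X "2 * length cs" "length cs"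
    by unfold_locales (use cs in auto)
  show False by (rule contradiction)
qed

end

section \<open>Conjugation\<close>

context skew_field
begin

lemma inv_inv_nz: "x \<in> carrier R \<Longrightarrow> x \<noteq> \<zero> \<Longrightarrow> inv (inv x) = x"
  using skew_field_Units by simp

lemma mult_eq_iff:
  assumes "x \<in> carrier R" "x \<noteq> \<zero>" "y \<in> carrier R" "z \<in> carrier R"
  shows "x \<otimes> y = z \<longleftrightarrow> y = inv x \<otimes> z" "y \<otimes> x = z \<longleftrightarrow> y = z \<otimes> inv x"
  using assms inv_cancel[OF assms(1,2)] inv_props[OF assms(1,2)] by metis+

definition noncentral :: "'a set \<Rightarrow> 'a \<Rightarrow> bool" where
  "noncentral K x \<longleftrightarrow> x \<in> K \<and> cent K {x} \<noteq> K"

definition similar :: "'a set \<Rightarrow> 'a \<Rightarrow> 'a \<Rightarrow> bool" where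
  "similar K x y \<longleftrightarrow> (\<exists>g \<in> K. g \<noteq> \<zero> \<and> g \<otimes> x = y \<otimes> g)"

lemma noncentral_iff: "noncentral K x \<longleftrightarrow> x \<in> K \<and> (\<exists>y \<in> K. x \<notin> cent K {y})"
proof -
  have "x \<in> cent K {y} \<longleftrightarrow> y \<in> cent K {x}" if "x \<in> K" "y \<in> K" for y
    using that by (auto simp: cent_def)
  then show ?thesis unfolding noncentral_def using cent_sub[of K "{x}"] by blast
qed

text \<open>A noncentral \<open>x\<close> lies outside the centralizer of some \<open>y\<close>.
  That centralizer is a division ring, so it contains nothing from which \<open>x\<close> is
  recovered by ring operations and inversion.\<close>

lemma noncentral_closure:
  assumes K: "divsub K" and x: "noncentral K x"
  shows "x \<noteq> \<zero>" "noncentral K (x \<oplus> \<one>)" "noncentral K (x \<ominus> \<one>)" "noncentral K (\<ominus> x)" "noncentral K (inv x)"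
proof -
  note KD = divsubD[OF K]
  obtain y where y: "x \<in> K" "y \<in> K" "x \<notin> cent K {y}" using x noncentral_iff by blast
  have V: "divsub (cent K {y})" using KD(2)[OF y(2)] by (intro divsub_cent K) auto
  note VD = divsubD[OF V]
  have xc: "x \<in> carrier R" by (rule KD(2)[OF y(1)])
  show nz: "x \<noteq> \<zero>" using VD(3) y(3) by metis
  have 1: "(x \<oplus> \<one>) \<ominus> \<one> = x" "(x \<ominus> \<one>) \<oplus> \<one> = x" "\<ominus> (\<ominus> x) = x" "inv (inv x) = x"
    using xc one_closed inv_inv_nz[OF xc nz] by (algebra, algebra, simp, simp)
  have "x \<oplus> \<one> \<notin> cent K {y}" using VD(5)[OF _ VD(4), of "x \<oplus> \<one>"] 1(1) y(3) by auto
  moreover have "x \<ominus> \<one> \<notin> cent K {y}" using VD(6)[OF _ VD(4), of "x \<ominus> \<one>"] 1(2) y(3) by auto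
  moreover have "\<ominus> x \<notin> cent K {y}" using VD(7)[of "\<ominus> x"] 1(3) y(3) by auto
  moreover have "inv x \<notin> cent K {y}" using VD(9)[of "inv x"] 1(4) y(3) inv_props(4)[OF xc nz] by auto
  ultimately show "noncentral K (x \<oplus> \<one>)" "noncentral K (x \<ominus> \<one>)" "noncentral K (\<ominus> x)" "noncentral K (inv x)"
    unfolding noncentral_iff using y KD(4-7) KD(9)[OF y(1) nz] by blast+
qed

lemma similar_sym:
  assumes K: "divsub K" and xy: "x \<in> K" "y \<in> K" "similar K x y"
  shows "similar K y x"
proof -
  note KD = divsubD[OF K]
  obtain g where g: "g \<in> K" "g \<noteq> \<zero>" "g \<otimes> x = y \<otimes> g" using xy(3) unfolding similar_def by blast
  have c: "g \<in> carrier R" "x \<in> carrier R" "y \<in> carrier R" using g xy KD(2) by auto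
  have i: "inv g \<in> carrier R" using inv_props[OF c(1) g(2)] by blast
  have "inv g \<otimes> y = inv g \<otimes> (y \<otimes> g \<otimes> inv g)" using inv_cancel(3)[OF c(1) g(2) c(3)] by simp
  also have "\<dots> = inv g \<otimes> (g \<otimes> (x \<otimes> inv g))" unfolding g(3)[symmetric] using c i by (simp add: m_assoc)
  also have "\<dots> = x \<otimes> inv g" by (rule inv_cancel(1)) (use c i g in auto)
  finally show ?thesis unfolding similar_def using KD(9)[OF g(1,2)] inv_props(4)[OF c(1) g(2)] by blast
qed

lemma similar_trans:
  assumes K: "divsub K" and xy: "x \<in> K" "y \<in> K" "z \<in> K" "similar K x y" "similar K y z"
  shows "similar K x z"
proof -
  note KD = divsubD[OF K]
  obtain g where g: "g \<in> K" "g \<noteq> \<zero>" "g \<otimes> x = y \<otimes> g" using xy(4) unfolding similar_def by blast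
  obtain h where h: "h \<in> K" "h \<noteq> \<zero>" "h \<otimes> y = z \<otimes> h" using xy(5) unfolding similar_def by blast
  have c: "g \<in> carrier R" "h \<in> carrier R" "x \<in> carrier R" "y \<in> carrier R" "z \<in> carrier R"
    using g h xy KD(2) by auto
  have "(h \<otimes> g) \<otimes> x = (h \<otimes> y) \<otimes> g" using g(3) c by (simp add: m_assoc)
  also have "\<dots> = z \<otimes> (h \<otimes> g)" unfolding h(3) using c by (simp add: m_assoc)
  finally show ?thesis unfolding similar_def
    using KD(8)[OF h(1) g(1)] nz_mult[OF c(2,1)] g(2) h(2) by blast
qed

lemma similar_inv:
  assumes K: "divsub K" and xy: "x \<in> K" "y \<in> K" "x \<noteq> \<zero>" "y \<noteq> \<zero>" "similar K x y"
  shows "similar K (inv x) (inv y)"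
proof -
  note KD = divsubD[OF K]
  obtain g where g: "g \<in> K" "g \<noteq> \<zero>" "g \<otimes> x = y \<otimes> g" using xy(5) unfolding similar_def by blast
  have c: "g \<in> carrier R" "x \<in> carrier R" "y \<in> carrier R" using g xy KD(2) by auto
  have i: "inv x \<in> carrier R" "inv y \<in> carrier R"
    using inv_props(1)[OF c(2) xy(3)] inv_props(1)[OF c(3) xy(4)] by auto
  have "g \<otimes> inv x = inv y \<otimes> (y \<otimes> (g \<otimes> inv x))"
    by (rule inv_cancel(1)[symmetric]) (use c i xy in auto)
  also have "y \<otimes> (g \<otimes> inv x) = g \<otimes> x \<otimes> inv x" unfolding g(3) using c i by (simp add: m_assoc)
  also have "\<dots> = g" by (rule inv_cancel(3)) (use c xy in auto)
  finally show ?thesis unfolding similar_def using g by blast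
qed

end

context super_skew
begin

text \<open>Surjectivity of \<open>ad b\<close> gives \<open>p\<close> with
  \<open>[p, b] = 1\<close>. Such a \<open>p\<close> is noncentral itself, so 1 is a logarithmic
  derivative, and \<open>D g = g\<close> means \<open>g b = (b + 1) g\<close>.\<close>

lemma similar_plus_one:
  assumes K: "divsub K" "dset M K" "infinite K"
    and big: "\<And>b. noncentral K b \<Longrightarrow> \<not> finspan (cent K {b}) K"
    and char_zero: "\<And>n. n > 0 \<Longrightarrow> nat_emb n \<noteq> \<zero>"
    and b: "noncentral K b"
  shows "similar K b (b \<oplus> \<one>)"
proof -
  note KD = divsubD[OF K(1)]
  have bK: "b \<in> K" using b by (simp add: noncentral_def)
  have bc: "b \<in> carrier M" by (rule KD(2)[OF bK])
  obtain p where p: "p \<in> K" "ad b p = \<ominus> \<one>"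
    using ad_onto[OF K(1,2) bK infinite_cent[OF K(1,3) bK] big[OF b] KD(7)[OF KD(4)]] by blast
  have pc: "p \<in> carrier M" by (rule KD(2)[OF p(1)])
  have pb: "p \<otimes> b \<ominus> b \<otimes> p = \<one>"
  proof -
    have "p \<otimes> b \<ominus> b \<otimes> p = \<ominus> (b \<otimes> p \<ominus> p \<otimes> b)" using pc bc by algebra
    then show ?thesis using p(2) by (simp add: ad_def)
  qed
  have "p \<otimes> b \<noteq> b \<otimes> p" using pb one_nz diff_zero[of "p \<otimes> b" "b \<otimes> p"] pc bc by simp
  then have "b \<notin> cent K {p}" by (simp add: cent_def)
  then have np: "noncentral K p" using bK p(1) by (auto simp: noncentral_def)
  interpret log_derivations M \<kappa> K b p
    by unfold_locales (use K bK p(1) pb char_zero in auto)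
  obtain g where g: "g \<in> C" "g \<noteq> \<zero>" "D g = \<one> \<otimes> g" using one_in_Ld[OF big[OF np]] unfolding Ld_def by blast
  have gc: "g \<in> carrier M" using g(1) CD(2) by blast
  have eq: "g \<otimes> b \<ominus> b \<otimes> g = g" using g(3) gc by (simp add: D_def)
  have "g \<otimes> b = (g \<otimes> b \<ominus> b \<otimes> g) \<oplus> b \<otimes> g" using gc bc by algebra
  also have "\<dots> = (b \<oplus> \<one>) \<otimes> g" unfolding eq using gc bc by (simp add: l_distr a_comm)
  finally show ?thesis unfolding similar_def using g(1,2) C(3) by blast
qed

text \<open>Write \<open>x ~ y\<close> for conjugacy, so that \<open>x ~ x + 1\<close> for noncentral \<open>x\<close>. With \<open>c = a + 1\<close> we have
  \<open>1 / c ~ 1 / c - 1 = - a / c\<close>, hence \<open>a ~ c ~ - c / a = - 1 / a - 1 ~ - 1 / a\<close>. Conjugation by the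
  element that takes \<open>a\<close> to \<open>- 1 / a\<close> fixes \<open>h = a - 1 / a\<close>.\<close>

lemma larger_centralizer:
  assumes K: "divsub K" "dset M K" "infinite K"
    and big: "\<And>b. noncentral K b \<Longrightarrow> \<not> finspan (cent K {b}) K"
    and char_zero: "\<And>n. n > 0 \<Longrightarrow> nat_emb n \<noteq> \<zero>"
    and a: "noncentral K a"
  shows "\<exists>h. noncentral K h \<and> cent K {a} \<subset> cent K {h}"
proof -
  note KD = divsubD[OF K(1)]
  note nc = noncentral_closure[OF K(1)]
  have plus: "similar K x (x \<oplus> \<one>)" if "noncentral K x" for x
    by (rule similar_plus_one[OF K _ _ that]) (fact big, fact char_zero)
  have in_K: "x \<in> K" if "noncentral K x" for x using that by (simp add: noncentral_def)
  have aK: "a \<in> K" and ac: "a \<in> carrier M" and anz: "a \<noteq> \<zero>"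
    using in_K[OF a] KD(2) nc(1)[OF a] by auto
  define i where "i = inv a"
  have i: "i \<in> carrier M" "i \<otimes> a = \<one>" "a \<otimes> i = \<one>" "i \<in> K"
    unfolding i_def using inv_props[OF ac anz] KD(9)[OF aK anz] by auto
  define c where "c = a \<oplus> \<one>"
  have c: "noncentral K c" unfolding c_def by (rule nc(2)[OF a])
  have cK: "c \<in> K" and cc: "c \<in> carrier M" and cnz: "c \<noteq> \<zero>"
    using in_K[OF c] KD(2) nc(1)[OF c] by auto
  define j where "j = inv c"
  have j: "j \<in> carrier M" "j \<otimes> c = \<one>" "c \<otimes> j = \<one>" "j \<in> K" "j \<noteq> \<zero>"
    unfolding j_def using inv_props[OF cc cnz] KD(9)[OF cK cnz] by auto
  have nj: "noncentral K j" unfolding j_def by (rule nc(5)[OF c])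
  define d where "d = j \<ominus> \<one>"
  have d: "noncentral K d" unfolding d_def by (rule nc(3)[OF nj])
  have dK: "d \<in> K" and dc: "d \<in> carrier M" and dnz: "d \<noteq> \<zero>"
    using in_K[OF d] KD(2) nc(1)[OF d] by auto
  have d1: "d \<oplus> \<one> = j" unfolding d_def using j(1) one_closed by algebra
  define e where "e = \<ominus> i \<ominus> \<one>"
  have e: "noncentral K e" unfolding e_def i_def by (rule nc(3)[OF nc(4)[OF nc(5)[OF a]]])
  have eK: "e \<in> K" and ec: "e \<in> carrier M" using in_K[OF e] KD(2) by auto
  have e1: "e \<oplus> \<one> = \<ominus> i" unfolding e_def using i(1) one_closed by algebra
  \<comment> \<open>Here \<open>d\<close> is \<open>- a / c\<close> and \<open>e\<close> is
    \<open>- 1 / a - 1 = - c / a\<close>.\<close>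
  have ed: "inv d = e"
  proof -
    have "d = \<ominus> (a \<otimes> j)"
    proof -
      have "d = j \<ominus> c \<otimes> j" unfolding d_def j(3) ..
      also have "\<dots> = \<ominus> (a \<otimes> j)" unfolding c_def using ac j(1) by (simp add: l_distr a_minus_def minus_add a_ac r_neg r_neg1 r_neg2)
      finally show ?thesis .
    qed
    then have "e \<otimes> d = (\<ominus> i \<ominus> \<one>) \<otimes> (\<ominus> (a \<otimes> j))" by (simp add: e_def)
    also have "\<dots> = i \<otimes> a \<otimes> j \<oplus> \<one> \<otimes> (a \<otimes> j)" using i(1) ac j(1) one_closed by algebra
    also have "\<dots> = i \<otimes> a \<otimes> j \<oplus> a \<otimes> j" using ac j(1) by simp
    also have "\<dots> = c \<otimes> j" unfolding i(2) c_def using ac j(1) by (simp add: l_distr a_comm)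
    finally have "e \<otimes> d = \<one>" using j(3) by simp
    then show ?thesis using mult_eq_iff(2)[OF dc dnz ec one_closed] inv_props(1)[OF dc dnz] by simp
  qed
  have s1: "similar K a c" unfolding c_def by (rule plus[OF a])
  have "similar K j d" using similar_sym[OF K(1) dK, of j] plus[OF d] j(4) unfolding d1 by blast
  then have "similar K (inv j) (inv d)" by (intro similar_inv[OF K(1) j(4) dK j(5) dnz])
  then have s2: "similar K c e" unfolding ed by (simp add: j_def inv_inv_nz[OF cc cnz])
  have s3: "similar K e (\<ominus> i)" using plus[OF e] unfolding e1 .
  have "similar K a (\<ominus> i)"
    using similar_trans[OF K(1) aK eK KD(7)[OF i(4)] similar_trans[OF K(1) aK cK eK s1 s2] s3] .
  then obtain g where g: "g \<in> K" "g \<noteq> \<zero>" "g \<otimes> a = \<ominus> i \<otimes> g" unfolding similar_def by blast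
  have gc: "g \<in> carrier M" by (rule KD(2)[OF g(1)])
  have gi: "g \<otimes> i = \<ominus> (a \<otimes> g)"
  proof -
    have "a \<otimes> (g \<otimes> a) \<otimes> i = a \<otimes> (\<ominus> i \<otimes> g) \<otimes> i" unfolding g(3) ..
    moreover have "a \<otimes> (g \<otimes> a) \<otimes> i = a \<otimes> g \<otimes> (a \<otimes> i)" using ac gc i(1) by (simp add: m_assoc)
    moreover have "a \<otimes> (\<ominus> i \<otimes> g) \<otimes> i = \<ominus> ((a \<otimes> i) \<otimes> (g \<otimes> i))" using ac gc i(1) by (simp add: m_assoc l_minus r_minus)
    ultimately have "a \<otimes> g = \<ominus> (g \<otimes> i)" unfolding i(3) using ac gc i(1) by simp
    then show ?thesis using gc i(1) by simp
  qed
  obtain y where y: "y \<in> K" "ad a y = \<one>"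
    using ad_onto[OF K(1,2) aK infinite_cent[OF K(1,3) aK] big[OF a] KD(4)] by blast
  have yc: "y \<in> carrier M" by (rule KD(2)[OF y(1)])
  have ay: "a \<otimes> y \<ominus> y \<otimes> a = \<one>" using y(2) by (simp add: ad_def)
  \<comment> \<open>Otherwise the commutator of \<open>a \<otimes> a\<close> with \<open>y\<close>,
    which is \<open>2 a\<close>, would vanish.\<close>
  have sq: "a \<otimes> a \<noteq> \<ominus> \<one>"
  proof
    assume sq: "a \<otimes> a = \<ominus> \<one>"
    have "(a \<otimes> a) \<otimes> y \<ominus> y \<otimes> (a \<otimes> a) = a \<otimes> (a \<otimes> y \<ominus> y \<otimes> a) \<oplus> (a \<otimes> y \<ominus> y \<otimes> a) \<otimes> a"
      using ac yc by algebra
    also have "\<dots> = nat_emb 2 \<otimes> a" unfolding ay numeral_2_eq_2 using ac by (simp add: l_distr)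
    finally have "nat_emb 2 \<otimes> a = \<zero>" unfolding sq using yc by (simp add: l_minus r_minus a_minus_def l_neg)
    then show False using nz_mult[OF _ ac] char_zero[of 2] anz by simp
  qed
  define h where "h = a \<ominus> i"
  have hK: "h \<in> K" and hc: "h \<in> carrier M" unfolding h_def using KD(5)[OF aK i(4)] KD(2) by auto
  have gh: "g \<otimes> h = h \<otimes> g"
  proof -
    have "g \<otimes> h = g \<otimes> a \<ominus> g \<otimes> i" unfolding h_def using gc ac i(1) by algebra
    also have "\<dots> = h \<otimes> g" unfolding g(3) gi h_def using gc ac i(1) by algebra
    finally show ?thesis .
  qed
  have ga: "g \<otimes> a \<noteq> a \<otimes> g"
  proof
    assume "g \<otimes> a = a \<otimes> g"
    then have eq: "a \<otimes> g = \<ominus> i \<otimes> g" using g(3) by metis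
    have "a = a \<otimes> g \<otimes> inv g" by (rule inv_cancel(3)[OF gc g(2) ac, symmetric])
    also have "\<dots> = \<ominus> i" unfolding eq by (rule inv_cancel(3)[OF gc g(2)]) (simp add: i(1))
    finally have ai: "a = \<ominus> i" .
    have "a \<otimes> a = a \<otimes> (\<ominus> i)" by (rule arg_cong[OF ai])
    also have "\<dots> = \<ominus> \<one>" using i(1,3) ac by (simp add: r_minus)
    finally show False using sq by metis
  qed
  have iy: "i \<otimes> y \<ominus> y \<otimes> i = \<ominus> (i \<otimes> i)"
  proof -
    have "i \<otimes> (a \<otimes> y \<ominus> y \<otimes> a) \<otimes> i = (i \<otimes> a) \<otimes> y \<otimes> i \<ominus> i \<otimes> y \<otimes> (a \<otimes> i)"
      using i(1) ac yc by algebra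
    then have "i \<otimes> \<one> \<otimes> i = \<one> \<otimes> y \<otimes> i \<ominus> i \<otimes> y \<otimes> \<one>" unfolding ay i(2,3) .
    then have *: "i \<otimes> i = y \<otimes> i \<ominus> i \<otimes> y" using i(1) yc by simp
    show ?thesis unfolding * using i(1) yc by algebra
  qed
  \<comment> \<open>The commutator of \<open>h\<close> with \<open>y\<close> is
    \<open>\<one> \<oplus> i \<otimes> i\<close>, and this is nonzero by \<open>sq\<close>.\<close>
  have hy: "h \<otimes> y \<noteq> y \<otimes> h"
  proof
    assume "h \<otimes> y = y \<otimes> h"
    then have "\<zero> = h \<otimes> y \<ominus> y \<otimes> h" using diff_zero[of "h \<otimes> y" "y \<otimes> h"] hc yc by (metis m_closed)
    also have "\<dots> = (a \<otimes> y \<ominus> y \<otimes> a) \<ominus> (i \<otimes> y \<ominus> y \<otimes> i)" unfolding h_def using ac i(1) yc by algebra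
    also have "\<dots> = \<one> \<oplus> i \<otimes> i" unfolding ay iy using i(1) by (simp add: a_minus_def)
    finally have z: "\<one> \<oplus> i \<otimes> i = \<zero>" ..
    have "(\<one> \<oplus> i \<otimes> i) \<otimes> a \<otimes> a = \<zero>" unfolding z using ac by simp
    moreover have "(\<one> \<oplus> i \<otimes> i) \<otimes> a \<otimes> a = a \<otimes> a \<oplus> i \<otimes> (i \<otimes> a) \<otimes> a"
      using ac i(1) by (simp add: l_distr m_assoc)
    ultimately have "a \<otimes> a \<oplus> \<one> = \<zero>" using i ac by simp
    then show False using sq minus_equality[of "a \<otimes> a" \<one>] ac by simp
  qed
  have "cent K {a} \<subseteq> cent K {h}"
  proof
    fix x assume "x \<in> cent K {a}"
    then have x: "x \<in> K" "a \<in> cent K {x}" using aK by (auto simp: cent_def)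
    have V: "divsub (cent K {x})" using KD(2)[OF x(1)] by (intro divsub_cent K) auto
    have "h \<in> cent K {x}" unfolding h_def i_def
      by (rule divsubD(5)[OF V x(2) divsubD(9)[OF V x(2) anz]])
    then show "x \<in> cent K {h}" using x(1) by (auto simp: cent_def)
  qed
  moreover have "g \<in> cent K {h}" "g \<notin> cent K {a}" using g(1) gh ga by (auto simp: cent_def)
  moreover have "noncentral K h" using hK hy y(1) by (auto simp: noncentral_def cent_def)
  ultimately show ?thesis by blast
qed

text \<open>Otherwise both cases of the characteristic apply; in characteristic 0 the passage to a
  larger centralizer can be repeated and yields an infinite ascending chain.\<close>

lemma finspan_over_centralizer:
  assumes K: "divsub K" "dset M K" "infinite K" and a: "noncentral K a"
  shows "\<exists>b. noncentral K b \<and> finspan (cent K {b}) K"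
proof (rule ccontr)
  assume "\<not> ?thesis"
  then have big: "\<not> finspan (cent K {b}) K" if "noncentral K b" for b using that by blast
  show False
  proof (cases rule: char_cases)
    case 1
    have "\<exists>f. \<forall>n::nat. noncentral K (f n) \<and> cent K {f n} \<subset> cent K {f (Suc n)}"
      by (rule dependent_nat_choice[where Q = "\<lambda>_ x y. cent K {x} \<subset> cent K {y}"])
        (use a larger_centralizer[OF K] big 1 in auto)
    then obtain f :: "nat \<Rightarrow> 'm" where "\<And>n. noncentral K (f n)" "\<And>n. cent K {f n} \<subset> cent K {f (Suc n)}" by blast
    then show False using no_cent_chain[OF K(1,2), of f] by (auto simp: noncentral_def)
  next
    case (2 p)
    show False
      by (rule char_p_case[OF K _ _ _ 2(1,2)]) (use a big in \<open>auto simp: noncentral_def\<close>)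
  qed
qed

end

section \<open>Finite dimension over the center\<close>

context skew_field
begin

lemma lspan_rmult:
  assumes "set us \<subseteq> carrier R" "E \<subseteq> carrier R" "w \<in> lspan E us" "c \<in> carrier R"
  shows "w \<otimes> c \<in> lspan E (map (\<lambda>u. u \<otimes> c) us)"
  using assms
proof (induction us arbitrary: w)
  case (Cons u us)
  then obtain e w' where w: "w = e \<otimes> u \<oplus> w'" "e \<in> E" "w' \<in> lspan E us" by auto
  have "lspan E us \<subseteq> carrier R"
    by (rule lspan_least) (use Cons.prems(1,2) in \<open>auto simp: lsub_def addsub_def\<close>)
  then have "u \<in> carrier R" "c \<in> carrier R" "e \<in> carrier R" "w' \<in> carrier R"
    using Cons.prems w(2,3) by auto
  then have "w \<otimes> c = e \<otimes> (u \<otimes> c) \<oplus> w' \<otimes> c" unfolding w by algebra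
  then show ?case using Cons w by auto
qed simp

text \<open>Products of generators, as for towers of fields. Scalars stand on the left, so the
  generators of \<open>F\<close> over \<open>E\<close> multiply those of \<open>K\<close> over
  \<open>F\<close> from the left.\<close>

lemma finspan_trans:
  assumes E: "divsub E" and F: "divsub F" and K: "divsub K" "F \<subseteq> K"
    and EF: "finspan E F" and FK: "finspan F K" "E \<subseteq> F"
  shows "finspan E K"
proof -
  obtain vs where vs: "set vs \<subseteq> F" "F \<subseteq> lspan E vs" using EF unfolding finspan_def by blast
  obtain ws where ws: "set ws \<subseteq> K" "K \<subseteq> lspan F ws" using FK unfolding finspan_def by blast
  note KD = divsubD[OF K(1)]
  define us where "us = concat (map (\<lambda>w. map (\<lambda>v. v \<otimes> w) vs) ws)"
  have us: "set us \<subseteq> K"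
  proof
    fix u assume "u \<in> set us"
    then obtain v w where "v \<in> set vs" "w \<in> set ws" "u = v \<otimes> w" by (auto simp: us_def)
    then show "u \<in> K" using KD(8)[of v w] vs(1) ws(1) K(2) by blast
  qed
  then have usc: "set us \<subseteq> carrier R" using KD(2) by blast
  have vc: "set vs \<subseteq> carrier R" using vs(1) divsubD(2)[OF F] by blast
  have Ec: "E \<subseteq> carrier R" using divsubD(2)[OF E] by blast
  have "lspan F ws' \<subseteq> lspan E us" if "set ws' \<subseteq> set ws" for ws'
    using that
  proof (induction ws')
    case Nil
    show ?case using lsubD(3)[OF lsub_lspan[OF E usc]] by simp
  next
    case (Cons w ws')
    show ?case
    proof
      fix x assume "x \<in> lspan F (w # ws')"
      then obtain f r where x: "x = f \<otimes> w \<oplus> r" "f \<in> F" "r \<in> lspan F ws'" by auto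
      have wc: "w \<in> carrier R" using Cons.prems ws(1) KD(2) by auto
      have "f \<otimes> w \<in> lspan E (map (\<lambda>v. v \<otimes> w) vs)"
        by (rule lspan_rmult[OF vc Ec _ wc]) (use vs(2) x(2) in blast)
      moreover have "lspan E (map (\<lambda>v. v \<otimes> w) vs) \<subseteq> lspan E us"
        by (rule lspan_mono[OF E _ usc]) (use Cons.prems in \<open>auto simp: us_def\<close>)
      ultimately have "f \<otimes> w \<in> lspan E us" by blast
      moreover have "r \<in> lspan E us" using Cons x(3) by auto
      ultimately show "x \<in> lspan E us" unfolding x(1) by (rule lsubD(5)[OF lsub_lspan[OF E usc]])
    qed
  qed
  then show ?thesis using us ws(2) unfolding finspan_def by blast
qed

lemma lspan_psum:
  assumes "divsub E" "set vs \<subseteq> carrier R" "x \<in> lspan E vs"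
  shows "\<exists>f. (\<forall>i. f i \<in> E) \<and> x = psum (\<lambda>i. f i \<otimes> vs ! i) (length vs)"
  using assms(2,3)
proof (induction vs arbitrary: x)
  case Nil then show ?case using divsubD(3)[OF assms(1)] by (auto intro: exI[of _ "\<lambda>_. \<zero>"])
next
  case (Cons v vs)
  obtain e w where x: "x = e \<otimes> v \<oplus> w" "e \<in> E" "w \<in> lspan E vs" using Cons.prems(2) by auto
  then obtain f where f: "\<forall>i. f i \<in> E" "w = psum (\<lambda>i. f i \<otimes> vs ! i) (length vs)"
    using Cons.IH[of w] Cons.prems(1) by auto
  define f' where "f' i = (case i of 0 \<Rightarrow> e | Suc j \<Rightarrow> f j)" for i
  have f': "f' i \<in> E" for i using f(1) x(2) by (simp add: f'_def split: nat.split)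
  have "psum (\<lambda>i. f' i \<otimes> (v # vs) ! i) (Suc (length vs)) = f' 0 \<otimes> (v # vs) ! 0 \<oplus> psum (\<lambda>i. f' (Suc i) \<otimes> (v # vs) ! Suc i) (length vs)"
  proof (rule psum_shift)
    fix i assume "i < Suc (length vs)"
    then have "(v # vs) ! i \<in> carrier R" using Cons.prems(1) nth_mem[of i "v # vs"] by auto
    then show "f' i \<otimes> (v # vs) ! i \<in> carrier R" using divsubD(2)[OF assms(1) f'] by simp
  qed
  also have "\<dots> = x" by (simp add: f'_def x f(2))
  finally show ?case using f' by (intro exI[of _ f']) simp
qed

text \<open>If a relation has smallest support and one of its coefficients is 1, then its commutator
  with any \<open>t\<close> is a relation with smaller support, so that the coefficients are central.\<close>

lemma central_coefficients:
  assumes f: "\<And>i. f i \<in> carrier R" "\<exists>i < n. f i \<noteq> \<zero>" and x: "\<And>i. i < n \<Longrightarrow> x i \<in> carrier R"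
    and id: "\<And>y. y \<in> carrier R \<Longrightarrow> psum (\<lambda>i. f i \<otimes> y \<otimes> x i) n = \<zero>"
  shows "\<not> lin_indep (ring_center R) x n"
proof -
  define P where "P f \<longleftrightarrow> (\<forall>i. f i \<in> carrier R) \<and> (\<exists>i < n. f i \<noteq> \<zero>) \<and>
    (\<forall>y \<in> carrier R. psum (\<lambda>i. f i \<otimes> y \<otimes> x i) n = \<zero>)" for f
  define s where "s f = card {i. i < n \<and> f i \<noteq> \<zero>}" for f :: "nat \<Rightarrow> 'a"
  have "P f" using f id by (auto simp: P_def)
  then obtain f0 where f0: "P f0" "\<And>g. P g \<Longrightarrow> s f0 \<le> s g" using ex_has_least_nat[of P f s] by blast
  have f0c: "f0 i \<in> carrier R" for i using f0(1) by (simp add: P_def)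
  obtain i0 where i0: "i0 < n" "f0 i0 \<noteq> \<zero>" using f0(1) by (auto simp: P_def)
  define q where "q = inv (f0 i0)"
  have q: "q \<in> carrier R" "q \<otimes> f0 i0 = \<one>" "q \<noteq> \<zero>" unfolding q_def using inv_props[OF f0c i0(2)] by auto
  define h where "h i = q \<otimes> f0 i" for i
  have hc: "h i \<in> carrier R" for i using q f0c by (simp add: h_def)
  have hn: "h i = \<zero> \<longleftrightarrow> f0 i = \<zero>" for i unfolding h_def using nz_mult[OF q(1) f0c] q(3) by simp
  have h1: "h i0 = \<one>" using q by (simp add: h_def)
  have hid: "psum (\<lambda>i. h i \<otimes> y \<otimes> x i) n = \<zero>" if y: "y \<in> carrier R" for y
  proof -
    have "psum (\<lambda>i. h i \<otimes> y \<otimes> x i) n = psum (\<lambda>i. q \<otimes> (f0 i \<otimes> y \<otimes> x i)) n"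
      by (rule psum_cong) (simp add: h_def q f0c x y m_assoc)
    also have "\<dots> = q \<otimes> psum (\<lambda>i. f0 i \<otimes> y \<otimes> x i) n"
      by (rule psum_lmult) (simp_all add: q f0c x y)
    also have "\<dots> = \<zero>" using f0(1) y q by (simp add: P_def)
    finally show ?thesis .
  qed
  have comm: "h i \<otimes> t = t \<otimes> h i" if t: "t \<in> carrier R" and i: "i < n" for t i
  proof (rule ccontr)
    assume ne: "h i \<otimes> t \<noteq> t \<otimes> h i"
    define k where "k i = h i \<otimes> t \<ominus> t \<otimes> h i" for i
    have kc: "k i \<in> carrier R" for i using hc t by (simp add: k_def)
    have "psum (\<lambda>i. k i \<otimes> y \<otimes> x i) n = \<zero>" if y: "y \<in> carrier R" for y
    proof -
      have "psum (\<lambda>i. k i \<otimes> y \<otimes> x i) n = psum (\<lambda>i. h i \<otimes> (t \<otimes> y) \<otimes> x i \<ominus> t \<otimes> (h i \<otimes> y \<otimes> x i)) n"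
      proof (rule psum_cong)
        fix i assume "i < n"
        then show "k i \<otimes> y \<otimes> x i = h i \<otimes> (t \<otimes> y) \<otimes> x i \<ominus> t \<otimes> (h i \<otimes> y \<otimes> x i)"
          unfolding k_def using hc[of i] t y x[of i] by algebra
      qed
      also have "\<dots> = psum (\<lambda>i. h i \<otimes> (t \<otimes> y) \<otimes> x i) n \<ominus> psum (\<lambda>i. t \<otimes> (h i \<otimes> y \<otimes> x i)) n"
        by (rule psum_diff) (simp_all add: hc t y x)
      also have "psum (\<lambda>i. t \<otimes> (h i \<otimes> y \<otimes> x i)) n = t \<otimes> psum (\<lambda>i. h i \<otimes> y \<otimes> x i) n"
        by (rule psum_lmult) (simp_all add: hc t y x)
      also have "psum (\<lambda>i. h i \<otimes> (t \<otimes> y) \<otimes> x i) n \<ominus> t \<otimes> psum (\<lambda>i. h i \<otimes> y \<otimes> x i) n = \<zero>"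
        unfolding hid[OF y] hid[OF m_closed[OF t y]] using t by (simp add: a_minus_def)
      finally show ?thesis .
    qed
    moreover have "k i \<noteq> \<zero>" using ne hc t diff_zero[of "h i \<otimes> t" "t \<otimes> h i"] by (simp add: k_def)
    ultimately have "P k" using kc i by (auto simp: P_def)
    then have "s f0 \<le> s k" by (rule f0(2))
    moreover have "{i. i < n \<and> k i \<noteq> \<zero>} \<subset> {i. i < n \<and> f0 i \<noteq> \<zero>}"
    proof -
      have "k i = \<zero>" if "f0 i = \<zero>" for i
        using hn[of i] that t by (simp add: k_def a_minus_def)
      moreover have "k i0 = \<zero>" using h1 t by (simp add: k_def diff_zero)
      ultimately show ?thesis using i0 by blast
    qed
    then have "s k < s f0" unfolding s_def by (intro psubset_card_mono) auto
    ultimately show False by simp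
  qed
  have hZ: "h i \<in> ring_center R" if "i < n" for i
    unfolding ring_center_def using hc comm[OF _ that] by blast
  have "psum (\<lambda>i. h i \<otimes> x i) n = psum (\<lambda>i. h i \<otimes> \<one> \<otimes> x i) n"
    by (rule psum_cong) (simp add: hc)
  then have "psum (\<lambda>i. h i \<otimes> x i) n = \<zero>" using hid[OF one_closed] by simp
  then show ?thesis using lin_indepD[of "ring_center R" x n h i0] hZ i0(1) h1 one_nz by auto
qed

text \<open>Over a commutative \<open>E\<close> the right multiplications by \<open>x\<^sub>i\<close> are matrices of size
  \<open>length vs\<close>. More than \<open>(length vs)\<^sup>2\<close> of them are linearly dependent.\<close>

lemma dependent_over_center:
  assumes E: "divsub E" "\<And>a b. a \<in> E \<Longrightarrow> b \<in> E \<Longrightarrow> a \<otimes> b = b \<otimes> a"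
    and vs: "set vs \<subseteq> carrier R" "carrier R \<subseteq> lspan E vs"
    and n: "n > length vs * length vs" and x: "\<And>i. i < n \<Longrightarrow> x i \<in> carrier R"
  shows "\<not> lin_indep (ring_center R) x n"
proof -
  define m where "m = length vs"
  define v where "v j = vs ! j" for j
  have v: "v j \<in> carrier R" if "j < m" for j using vs(1) nth_mem that by (auto simp: v_def m_def)
  have coord: "\<exists>f. (\<forall>i. f i \<in> E) \<and> y = psum (\<lambda>i. f i \<otimes> v i) m" if "y \<in> carrier R" for y
    using lspan_psum[OF E(1) vs(1)] vs(2) that unfolding m_def v_def by blast
  have "\<exists>f. (\<forall>j. f j \<in> E) \<and> (i < n \<and> k < m \<longrightarrow> v k \<otimes> x i = psum (\<lambda>j. f j \<otimes> v j) m)" for i k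
    using coord[of "v k \<otimes> x i"] v[of k] x[of i] divsubD(3)[OF E(1)]
    by (cases "i < n \<and> k < m") (auto intro: exI[of _ "\<lambda>_. \<zero>"])
  then obtain a where a: "\<And>i k j. a i k j \<in> E"
    "\<And>i k. i < n \<Longrightarrow> k < m \<Longrightarrow> v k \<otimes> x i = psum (\<lambda>j. a i k j \<otimes> v j) m"
    by metis
  \<comment> \<open>One equation for each matrix entry \<open>(k, j)\<close>, that is
    \<open>m * m\<close> equations in \<open>n\<close> unknowns.\<close>
  have "\<exists>e. (\<forall>i. e i \<in> E) \<and> (\<exists>i \<in> {..<n}. e i \<noteq> \<zero>) \<and>
    (\<forall>kj \<in> {..<m} \<times> {..<m}. (\<Oplus>i \<in> {..<n}. e i \<otimes> a i (fst kj) (snd kj)) = \<zero>)"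
    by (rule homogeneous_system[OF E(1)]) (use n a(1) in \<open>simp_all add: m_def\<close>)
  then obtain e where e: "\<And>i. e i \<in> E" "\<exists>i < n. e i \<noteq> \<zero>"
    and e0: "\<And>k j. k < m \<Longrightarrow> j < m \<Longrightarrow> (\<Oplus>i \<in> {..<n}. e i \<otimes> a i k j) = \<zero>" by force
  have c: "e i \<in> carrier R" "a i k j \<in> carrier R" for i k j using divsubD(2)[OF E(1)] e(1) a(1) by auto
  have vk: "psum (\<lambda>i. e i \<otimes> (v k \<otimes> x i)) n = \<zero>" if k: "k < m" for k
  proof -
    have "psum (\<lambda>i. e i \<otimes> (v k \<otimes> x i)) n = psum (\<lambda>i. psum (\<lambda>j. e i \<otimes> a i k j \<otimes> v j) m) n"
    proof (rule psum_cong)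
      fix i assume i: "i < n"
      have "e i \<otimes> (v k \<otimes> x i) = psum (\<lambda>j. e i \<otimes> (a i k j \<otimes> v j)) m"
        unfolding a(2)[OF i k] by (rule psum_lmult[symmetric]) (simp_all add: c v)
      also have "\<dots> = psum (\<lambda>j. e i \<otimes> a i k j \<otimes> v j) m"
        by (rule psum_cong) (simp add: c v m_assoc)
      finally show "e i \<otimes> (v k \<otimes> x i) = psum (\<lambda>j. e i \<otimes> a i k j \<otimes> v j) m" .
    qed
    also have "\<dots> = psum (\<lambda>j. psum (\<lambda>i. e i \<otimes> a i k j \<otimes> v j) n) m"
      by (rule psum_swap) (simp add: c v)
    also have "\<dots> = psum (\<lambda>j. \<zero>) m"
    proof (rule psum_cong)
      fix j assume j: "j < m"
      have "psum (\<lambda>i. e i \<otimes> a i k j \<otimes> v j) n = psum (\<lambda>i. e i \<otimes> a i k j) n \<otimes> v j"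
        by (rule psum_rmult) (simp_all add: c v[OF j])
      also have "psum (\<lambda>i. e i \<otimes> a i k j) n = \<zero>"
        using psum_finsum[of n "\<lambda>i. e i \<otimes> a i k j"] e0[OF k j] c by simp
      finally show "psum (\<lambda>i. e i \<otimes> a i k j \<otimes> v j) n = \<zero>" using v[OF j] by simp
    qed
    finally show ?thesis by (simp only: psum_zero)
  qed
  show ?thesis
  proof (rule central_coefficients[OF c(1) e(2) x])
    fix y assume "y \<in> carrier R"
    then obtain f where f: "\<And>i. f i \<in> E" "y = psum (\<lambda>i. f i \<otimes> v i) m" using coord by blast
    have fc: "f i \<in> carrier R" for i by (rule divsubD(2)[OF E(1) f(1)])
    \<comment> \<open>Commutativity of \<open>E\<close> lets the coordinate \<open>f k\<close> pass
      \<open>e i\<close>, which extends the relation from the spanning vectors to all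
      \<open>y\<close>.\<close>
    have "psum (\<lambda>i. e i \<otimes> y \<otimes> x i) n = psum (\<lambda>i. psum (\<lambda>k. f k \<otimes> (e i \<otimes> (v k \<otimes> x i))) m) n"
    proof (rule psum_cong)
      fix i assume i: "i < n"
      have "e i \<otimes> y \<otimes> x i = psum (\<lambda>k. e i \<otimes> (f k \<otimes> v k)) m \<otimes> x i"
        unfolding f(2) by (subst psum_lmult) (simp_all add: fc v c)
      also have "\<dots> = psum (\<lambda>k. e i \<otimes> (f k \<otimes> v k) \<otimes> x i) m"
        by (rule psum_rmult[symmetric]) (simp_all add: fc v c x i)
      also have "\<dots> = psum (\<lambda>k. f k \<otimes> (e i \<otimes> (v k \<otimes> x i))) m"
      proof (rule psum_cong)
        fix k assume k: "k < m"
        have "e i \<otimes> (f k \<otimes> v k) \<otimes> x i = (e i \<otimes> f k) \<otimes> (v k \<otimes> x i)"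
          by (simp add: fc v c x i k m_assoc)
        also have "\<dots> = f k \<otimes> (e i \<otimes> (v k \<otimes> x i))"
          unfolding E(2)[OF e(1) f(1)] by (simp add: fc v c x i k m_assoc)
        finally show "e i \<otimes> (f k \<otimes> v k) \<otimes> x i = f k \<otimes> (e i \<otimes> (v k \<otimes> x i))" .
      qed
      finally show "e i \<otimes> y \<otimes> x i = psum (\<lambda>k. f k \<otimes> (e i \<otimes> (v k \<otimes> x i))) m" .
    qed
    also have "\<dots> = psum (\<lambda>k. psum (\<lambda>i. f k \<otimes> (e i \<otimes> (v k \<otimes> x i))) n) m"
      by (rule psum_swap) (simp add: fc v c x)
    also have "\<dots> = psum (\<lambda>k. \<zero>) m"
    proof (rule psum_cong)
      fix k assume k: "k < m"
      have "psum (\<lambda>i. f k \<otimes> (e i \<otimes> (v k \<otimes> x i))) n = f k \<otimes> psum (\<lambda>i. e i \<otimes> (v k \<otimes> x i)) n"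
        by (rule psum_lmult) (simp_all add: fc v[OF k] c x)
      then show "psum (\<lambda>i. f k \<otimes> (e i \<otimes> (v k \<otimes> x i))) n = \<zero>" using vk[OF k] fc by simp
    qed
    finally show "psum (\<lambda>i. e i \<otimes> y \<otimes> x i) n = \<zero>" by (simp only: psum_zero)
  qed
qed

end

section \<open>Descent to a commutative division subring\<close>

context super_skew
begin

text \<open>As long as the division ring reached is noncommutative, it is replaced by a proper
  centralizer over which it is finitely generated. Each ring is a left space over the next, so the
  chain condition for vector spaces ends the descent.\<close>

lemma finspan_over_commutative:
  "\<exists>E. divsub E \<and> (\<forall>a \<in> E. \<forall>b \<in> E. a \<otimes> b = b \<otimes> a) \<and> finspan E (carrier M)"
proof (cases "finite (carrier M)")
  case True
  \<comment> \<open>For a finite structure the center serves, with all elements as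
    generators.\<close>
  define E where "E = cent (carrier M) (carrier M)"
  have E: "divsub E" unfolding E_def by (intro divsub_cent divsub_carrier) auto
  obtain vs where vs: "set vs = carrier M" using finite_list[OF True] by blast
  then have "finspan E (carrier M)" unfolding finspan_def using lspan_set[OF E, of vs] by blast
  moreover have "a \<otimes> b = b \<otimes> a" if "a \<in> E" "b \<in> E" for a b
    using that unfolding E_def cent_def by blast
  ultimately show ?thesis using E by blast
next
  case False
  show ?thesis
  proof (rule ccontr)
    assume no: "\<not> ?thesis"
    define good where "good K \<longleftrightarrow> divsub K \<and> dset M K \<and> infinite K \<and> finspan K (carrier M)" for K
    have "finspan (carrier M) (carrier M)"
    proof -
      have "x \<in> lspan (carrier M) [\<one>]" if "x \<in> carrier M" for x
      proof -
        have "x = x \<otimes> \<one> \<oplus> \<zero>" using that by simp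
        moreover have "\<zero> \<in> lspan (carrier M) []" by simp
        ultimately show ?thesis unfolding lspan.simps(2) using that by blast
      qed
      then show ?thesis unfolding finspan_def by (intro exI[of _ "[\<one>]"]) auto
    qed
    then have g0: "good (carrier M)" using divsub_carrier dset_carrier False by (simp add: good_def)
    have step: "\<exists>K'. good K' \<and> K' \<subset> K" if K: "good K" for K
    proof -
      note K = K[unfolded good_def]
      obtain a a' where "a \<in> K" "a' \<in> K" "a \<otimes> a' \<noteq> a' \<otimes> a" using no K by blast
      then have "\<exists>a. noncentral K a" unfolding noncentral_iff cent_def by fastforce
      then obtain b where b: "noncentral K b" "finspan (cent K {b}) K"
        using finspan_over_centralizer K by blast
      have bK: "b \<in> K" and bc: "b \<in> carrier M" using b(1) divsubD(2)[of K b] K by (auto simp: noncentral_def)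
      have V: "divsub (cent K {b})" using K bc by (intro divsub_cent) auto
      have "good (cent K {b})" unfolding good_def
      proof (intro conjI V)
        show "dset M (cent K {b})" using K bc by (intro dset_cent dset_sing) auto
        show "infinite (cent K {b})" using K bK by (intro infinite_cent) auto
        show "finspan (cent K {b}) (carrier M)"
          by (rule finspan_trans[OF V _ divsub_carrier _ b(2)]) (use K divsubD(2)[of K] cent_sub in auto)
      qed
      moreover have "cent K {b} \<subset> K" using b(1) cent_sub[of K "{b}"] by (auto simp: noncentral_def)
      ultimately show ?thesis by blast
    qed
    have "\<exists>f. \<forall>n::nat. good (f n) \<and> f (Suc n) \<subset> f n"
      by (rule dependent_nat_choice[where Q = "\<lambda>_ x y. y \<subset> x"]) (use g0 step in blast)+
    then obtain f :: "nat \<Rightarrow> 'm set" where f: "\<And>n. good (f n)" "\<And>n. f (Suc n) \<subset> f n" by blast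
    have "\<exists>n. f (Suc n) = f n"
    proof (rule vec_chain_var[of "\<lambda>n. f (Suc n)"])
      show "lsub (f (Suc n)) (f n)" "lsub (f (Suc n)) (f (Suc n))" for n
        using f(1)[of n] f(1)[of "Suc n"] f(2)[of n] by (auto simp: good_def intro!: lsub_divsub)
    qed (use f in \<open>auto simp: good_def\<close>)
    then show False using f(2) by blast
  qed
qed

lemma bounded_independence:
  obtains n where "\<And>x. (\<And>i. i < n \<Longrightarrow> x i \<in> carrier M) \<Longrightarrow> \<not> lin_indep (ring_center M) x n"
proof -
  obtain E vs where "divsub E" "\<And>a b. a \<in> E \<Longrightarrow> b \<in> E \<Longrightarrow> a \<otimes> b = b \<otimes> a"
    "set vs \<subseteq> carrier M" "carrier M \<subseteq> lspan E vs"
    using finspan_over_commutative unfolding finspan_def by blast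
  then show ?thesis using that[of "Suc (length vs * length vs)"] dependent_over_center by blast
qed

end

section \<open>Transfer to the given division ring\<close>

abbreviation All :: "nat \<Rightarrow> rform \<Rightarrow> rform" where
  "All i \<phi> \<equiv> Neg (Exists i (Neg \<phi>))"

abbreviation Or :: "rform \<Rightarrow> rform \<Rightarrow> rform" where
  "Or \<phi> \<psi> \<equiv> Neg (And (Neg \<phi>) (Neg \<psi>))"

primrec exists_block :: "nat \<Rightarrow> nat \<Rightarrow> rform \<Rightarrow> rform" where
  "exists_block m 0 \<phi> = \<phi>"
| "exists_block m (Suc n) \<phi> = Exists (m + n) (exists_block m n \<phi>)"

primrec conjunction :: "(nat \<Rightarrow> rform) \<Rightarrow> nat \<Rightarrow> rform" where
  "conjunction f 0 = Equal Zero Zero"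
| "conjunction f (Suc n) = And (conjunction f n) (f n)"

primrec term_sum :: "(nat \<Rightarrow> rterm) \<Rightarrow> nat \<Rightarrow> rterm" where
  "term_sum f 0 = Zero"
| "term_sum f (Suc n) = Add (term_sum f n) (f n)"

lemma fvars_exists_block: "fvars (exists_block m n \<phi>) = fvars \<phi> - {m..<m + n}"
proof (induction n)
  case (Suc n)
  have eq: "{m..<m + Suc n} = Set.insert (m + n) {m..<m + n}" by (simp add: atLeastLessThanSuc)
  show ?case unfolding exists_block.simps fvars.simps Suc eq by blast
qed simp

lemma fvars_conjunction: "fvars (conjunction f n) = (\<Union>i < n. fvars (f i))"
  by (induction n) (auto simp: less_Suc_eq)

lemma tvars_term_sum: "tvars (term_sum f n) = (\<Union>i < n. tvars (f i))"
  by (induction n) (auto simp: less_Suc_eq)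

lemma sat_conjunction: "sat M v (conjunction f n) \<longleftrightarrow> (\<forall>i < n. sat M v (f i))"
  by (induction n) (auto simp: less_Suc_eq)

lemma sat_exists_block:
  "sat M v (exists_block m n \<phi>) \<longleftrightarrow>
    (\<exists>w. (\<forall>i < n. w i \<in> carrier M) \<and> sat M (\<lambda>i. if m \<le> i \<and> i < m + n then w (i - m) else v i) \<phi>)"
proof (induction n arbitrary: v)
  case 0
  have "(\<lambda>i. if m \<le> i \<and> i < m + 0 then w (i - m) else v i) = v" for w :: "nat \<Rightarrow> 'a" by (rule ext) auto
  then show ?case by simp
next
  case (Suc n)
  have eq: "(\<lambda>i. if m \<le> i \<and> i < m + n then w (i - m) else (v(m + n := w n)) i) =
    (\<lambda>i. if m \<le> i \<and> i < m + Suc n then w (i - m) else v i)" for w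
    by (rule ext) auto
  show ?case
  proof
    assume "sat M v (exists_block m (Suc n) \<phi>)"
    then obtain a w where a: "a \<in> carrier M" "\<forall>i < n. w i \<in> carrier M"
      "sat M (\<lambda>i. if m \<le> i \<and> i < m + n then w (i - m) else (v(m + n := a)) i) \<phi>"
      by (auto simp: Suc)
    have "(\<lambda>i. if m \<le> i \<and> i < m + n then w (i - m) else (v(m + n := a)) i) =
      (\<lambda>i. if m \<le> i \<and> i < m + Suc n then (w(n := a)) (i - m) else v i)"
      by (rule ext) auto
    then show "\<exists>w. (\<forall>i < Suc n. w i \<in> carrier M) \<and> sat M (\<lambda>i. if m \<le> i \<and> i < m + Suc n then w (i - m) else v i) \<phi>"
      using a by (intro exI[of _ "w(n := a)"]) (simp add: less_Suc_eq)
  next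
    assume "\<exists>w. (\<forall>i < Suc n. w i \<in> carrier M) \<and> sat M (\<lambda>i. if m \<le> i \<and> i < m + Suc n then w (i - m) else v i) \<phi>"
    then obtain w where w: "\<forall>i < Suc n. w i \<in> carrier M"
      "sat M (\<lambda>i. if m \<le> i \<and> i < m + Suc n then w (i - m) else v i) \<phi>" by blast
    have "sat M (v(m + n := w n)) (exists_block m n \<phi>)"
      unfolding Suc by (rule exI[of _ w]) (use w eq[of w] in simp)
    then show "sat M v (exists_block m (Suc n) \<phi>)" using w(1) by auto
  qed
qed

lemma (in ring) teval_term_sum: "teval R v (term_sum f n) = psum (\<lambda>i. teval R v (f i)) n"
  by (induction n) auto

text \<open>The theory of \<open>D\<close> contains the negation of every sentence that fails in
  \<open>D\<close>, so the inclusion of theories gives both directions.\<close>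

lemma model_sat:
  assumes "is_model M (ring_theory D)" "fvars \<phi> = {}"
  shows "sat M (\<lambda>_. \<zero>\<^bsub>M\<^esub>) \<phi> \<longleftrightarrow> sat D (\<lambda>_. \<zero>\<^bsub>D\<^esub>) \<phi>"
proof (cases "sat D (\<lambda>_. \<zero>\<^bsub>D\<^esub>) \<phi>")
  case True
  then have "\<phi> \<in> ring_theory D" using assms(2) by (simp add: ring_theory_def)
  then have "\<phi> \<in> ring_theory M" using assms(1) by (auto simp: is_model_def)
  then show ?thesis using True by (simp add: ring_theory_def)
next
  case False
  then have "Neg \<phi> \<in> ring_theory D" using assms(2) by (simp add: ring_theory_def)
  then have "Neg \<phi> \<in> ring_theory M" using assms(1) by (auto simp: is_model_def)
  then show ?thesis using False by (simp add: ring_theory_def)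
qed

text \<open>Division rings are axiomatized by finitely many sentences.\<close>

lemma skew_field_model:
  assumes D: "skew_field D" and M: "is_model M (ring_theory D)"
  shows "skew_field M"
proof -
  interpret D: skew_field D by (rule D)
  have L: "\<zero>\<^bsub>M\<^esub> \<in> carrier M" "\<one>\<^bsub>M\<^esub> \<in> carrier M"
    "\<And>x y. x \<in> carrier M \<Longrightarrow> y \<in> carrier M \<Longrightarrow> x \<oplus>\<^bsub>M\<^esub> y \<in> carrier M"
    "\<And>x y. x \<in> carrier M \<Longrightarrow> y \<in> carrier M \<Longrightarrow> x \<otimes>\<^bsub>M\<^esub> y \<in> carrier M"
    using M by (auto simp: is_model_def ring_language_structure_def)
  let ?x = "Var 0" and ?y = "Var 1" and ?z = "Var 2"
  have "\<forall>x \<in> carrier M. \<forall>y \<in> carrier M. \<forall>z \<in> carrier M. (x \<oplus>\<^bsub>M\<^esub> y) \<oplus>\<^bsub>M\<^esub> z = x \<oplus>\<^bsub>M\<^esub> (y \<oplus>\<^bsub>M\<^esub> z)"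
    using model_sat[OF M, of "All 0 (All 1 (All 2 (Equal (Add (Add ?x ?y) ?z) (Add ?x (Add ?y ?z)))))"]
    by (auto simp: D.a_assoc)
  moreover have "\<forall>x \<in> carrier M. \<forall>y \<in> carrier M. x \<oplus>\<^bsub>M\<^esub> y = y \<oplus>\<^bsub>M\<^esub> x"
    using model_sat[OF M, of "All 0 (All 1 (Equal (Add ?x ?y) (Add ?y ?x)))"]
    by (auto simp: D.a_comm)
  moreover have "\<forall>x \<in> carrier M. \<zero>\<^bsub>M\<^esub> \<oplus>\<^bsub>M\<^esub> x = x"
    using model_sat[OF M, of "All 0 (Equal (Add Zero ?x) ?x)"] by auto
  moreover have "\<forall>x \<in> carrier M. \<exists>y \<in> carrier M. y \<oplus>\<^bsub>M\<^esub> x = \<zero>\<^bsub>M\<^esub>"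
    using model_sat[OF M, of "All 0 (Exists 1 (Equal (Add ?y ?x) Zero))"]
    by (auto intro!: D.add.l_inv_ex)
  ultimately have ag: "abelian_group M" using L by (intro abelian_groupI) blast+
  have "\<forall>x \<in> carrier M. \<forall>y \<in> carrier M. \<forall>z \<in> carrier M. (x \<otimes>\<^bsub>M\<^esub> y) \<otimes>\<^bsub>M\<^esub> z = x \<otimes>\<^bsub>M\<^esub> (y \<otimes>\<^bsub>M\<^esub> z)"
    using model_sat[OF M, of "All 0 (All 1 (All 2 (Equal (Mult (Mult ?x ?y) ?z) (Mult ?x (Mult ?y ?z)))))"]
    by (auto simp: D.m_assoc)
  moreover have "\<forall>x \<in> carrier M. \<one>\<^bsub>M\<^esub> \<otimes>\<^bsub>M\<^esub> x = x"
    using model_sat[OF M, of "All 0 (Equal (Mult One ?x) ?x)"] by auto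
  moreover have "\<forall>x \<in> carrier M. x \<otimes>\<^bsub>M\<^esub> \<one>\<^bsub>M\<^esub> = x"
    using model_sat[OF M, of "All 0 (Equal (Mult ?x One) ?x)"] by auto
  ultimately have mo: "Group.monoid M" using L by (intro Group.monoidI) blast+
  have d1: "\<forall>x \<in> carrier M. \<forall>y \<in> carrier M. \<forall>z \<in> carrier M. (x \<oplus>\<^bsub>M\<^esub> y) \<otimes>\<^bsub>M\<^esub> z = x \<otimes>\<^bsub>M\<^esub> z \<oplus>\<^bsub>M\<^esub> y \<otimes>\<^bsub>M\<^esub> z"
    using model_sat[OF M, of "All 0 (All 1 (All 2 (Equal (Mult (Add ?x ?y) ?z) (Add (Mult ?x ?z) (Mult ?y ?z)))))"]
    by (auto simp: D.l_distr)
  have d2: "\<forall>x \<in> carrier M. \<forall>y \<in> carrier M. \<forall>z \<in> carrier M. z \<otimes>\<^bsub>M\<^esub> (x \<oplus>\<^bsub>M\<^esub> y) = z \<otimes>\<^bsub>M\<^esub> x \<oplus>\<^bsub>M\<^esub> z \<otimes>\<^bsub>M\<^esub> y"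
    using model_sat[OF M, of "All 0 (All 1 (All 2 (Equal (Mult ?z (Add ?x ?y)) (Add (Mult ?z ?x) (Mult ?z ?y)))))"]
    by (auto simp: D.r_distr)
  interpret M: ring M by (intro ringI ag mo) (use d1 d2 in blast)+
  have ne: "\<one>\<^bsub>M\<^esub> \<noteq> \<zero>\<^bsub>M\<^esub>"
    using model_sat[OF M, of "Neg (Equal One Zero)"] D.one_nz by simp
  have "x = \<zero>\<^bsub>D\<^esub> \<or> (\<exists>y \<in> carrier D. y \<otimes>\<^bsub>D\<^esub> x = \<one>\<^bsub>D\<^esub> \<and> x \<otimes>\<^bsub>D\<^esub> y = \<one>\<^bsub>D\<^esub>)"
    if "x \<in> carrier D" for x
    using D.inv_props[OF that] by blast
  then have "\<forall>x \<in> carrier M. x = \<zero>\<^bsub>M\<^esub> \<or> (\<exists>y \<in> carrier M. y \<otimes>\<^bsub>M\<^esub> x = \<one>\<^bsub>M\<^esub> \<and> x \<otimes>\<^bsub>M\<^esub> y = \<one>\<^bsub>M\<^esub>)"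
    using model_sat[OF M, of "All 0 (Or (Equal ?x Zero) (Exists 1 (And (Equal (Mult ?y ?x) One) (Equal (Mult ?x ?y) One))))"]
    by auto
  then have "Units M = carrier M - {\<zero>\<^bsub>M\<^esub>}" using ne by (auto simp: Units_def)
  then show ?thesis by unfold_locales
qed

text \<open>Variables below \<open>n\<close> hold the family, those from \<open>n\<close> to
  \<open>2 * n - 1\<close> the coefficients of a relation, and \<open>2 * n\<close> an arbitrary
  element with which each coefficient has to commute; this expresses centrality in the language of
  rings.\<close>

definition dependent_sentence :: "nat \<Rightarrow> rform" where
  "dependent_sentence n = Neg (exists_block 0 n (Neg (exists_block n n
     (And (conjunction (\<lambda>i. All (2 * n) (Equal (Mult (Var (n + i)) (Var (2 * n))) (Mult (Var (2 * n)) (Var (n + i))))) n)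
     (And (Neg (conjunction (\<lambda>i. Equal (Var (n + i)) Zero) n))
       (Equal (term_sum (\<lambda>i. Mult (Var (n + i)) (Var i)) n) Zero))))))"

lemma fvars_dependent_sentence: "fvars (dependent_sentence n) = {}"
  by (auto simp: dependent_sentence_def fvars_exists_block fvars_conjunction tvars_term_sum)

lemma (in skew_field) sat_dependent_sentence:
  "sat R (\<lambda>_. \<zero>) (dependent_sentence n) \<longleftrightarrow>
    (\<forall>x. (\<forall>i < n. x i \<in> carrier R) \<longrightarrow> \<not> lin_indep (ring_center R) x n)"
proof -
  define \<psi> where "\<psi> = And (conjunction (\<lambda>i. All (2 * n) (Equal (Mult (Var (n + i)) (Var (2 * n))) (Mult (Var (2 * n)) (Var (n + i))))) n)
     (And (Neg (conjunction (\<lambda>i. Equal (Var (n + i)) Zero) n))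
       (Equal (term_sum (\<lambda>i. Mult (Var (n + i)) (Var i)) n) Zero))"
  \<comment> \<open>The valuation that the two quantifier blocks produce, kept in the literal form
    with \<open>0 + n\<close> and \<open>i - 0\<close> so that the unfolded sentence matches
    it.\<close>
  define val where "val x f i = (if n \<le> i \<and> i < n + n then f (i - n) else if 0 \<le> i \<and> i < 0 + n then x (i - 0) else \<zero>)"
    for x f :: "nat \<Rightarrow> 'a" and i :: nat
  have val: "val x f (n + i) = f i" "val x f i = x i" if "i < n" for x f i using that by (auto simp: val_def)
  have \<psi>: "sat R (val x f) \<psi> \<longleftrightarrow> (\<forall>i < n. \<forall>a \<in> carrier R. f i \<otimes> a = a \<otimes> f i) \<and>
      \<not> (\<forall>i < n. f i = \<zero>) \<and> psum (\<lambda>i. f i \<otimes> x i) n = \<zero>" for x f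
  proof -
    have "psum (\<lambda>i. val x f (n + i) \<otimes> val x f i) n = psum (\<lambda>i. f i \<otimes> x i) n"
      by (rule psum_cong) (simp add: val)
    then show ?thesis by (auto simp: \<psi>_def sat_conjunction teval_term_sum val)
  qed
  have "sat R (\<lambda>_. \<zero>) (dependent_sentence n) \<longleftrightarrow> (\<forall>x. (\<forall>i < n. x i \<in> carrier R) \<longrightarrow>
    (\<exists>f. (\<forall>i < n. f i \<in> carrier R) \<and> sat R (val x f) \<psi>))"
    unfolding dependent_sentence_def \<psi>_def[symmetric] val_def[abs_def] sat.simps sat_exists_block by blast
  also have "\<dots> \<longleftrightarrow> (\<forall>x. (\<forall>i < n. x i \<in> carrier R) \<longrightarrow> \<not> lin_indep (ring_center R) x n)"
  proof -
    have Z: "(\<forall>i < n. f i \<in> ring_center R) \<longleftrightarrow>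
      (\<forall>i < n. f i \<in> carrier R) \<and> (\<forall>i < n. \<forall>a \<in> carrier R. f i \<otimes> a = a \<otimes> f i)" for f
      unfolding ring_center_def by blast
    have "(\<exists>f. (\<forall>i < n. f i \<in> carrier R) \<and> sat R (val x f) \<psi>) \<longleftrightarrow> \<not> lin_indep (ring_center R) x n" for x
      unfolding \<psi> lin_indep_def Z not_all not_imp conj_assoc by (intro arg_cong[where f = Ex] ext) argo
    then show ?thesis by simp
  qed
  finally show ?thesis .
qed

text \<open>For the least possible bound there is an independent family with one element fewer. It
  is maximal, so it spans.\<close>

lemma (in skew_field) finite_dimension_center:
  assumes "\<And>x. (\<And>i. i < n \<Longrightarrow> x i \<in> carrier R) \<Longrightarrow> \<not> lin_indep (ring_center R) x n"
  shows "finite_dimension (ring_center R) (carrier R)"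
proof -
  define Z where "Z = ring_center R"
  have Z: "divsub Z"
  proof -
    have "Z = cent (carrier R) (carrier R)" by (auto simp: Z_def ring_center_def cent_def)
    then show ?thesis by (auto intro: divsub_cent divsub_carrier)
  qed
  have sf: "subfield Z R" unfolding Z_def by (rule subfield_ring_center)
  define P where "P n \<longleftrightarrow> (\<forall>x. (\<forall>i < n. x i \<in> carrier R) \<longrightarrow> \<not> lin_indep Z x n)" for n
  define k where "k = (LEAST n. P n)"
  have "P n" using assms by (auto simp: P_def Z_def)
  then have Pk: "P k" unfolding k_def by (rule LeastI)
  \<comment> \<open>The empty family is independent, so the least bound is a successor.\<close>
  have "\<not> P 0" by (simp add: P_def lin_indep_def)
  then obtain m where m: "k = Suc m" using Pk by (cases k) auto
  then have "\<not> P m" using not_less_Least[of m P] by (simp add: k_def)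
  then obtain h where h: "\<And>i. i < m \<Longrightarrow> h i \<in> carrier R" "lin_indep Z h m" by (auto simp: P_def)
  have us: "set (map h [0..<m]) \<subseteq> carrier R" using h(1) by auto
  note S = Span_is_subalgebra[OF sf us]
  have "x \<in> Span Z (map h [0..<m])" if x: "x \<in> carrier R" for x
  proof (rule ccontr)
    assume nS: "x \<notin> Span Z (map h [0..<m])"
    have ne: "x \<noteq> psum (\<lambda>i. f i \<otimes> h i) m" if f: "\<And>i. i < m \<Longrightarrow> f i \<in> Z" for f
    proof -
      have "psum (\<lambda>i. f i \<otimes> h i) j \<in> Span Z (map h [0..<m])" if "j \<le> m" for j
        using that
      proof (induction j)
        case 0 show ?case using Span_subgroup_props(2)[OF sf us] by simp
      next
        case (Suc j)
        have "h j \<in> Span Z (map h [0..<m])" using Span_base_incl[OF sf us] Suc.prems by auto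
        then have "f j \<otimes> h j \<in> Span Z (map h [0..<m])"
          using Span_smult_closed[OF sf us] f[of j] Suc.prems by simp
        then show ?case using Span_subgroup_props(3)[OF sf us] Suc by simp
      qed
      then show ?thesis using nS by auto
    qed
    have "lin_indep Z (h(m := x)) (Suc m)"
      by (rule lin_indep_extend[OF Z h(2,1) x]) (simp_all add: ne)
    moreover have "\<forall>i < Suc m. (h(m := x)) i \<in> carrier R" using h(1) x by (simp add: less_Suc_eq)
    ultimately show False using Pk unfolding m P_def by blast
  qed
  then have "Span Z (map h [0..<m]) = carrier R" using Span_in_carrier[OF _ us] subfieldE(3)[OF sf] by blast
  then show ?thesis using Span_finite_dimension[OF sf us] by (simp add: Z_def)
qed

theorem theorem2p9:
  fixes D :: "('a, 'b) ring_scheme"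
  assumes "skew_field D"
    and "superrosy TYPE('m) (ring_theory D)"
  shows "ring.finite_dimension D (ring_center D) (carrier D)"
proof -
  interpret D: skew_field D by (rule assms(1))
  obtain M :: "'m ring" and \<kappa> :: "'m rel" where M: "is_model M (ring_theory D)" and "monster \<kappa> M"
    and U: "\<forall>\<sigma> A. small \<kappa> M A \<longrightarrow> (\<forall>p \<in> complete_types M \<sigma> A. U_thorn_ordinal_valued \<kappa> M p)"
    using assms(2) unfolding superrosy_def by blast
  then have "super \<kappa> M" by (simp add: super_def is_model_def)
  moreover have "skew_field M" by (rule skew_field_model[OF assms(1) M])
  ultimately interpret M: super_skew M \<kappa> by (intro super_skew.intro super_skew_axioms.intro)
  obtain n where "\<And>x. (\<And>i. i < n \<Longrightarrow> x i \<in> carrier M) \<Longrightarrow> \<not> M.lin_indep (ring_center M) x n"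
    using M.bounded_independence by blast
  then have "sat M (\<lambda>_. \<zero>\<^bsub>M\<^esub>) (dependent_sentence n)" unfolding M.sat_dependent_sentence by blast
  then have "sat D (\<lambda>_. \<zero>\<^bsub>D\<^esub>) (dependent_sentence n)"
    using model_sat[OF M fvars_dependent_sentence] by blast
  then show ?thesis unfolding D.sat_dependent_sentence by (intro D.finite_dimension_center) blast
qed

end
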